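(* Let $n\ge 1$, $1<p,q<\infty$, $m\in\mathbb{R}$ and $0<\delta<1$. If $m>-\left|\frac1q-\frac12\right|\delta n$, then there exists a symbol $\sigma\in S^m_{1,\delta}$ such that the pseudo-differential operator $\sigma(X,D)$ is not bounded on $M^{p,q}(\mathbb{R}^n)$, i.e. there is no constant $C$ with $\|\sigma(X,D)f\|_{M^{p,q}}\le C\|f\|_{M^{p,q}}$ for all $f\in\mathcal{S}(\mathbb{R}^n)$.
   Context: Fourier transform: $\widehat f(\xi)=\mathcal{F}f(\xi)=\int_{\mathbb{R}^n}e^{-i\xi\cdot x}f(x)\,dx$, $\mathcal{F}^{-1}f(x)=(2\pi)^{-n}\int e^{ix\cdot\xi}f(\xi)\,d\xi$. For $m\in\mathbb{R}$, $0\le\delta\le\rho\le1$, the class $S^m_{\rho,\delta}$ consists of all $\sigma\in C^\infty(\mathbb{R}^n\times\mathbb{R}^n)$ with $|\partial_\xi^\alpha\partial_x^\beta\sigma(x,\xi)|\le C_{\alpha,\beta}(1+|\xi|)^{m-\rho|\alpha|+\delta|\beta|}$ for all multi-indices $\alpha,\beta$. For such $\sigma$, $\sigma(X,D)f(x)=(2\pi)^{-n}\int e^{ix\cdot\xi}\sigma(x,\xi)\widehat f(\xi)\,d\xi$ for $f\in\mathcal{S}(\mathbb{R}^n)$. Modulation spaces: fix a window $\gamma\in\mathcal{S}(\mathbb{R}^n)\setminus\{0\}$; for $f\in\mathcal{S}'(\mathbb{R}^n)$ the short-time Fourier transform is $V_\gamma f(x,\xi)=(f,M_\xi T_x\gamma)$,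 i.e. formally $\int f(t)\overline{\gamma(t-x)}e^{-i\xi\cdot t}\,dt$, where $M_\xi\gamma(t)=e^{i\xi\cdot t}\gamma(t)$, $T_x\gamma(t)=\gamma(t-x)$. For $1\le p,q\le\infty$, $M^{p,q}(\mathbb{R}^n)$ is the set of $f\in\mathcal{S}'(\mathbb{R}^n)$ with $\|f\|_{M^{p,q}}=\left(\int\left(\int|V_\gamma f(x,\xi)|^p\,dx\right)^{q/p}d\xi\right)^{1/q}<\infty$ (different windows give equivalent norms). *)

theory Defs
  imports "HOL-Analysis.Analysis"
begin

definition dderiv :: "'a::real_normed_vector \<Rightarrow> ('a \<Rightarrow> complex) \<Rightarrow> 'a \<Rightarrow> complex" where
  "dderiv v f x = vector_derivative (\<lambda>t::real. f (x + t *\<^sub>R v)) (at 0)"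

fun dderivs :: "'a::real_normed_vector list \<Rightarrow> ('a \<Rightarrow> complex) \<Rightarrow> 'a \<Rightarrow> complex" where
  "dderivs [] f = f"
| "dderivs (v # vs) f = dderiv v (dderivs vs f)"

definition smooth_dirs :: "'a::real_normed_vector set \<Rightarrow> ('a \<Rightarrow> complex) \<Rightarrow> bool" where
  "smooth_dirs D f \<longleftrightarrow>
     (\<forall>vs. set vs \<subseteq> D \<longrightarrow>
        continuous_on UNIV (dderivs vs f) \<and>
        (\<forall>v\<in>D. \<forall>x. (\<lambda>t::real. dderivs vs f (x + t *\<^sub>R v)) differentiable (at 0)))"

definition coord_dirs :: "(real^'n) set" where
  "coord_dirs = range (\<lambda>i. axis i 1)"

definition pd :: "'n list \<Rightarrow> (real^'n \<Rightarrow> complex) \<Rightarrow> real^'n \<Rightarrow> complex" where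
  "pd is f = dderivs (map (\<lambda>i. axis i 1) is) f"

definition schwartz :: "(real^'n \<Rightarrow> complex) set" where
  "schwartz = {f. smooth_dirs coord_dirs f \<and>
     (\<forall>(N::nat) is. \<exists>C. \<forall>x. (1 + norm x) ^ N * norm (pd is f x) \<le> C)}"

definition fourier :: "(real^'n \<Rightarrow> complex) \<Rightarrow> real^'n \<Rightarrow> complex" where
  "fourier f \<xi> = (\<integral>x. cis (- (\<xi> \<bullet> x)) * f x \<partial>lborel)"

definition x_dir :: "'n \<Rightarrow> (real^'n) \<times> (real^'n)" where
  "x_dir i = (axis i 1, 0)"

definition xi_dir :: "'n \<Rightarrow> (real^'n) \<times> (real^'n)" where
  "xi_dir i = (0, axis i 1)"

definition symbol_class :: "real \<Rightarrow> real \<Rightarrow> real \<Rightarrow> ((real^'n) \<times> (real^'n) \<Rightarrow> complex) set" where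
  "symbol_class m \<rho> \<delta> = {\<sigma>. smooth_dirs (range x_dir \<union> range xi_dir) \<sigma> \<and>
     (\<forall>(\<alpha>::'n list) (\<beta>::'n list). \<exists>C. \<forall>x \<xi>.
        norm (dderivs (map xi_dir \<alpha> @ map x_dir \<beta>) \<sigma> (x, \<xi>))
          \<le> C * (1 + norm \<xi>) powr (m - \<rho> * real (length \<alpha>) + \<delta> * real (length \<beta>)))}"

definition psido :: "((real^'n) \<times> (real^'n) \<Rightarrow> complex) \<Rightarrow> (real^'n \<Rightarrow> complex) \<Rightarrow> real^'n \<Rightarrow> complex" where
  "psido \<sigma> f x = complex_of_real ((2 * pi) powr (- real CARD('n))) *
     (\<integral>\<xi>. cis (x \<bullet> \<xi>) * \<sigma> (x, \<xi>) * fourier f \<xi> \<partial>lborel)"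

definition stft :: "(real^'n \<Rightarrow> complex) \<Rightarrow> (real^'n \<Rightarrow> complex) \<Rightarrow> real^'n \<Rightarrow> real^'n \<Rightarrow> complex" where
  "stft \<gamma> f x \<xi> = (\<integral>t. f t * cnj (\<gamma> (t - x)) * cis (- (\<xi> \<bullet> t)) \<partial>lborel)"

text \<open>Power of an extended nonnegative real with positive real exponent.\<close>
definition enn_powr :: "ennreal \<Rightarrow> real \<Rightarrow> ennreal" where
  "enn_powr a r = (if a = \<infinity> then \<infinity> else ennreal (enn2real a powr r))"

definition mod_norm :: "real \<Rightarrow> real \<Rightarrow> (real^'n \<Rightarrow> complex) \<Rightarrow> (real^'n \<Rightarrow> complex) \<Rightarrow> ennreal" where
  "mod_norm p q \<gamma> f = enn_powr
     (\<integral>\<^sup>+ \<xi>. enn_powr (\<integral>\<^sup>+ x. ennreal (norm (stft \<gamma> f x \<xi>) powr p) \<partial>lborel) (q / p) \<partial>lborel)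
     (1 / q)"

end

theory Submission
  imports Defs "HOL-Probability.Probability" "HOL-Complex_Analysis.Complex_Analysis"
    "HOL-Real_Asymp.Real_Asymp"
begin

text \<open>
  Let D be a power of two. The Rudin--Shapiro polynomials provide functions
  b(x) = D^(-1/2) * (sum over k < D of eps_k * exp(i * L * k * x)) with |eps_k| = 1 that are bounded
  uniformly in D and L, although their D frequencies, which are L apart, all carry the same weight
  D^(-1/2). Multiplication by the n-fold tensor power of b turns a Gaussian g into D^n well separated
  Gaussian wave packets; in the modulation space norm this gains the factor D^(n/q - n/2), since
  b is bounded but the l^q norm of the coefficients is D^(n/q - n/2). Conversely the conjugate of b
  times g is mapped to |b|^2 * g, whose packet at frequency 0 has weight one: the gain is then
  D^(n/2 - n/q).

  The symbol is the lacunary sum of 4^(j*m) * b_j(x) * psi(xi / 4^j), with psi a cutoff which is one near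
  3/2 and supported in [1, 2] in every coordinate, and with L_j * D_j = 4^(j*delta), which is exactly
  what makes it of type (1, delta). On a Gaussian modulated to frequency 3/2 * 4^j it acts as
  multiplication by 4^(j*m) * b_j up to an error O(4^(-j*M)) for every M, because the packets of
  the input are centred within 4^(j*delta) of 3/2 * 4^j and delta < 1. If D_j is close to 4^(j*delta), but with
  L_j still tending to infinity so that the packets decouple, the gain
  4^(j*m) * D_j^(n * |1/q - 1/2|) is unbounded, by the strict inequality assumed for m.
\<close>

section \<open>Smoothness along coordinate directions\<close>

text \<open>The number of packets enters the norm only through the frequency integral, so the gain
  depends on q and its exponent changes sign at q = 2: for q <= 2 it pays to split one packet into
  many, for q > 2 to recombine many into one. Two requirements compete. Neighbouring packets may
  disturb each other only by a small fraction, so L_j has to exceed a constant that depends on the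
  window, yet every factor given to L_j is taken from D_j. The window is quantified after the
  symbol, so no fixed L_j would do. For the same reason the Gaussian is adapted to the window: its
  width is chosen such that its transform with respect to the window is nonzero somewhere at
  frequency 0. The factors b_j and the test functions are restrictions of entire functions, so
  Cauchy's estimates on circles of suitable radius replace Bernstein's inequality and explicit
  derivatives of Gaussians. Test functions and pieces of the symbol are tensor products, which makes
  most estimates one-dimensional.\<close>

definition deriv_seq :: "(nat \<Rightarrow> real \<Rightarrow> complex) \<Rightarrow> bool" where
  "deriv_seq F \<longleftrightarrow> (\<forall>k x. (F k has_vector_derivative F (Suc k) x) (at x))"

lemma deriv_seqD: "deriv_seq F \<Longrightarrow> (F k has_vector_derivative F (Suc k) x) (at x)"
  unfolding deriv_seq_def by blast

lemma deriv_seq_continuous: "deriv_seq F \<Longrightarrow> continuous_on A (F k)"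
  by (meson continuous_on_eq_continuous_within continuous_on_subset deriv_seqD
      has_vector_derivative_continuous subset_UNIV)

lemma has_vector_derivative_shift:
  fixes f :: "real \<Rightarrow> 'b::real_normed_vector"
  assumes "(f has_vector_derivative d) (at a)"
  shows "((\<lambda>t. f (a + t)) has_vector_derivative d) (at 0)"
proof -
  have "((\<lambda>t. a + t) has_vector_derivative 1) (at (0::real))"
    by (auto intro!: derivative_eq_intros)
  from vector_diff_chain_at[OF this, of f d] assms
  show ?thesis by (simp add: o_def)
qed

text \<open>The functionals \<open>l\<close> are coordinates dual to the directions
  \<open>e\<close>: a step along \<open>e r\<close> moves coordinate r alone, so a single factor is
  differentiated. Keeping \<open>l\<close> and \<open>e\<close> abstract lets one lemma serve both
  R^n, with index type \<open>'n\<close>, and phase space, with index type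
  \<open>'n + 'n\<close>.\<close>

lemma tensor_dir_derivative:
  fixes l :: "'s::finite \<Rightarrow> 'a::real_normed_vector \<Rightarrow> real"
  assumes le: "\<And>s r y t. l s (y + t *\<^sub>R e r) = l s y + (if s = r then t else 0)"
    and W: "\<And>s. deriv_seq (W s)"
  shows "((\<lambda>t. c * (\<Prod>s\<in>UNIV. W s (k s) (l s (y + t *\<^sub>R e r)))) has_vector_derivative
           c * (\<Prod>s\<in>UNIV. W s (if s = r then Suc (k s) else k s) (l s y))) (at 0)"
proof -
  define A where "A = c * (\<Prod>s\<in>UNIV-{r}. W s (k s) (l s y))"
  have "((\<lambda>t. W r (k r) (l r y + t)) has_vector_derivative W r (Suc (k r)) (l r y)) (at 0)"
    by (intro has_vector_derivative_shift deriv_seqD W)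
  then have d: "((\<lambda>t. A * W r (k r) (l r y + t)) has_vector_derivative A * W r (Suc (k r)) (l r y)) (at 0)"
    by (rule has_vector_derivative_mult_right)
  have *: "(\<Prod>s\<in>UNIV. g s) = g r * (\<Prod>s\<in>UNIV-{r}. g s)" for g :: "'s \<Rightarrow> complex"
    by (rule prod.remove) auto
  have 1: "c * (\<Prod>s\<in>UNIV. W s (k s) (l s (y + t *\<^sub>R e r))) = A * W r (k r) (l r y + t)" for t
    unfolding A_def le by (subst *) (auto intro!: prod.cong)
  have 2: "c * (\<Prod>s\<in>UNIV. W s (if s = r then Suc (k s) else k s) (l s y)) = A * W r (Suc (k r)) (l r y)"
    unfolding A_def by (subst *) (auto intro!: prod.cong)
  show ?thesis unfolding 1 2 by (rule d)
qed

text \<open>Products whose factors are taken from derivative sequences are closed under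
  differentiation: each step advances the index of one factor. Storing all derivatives in
  \<open>W\<close> keeps iterated derivatives explicit, and the order of the directions
  disappears.\<close>

lemma dderivs_tensor:
  fixes l :: "'s::finite \<Rightarrow> 'a::real_normed_vector \<Rightarrow> real"
  assumes le: "\<And>s r y t. l s (y + t *\<^sub>R e r) = l s y + (if s = r then t else 0)"
    and W: "\<And>s. deriv_seq (W s)"
  shows "dderivs (map e ss) (\<lambda>y. c * (\<Prod>s\<in>UNIV. W s 0 (l s y)))
           = (\<lambda>y. c * (\<Prod>s\<in>UNIV. W s (count_list ss s) (l s y)))"
proof (induction ss)
  case Nil
  show ?case by simp
next
  case (Cons r ss)
  show ?case
  proof
    fix y
    have "dderivs (map e (r # ss)) (\<lambda>y. c * (\<Prod>s\<in>UNIV. W s 0 (l s y))) y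
      = vector_derivative (\<lambda>t. c * (\<Prod>s\<in>UNIV. W s (count_list ss s) (l s (y + t *\<^sub>R e r)))) (at 0)"
      by (simp add: Cons.IH dderiv_def)
    also have "\<dots> = c * (\<Prod>s\<in>UNIV. W s (if s = r then Suc (count_list ss s) else count_list ss s) (l s y))"
      by (rule vector_derivative_at) (rule tensor_dir_derivative[OF le W])
    also have "\<dots> = c * (\<Prod>s\<in>UNIV. W s (count_list (r # ss) s) (l s y))"
      by (intro arg_cong2[where f="(*)"] refl prod.cong) auto
    finally show "dderivs (map e (r # ss)) (\<lambda>y. c * (\<Prod>s\<in>UNIV. W s 0 (l s y))) y = \<dots>" .
  qed
qed

lemma smooth_dirs_tensor:
  fixes l :: "'s::finite \<Rightarrow> 'a::real_normed_vector \<Rightarrow> real"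
  assumes le: "\<And>s r y t. l s (y + t *\<^sub>R e r) = l s y + (if s = r then t else 0)"
    and cont: "\<And>s. continuous_on UNIV (l s)"
    and W: "\<And>s. deriv_seq (W s)"
  shows "smooth_dirs (range e) (\<lambda>y. c * (\<Prod>s\<in>UNIV. W s 0 (l s y)))"
  unfolding smooth_dirs_def
proof (intro allI impI conjI ballI)
  fix vs assume "set vs \<subseteq> range e"
  then obtain ss where vs: "vs = map e ss"
    by (metis ex_map_conv subsetD imageE)
  note d = dderivs_tensor[of l e W, OF le W]
  have "continuous_on UNIV (\<lambda>x. W s k (l s x))" for s k
    by (rule continuous_on_compose2[OF deriv_seq_continuous[OF W, of UNIV] cont]) auto
  then show "continuous_on UNIV (dderivs vs (\<lambda>y. c * (\<Prod>s\<in>UNIV. W s 0 (l s y))))"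
    unfolding vs d by (intro continuous_intros)
  fix v x assume "v \<in> range e"
  then obtain r where v: "v = e r" by auto
  show "(\<lambda>t. dderivs vs (\<lambda>y. c * (\<Prod>s\<in>UNIV. W s 0 (l s y))) (x + t *\<^sub>R v)) differentiable at 0"
    unfolding vs d v by (rule differentiableI_vector) (rule tensor_dir_derivative[OF le W])
qed

lemma dderivs_cong_open:
  fixes f g :: "'a::real_normed_vector \<Rightarrow> complex"
  assumes "open U" "\<And>y. y \<in> U \<Longrightarrow> f y = g y" "y \<in> U"
  shows "dderivs vs f y = dderivs vs g y"
  using assms(3)
proof (induction vs arbitrary: y)
  case Nil
  then show ?case using assms by simp
next
  case (Cons v vs)
  have "((\<lambda>t. y + t *\<^sub>R v) \<longlongrightarrow> y + 0 *\<^sub>R v) (nhds (0::real))"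
    by (intro tendsto_intros filterlim_ident)
  then have "\<forall>\<^sub>F t in nhds (0::real). y + t *\<^sub>R v \<in> U"
    using Cons.prems \<open>open U\<close> by (simp add: tendsto_def)
  then have "\<forall>\<^sub>F t in nhds 0. t \<in> UNIV \<longrightarrow> dderivs vs f (y + t *\<^sub>R v) = dderivs vs g (y + t *\<^sub>R v)"
    by eventually_elim (simp add: Cons.IH)
  then show ?case
    unfolding dderivs.simps dderiv_def by (intro vector_derivative_cong_eq) auto
qed

text \<open>Meant for the lacunary sum, which near every point coincides with one of its smooth
  terms, but with different terms near different points.\<close>

lemma smooth_dirs_local:
  fixes f :: "'a::real_normed_vector \<Rightarrow> complex"
  assumes "\<And>y. \<exists>U g. open U \<and> y \<in> U \<and> smooth_dirs D g \<and> (\<forall>z\<in>U. f z = g z)"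
  shows "smooth_dirs D f"
  unfolding smooth_dirs_def
proof (intro allI impI conjI ballI)
  fix vs assume vs: "set vs \<subseteq> D"
  show "continuous_on UNIV (dderivs vs f)"
  proof (rule continuous_at_imp_continuous_on, rule ballI)
    fix y
    obtain U g where U: "open U" "y \<in> U" "smooth_dirs D g" "\<forall>z\<in>U. f z = g z"
      using assms by blast
    have "isCont (dderivs vs g) y"
      using U(3) vs unfolding smooth_dirs_def by (simp add: continuous_on_eq_continuous_at)
    moreover have "\<forall>\<^sub>F z in nhds y. dderivs vs f z = dderivs vs g z"
      using eventually_nhds_in_open[OF U(1,2)]
      by eventually_elim (use U in \<open>auto intro!: dderivs_cong_open[of U]\<close>)
    ultimately show "isCont (dderivs vs f) y"
      using isCont_cong by blast
  qed
  fix v x assume v: "v \<in> D"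
  obtain U g where U: "open U" "x \<in> U" "smooth_dirs D g" "\<forall>z\<in>U. f z = g z"
    using assms by blast
  have "((\<lambda>t. x + t *\<^sub>R v) \<longlongrightarrow> x + 0 *\<^sub>R v) (nhds (0::real))"
    by (intro tendsto_intros filterlim_ident)
  then have "\<forall>\<^sub>F t in nhds (0::real). x + t *\<^sub>R v \<in> U"
    using U by (simp add: tendsto_def)
  then have ev: "\<forall>\<^sub>F t in nhds 0. dderivs vs g (x + t *\<^sub>R v) = dderivs vs f (x + t *\<^sub>R v)"
    by eventually_elim (use U in \<open>auto intro!: dderivs_cong_open[of U]\<close>)
  have "(\<lambda>t. dderivs vs g (x + t *\<^sub>R v)) differentiable at 0"
    using U(3) vs v unfolding smooth_dirs_def by blast
  then obtain d where "((\<lambda>t. dderivs vs g (x + t *\<^sub>R v)) has_derivative d) (at 0)"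
    by (auto simp: differentiable_def)
  then have "((\<lambda>t. dderivs vs f (x + t *\<^sub>R v)) has_derivative d) (at 0)"
    by (rule has_derivative_transform_eventually)
       (use ev in \<open>auto simp: eventually_at_filter elim: eventually_mono dest: eventually_nhds_x_imp_x\<close>)
  then show "(\<lambda>t. dderivs vs f (x + t *\<^sub>R v)) differentiable at 0"
    by (auto simp: differentiable_def)
qed

section \<open>Entire functions\<close>

text \<open>Complex derivatives restricted to the real axis are real derivatives. This is how the
  Rudin--Shapiro factors and the Gaussian test functions acquire derivative sequences that Cauchy's
  estimates can bound.\<close>

lemma deriv_seq_entire:
  assumes "F holomorphic_on UNIV"
  shows "deriv_seq (\<lambda>k t. (deriv ^^ k) F (of_real t))"
  unfolding deriv_seq_def
proof (intro allI)
  fix k and t :: real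
  have "(deriv ^^ k) F holomorphic_on UNIV"
    by (rule holomorphic_higher_deriv[OF assms]) auto
  then have "((deriv ^^ k) F has_field_derivative (deriv ^^ Suc k) F (of_real t)) (at (of_real t))"
    by (simp add: holomorphic_derivI)
  then show "((\<lambda>t. (deriv ^^ k) F (of_real t)) has_vector_derivative (deriv ^^ Suc k) F (of_real t)) (at t)"
    using has_vector_derivative_real_field by blast
qed

lemma Cauchy_bound_entire:
  assumes "F holomorphic_on UNIV" "0 < r" "\<And>w. norm (z - w) = r \<Longrightarrow> norm (F w) \<le> B"
  shows "norm ((deriv ^^ k) F z) \<le> fact k * B / r ^ k"
  by (rule Cauchy_inequality)
     (use assms holomorphic_on_subset holomorphic_on_imp_continuous_on in \<open>blast+\<close>)

section \<open>A smooth cutoff\<close>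

text \<open>Smoothness of finite order, in which the derivative is only asserted to exist: sums,
  products and compositions are then settled by induction on the order, without formulas for higher
  derivatives.\<close>

fun smooth_upto :: "nat \<Rightarrow> (real \<Rightarrow> real) \<Rightarrow> bool" where
  "smooth_upto 0 f = continuous_on UNIV f"
| "smooth_upto (Suc n) f = (\<exists>f'. (\<forall>x. (f has_real_derivative f' x) (at x)) \<and> smooth_upto n f')"

lemma smooth_upto_Suc: "smooth_upto (Suc n) f \<Longrightarrow> smooth_upto n f"
proof (induction n arbitrary: f)
  case 0
  then show ?case
    by (auto simp: continuous_on_eq_continuous_at intro: DERIV_isCont)
next
  case (Suc n)
  then show ?case by (metis smooth_upto.simps(2))
qed

lemma smooth_upto_add: "smooth_upto n f \<Longrightarrow> smooth_upto n g \<Longrightarrow> smooth_upto n (\<lambda>x. f x + g x)"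
proof (induction n arbitrary: f g)
  case 0
  then show ?case by (auto intro: continuous_intros)
next
  case (Suc n)
  then obtain f' g' where "\<forall>x. (f has_real_derivative f' x) (at x)" "smooth_upto n f'"
    "\<forall>x. (g has_real_derivative g' x) (at x)" "smooth_upto n g'" by auto
  with Suc.IH[of f' g'] show ?case
    by (auto intro!: exI[of _ "\<lambda>x. f' x + g' x"] derivative_intros)
qed

lemma smooth_upto_mult: "smooth_upto n f \<Longrightarrow> smooth_upto n g \<Longrightarrow> smooth_upto n (\<lambda>x. f x * g x)"
proof (induction n arbitrary: f g)
  case 0
  then show ?case by (auto intro: continuous_intros)
next
  case (Suc n)
  from Suc.prems obtain f' g' where d: "\<forall>x. (f has_real_derivative f' x) (at x)" "smooth_upto n f'"
    "\<forall>x. (g has_real_derivative g' x) (at x)" "smooth_upto n g'" by auto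
  have "smooth_upto n (\<lambda>x. f' x * g x + g' x * f x)"
    using Suc.IH d Suc.prems by (intro smooth_upto_add) (auto dest: smooth_upto_Suc simp del: smooth_upto.simps)
  with d show ?case
    by (auto intro!: exI[of _ "\<lambda>x. f' x * g x + g' x * f x"] DERIV_mult)
qed

lemma smooth_upto_compose: "smooth_upto n f \<Longrightarrow> smooth_upto n g \<Longrightarrow> smooth_upto n (\<lambda>x. f (g x))"
proof (induction n arbitrary: f g)
  case 0
  then show ?case by (auto intro: continuous_on_compose2)
next
  case (Suc n)
  from Suc.prems obtain f' g' where d: "\<forall>x. (f has_real_derivative f' x) (at x)" "smooth_upto n f'"
    "\<forall>x. (g has_real_derivative g' x) (at x)" "smooth_upto n g'" by auto
  have "smooth_upto n (\<lambda>x. f' (g x) * g' x)"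
    using Suc.IH d Suc.prems by (intro smooth_upto_mult) (auto dest: smooth_upto_Suc simp del: smooth_upto.simps)
  with d show ?case
    by (auto intro!: exI[of _ "\<lambda>x. f' (g x) * g' x"] DERIV_chain2[of f _ g])
qed

lemma smooth_upto_const: "smooth_upto n (\<lambda>x. c)"
  by (induction n arbitrary: c) (auto intro!: exI[of _ "\<lambda>x. 0"])

lemma smooth_upto_ident: "smooth_upto n (\<lambda>x. x)"
  by (cases n) (auto intro!: exI[of _ "\<lambda>x. 1"] smooth_upto_const continuous_intros)

text \<open>The polynomial is a parameter because differentiating exp(-1/t) produces polynomials in
  1/t as factors; the whole family is closed under differentiation, and one induction makes all its
  members smooth.\<close>

definition flat_exp :: "real poly \<Rightarrow> real \<Rightarrow> real" where
  "flat_exp p t = (if t > 0 then poly p (1 / t) * exp (- (1 / t)) else 0)"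

lemma poly_exp_tendsto_0: "((\<lambda>t. poly p (1 / t) * exp (- (1 / t))) \<longlongrightarrow> (0::real)) (at_right 0)"
proof -
  have *: "((\<lambda>u. poly p u * exp (- u)) \<longlongrightarrow> (0::real)) at_top"
  proof -
    have "((\<lambda>u. \<Sum>i\<le>degree p. coeff p i * (u ^ i / exp u)) \<longlongrightarrow> (\<Sum>i\<le>degree p. coeff p i * 0)) at_top"
      by (intro tendsto_intros tendsto_power_div_exp_0)
    moreover have "(\<Sum>i\<le>degree p. coeff p i * (u ^ i / exp u)) = poly p u * exp (- u)" for u
      by (simp add: poly_altdef sum_distrib_right exp_minus divide_inverse mult.assoc)
    ultimately show ?thesis by simp
  qed
  have "filterlim (\<lambda>t::real. 1 / t) at_top (at_right 0)"
    using filterlim_inverse_at_top_right by (simp add: divide_inverse)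
  from filterlim_compose[OF * this] show ?thesis .
qed

text \<open>With u = 1/t, and hence du/dt = -u^2, the derivative of p(u) exp(-u) is u^2 (p(u) -
  p'(u)) exp(-u). At the origin the derivative has to be found from the difference quotient.\<close>

lemma DERIV_flat_exp:
  "(flat_exp p has_real_derivative flat_exp ([:0,0,1:] * (p - pderiv p)) t) (at t)"
proof -
  consider "t > 0" | "t < 0" | "t = 0" by linarith
  then show ?thesis
  proof cases
    case 1
    have "((\<lambda>t. poly p (1 / t) * exp (- (1 / t))) has_real_derivative
       flat_exp ([:0,0,1:] * (p - pderiv p)) t) (at t)"
      using 1 by (auto intro!: derivative_eq_intros DERIV_chain2[OF poly_DERIV]
          simp: flat_exp_def field_simps power2_eq_square)
    then show ?thesis
      by (rule DERIV_cong_ev[THEN iffD1, rotated -1])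
         (use 1 eventually_nhds_in_open[of "{0<..}" t] in \<open>auto simp: flat_exp_def elim: eventually_mono\<close>)
  next
    case 2
    have "((\<lambda>t. 0) has_real_derivative flat_exp ([:0,0,1:] * (p - pderiv p)) t) (at t)"
      using 2 by (auto simp: flat_exp_def)
    then show ?thesis
      by (rule DERIV_cong_ev[THEN iffD1, rotated -1])
         (use 2 eventually_nhds_in_open[of "{..<0}" t] in \<open>auto simp: flat_exp_def elim: eventually_mono\<close>)
  next
    case 3
    have "((\<lambda>h. (flat_exp p (0 + h) - flat_exp p 0) / h) \<longlongrightarrow> 0) (at 0)"
      unfolding filterlim_split_at_real
    proof (rule filterlim_split_at)
      show "((\<lambda>h. (flat_exp p (0 + h) - flat_exp p 0) / h) \<longlongrightarrow> 0) (at_left 0)"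
        by (rule tendsto_eventually) (auto simp: flat_exp_def eventually_at_filter)
      \<comment> \<open>The difference quotient p(1/h) exp(-1/h) / h has the same shape as the
        function: \<open>pCons 0 p\<close> supplies the additional factor 1/h.\<close>
      have "((\<lambda>t. poly (pCons 0 p) (1 / t) * exp (- (1 / t))) \<longlongrightarrow> (0::real)) (at_right 0)"
        by (rule poly_exp_tendsto_0)
      then show "((\<lambda>h. (flat_exp p (0 + h) - flat_exp p 0) / h) \<longlongrightarrow> 0) (at_right 0)"
        by (rule Lim_transform_eventually) (auto simp: flat_exp_def eventually_at_filter)
    qed
    then show ?thesis using 3 by (simp add: DERIV_def flat_exp_def)
  qed
qed

lemma smooth_upto_flat_exp: "smooth_upto n (flat_exp p)"
proof (induction n arbitrary: p)
  case 0
  show ?case using DERIV_flat_exp by (auto simp: continuous_on_eq_continuous_at intro: DERIV_isCont)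
next
  case (Suc n)
  then show ?case using DERIV_flat_exp by auto
qed

text \<open>Derivatives are unique, so those promised by \<open>smooth_upto\<close> for the various
  orders are all given by \<open>deriv\<close> and fit together into one infinite sequence.\<close>

lemma deriv_seq_of_smooth_upto:
  assumes "\<And>n. smooth_upto n f"
  shows "deriv_seq (\<lambda>k t. complex_of_real ((deriv ^^ k) f t))"
proof -
  have step: "\<forall>n. smooth_upto n g \<Longrightarrow> (\<forall>x. (g has_real_derivative deriv g x) (at x)) \<and> (\<forall>n. smooth_upto n (deriv g))" for g
  proof -
    assume g: "\<forall>n. smooth_upto n g"
    have "smooth_upto (Suc 0) g" using g by blast
    then have "\<forall>x. (g has_real_derivative deriv g x) (at x)"
      by (metis smooth_upto.simps(2) DERIV_imp_deriv)
    moreover have "smooth_upto n (deriv g)" for n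
    proof -
      have "smooth_upto (Suc n) g" using g by blast
      then obtain g' where "\<forall>x. (g has_real_derivative g' x) (at x)" "smooth_upto n g'" by auto
      moreover have "g' = deriv g" using calculation(1) by (auto simp: fun_eq_iff intro!: DERIV_imp_deriv[symmetric])
      ultimately show ?thesis by simp
    qed
    ultimately show ?thesis by blast
  qed
  have "\<forall>n. smooth_upto n ((deriv ^^ k) f)" for k
    by (induction k) (use assms step in auto)
  then have "\<forall>x. ((deriv ^^ k) f has_real_derivative (deriv ^^ Suc k) f x) (at x)" for k
    using step by simp
  then show ?thesis
    unfolding deriv_seq_def
    by (metis has_vector_derivative_of_real has_real_derivative_iff_has_vector_derivative)
qed

lemma smooth_cutoff:
  obtains W where "deriv_seq W" "\<And>t. t \<in> {5/4..7/4} \<Longrightarrow> W 0 t = 1"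
    "\<And>k t. t \<notin> {1..2} \<Longrightarrow> W k t = 0" "\<And>k. \<exists>C. \<forall>t. norm (W k t) \<le> C"
proof -
  define h where "h = flat_exp 1"
  \<comment> \<open>For |t - 3/2| <= 1/4 the inner argument is at most 0, so the inner h vanishes
    and w = h(1/2) / h(1/2) = 1. For |t - 3/2| >= 1/2 it is at least 3, where h is at least 1/2, so
    the outer argument is at most 0 and w = 0. Differences and quotients are written as sums and
    products to fit the closure lemmas.\<close>
  define w where "w = (\<lambda>t::real. 1 / h (1/2) * h (1/2 + - 1 * h (16 * ((t + -3/2) * (t + -3/2) + -1/16))))"
  define W where "W = (\<lambda>k t. complex_of_real ((deriv ^^ k) w t))"
  have "smooth_upto n w" for n
    unfolding w_def h_def
    by (intro smooth_upto_mult smooth_upto_add smooth_upto_const smooth_upto_ident smooth_upto_compose[OF smooth_upto_flat_exp])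
  then have W: "deriv_seq W"
    unfolding W_def by (rule deriv_seq_of_smooth_upto)
  have h0: "h t = 0" if "t \<le> 0" for t
    using that by (simp add: h_def flat_exp_def)
  have W1: "W 0 t = 1" if "t \<in> {5/4..7/4}" for t
  proof -
    have "\<bar>t - 3/2\<bar> \<le> 1/4" using that by (auto simp: abs_if)
    then have "(t - 3/2)^2 \<le> (1/4)^2" by (metis abs_ge_zero power2_abs power_mono)
    then have "(t + -3/2) * (t + -3/2) + -1/16 \<le> 0" by (simp add: power2_eq_square)
    then have "h (16 * ((t + -3/2) * (t + -3/2) + -1/16)) = 0"
      by (intro h0) auto
    moreover have "h (1/2) \<noteq> 0" by (simp add: h_def flat_exp_def)
    ultimately show ?thesis by (simp add: W_def w_def)
  qed
  have w0: "w t = 0" if "t \<notin> {1..2}" for t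
  proof -
    have "\<bar>t - 3/2\<bar> \<ge> 1/2" using that by (auto simp: abs_if)
    then have "(t - 3/2)^2 \<ge> (1/2)^2" by (metis abs_ge_zero power2_abs power_mono zero_le_divide_1_iff zero_le_numeral)
    then have *: "16 * ((t + -3/2) * (t + -3/2) + -1/16) \<ge> 3" by (simp add: power2_eq_square)
    have "h u \<ge> 1/2" if "u \<ge> 3" for u
    proof -
      have "1 / u \<le> 1/3" using that by (simp add: field_simps)
      moreover have "exp (- (1/u)) \<ge> 1 + - (1/u)" by (rule exp_ge_add_one_self)
      ultimately have "exp (- (1/u)) \<ge> 1/2" by linarith
      then show ?thesis using that by (simp add: h_def flat_exp_def)
    qed
    from this[OF *] show ?thesis unfolding w_def by (simp add: h0)
  qed
  have W0: "W k t = 0" if "t \<notin> {1..2}" for k t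
  proof -
    have "open (- {1..2::real})" by (intro open_Compl closed_real_atLeastAtMost)
    have "(deriv ^^ k) w t = (deriv ^^ k) (\<lambda>_. 0) t"
      by (rule higher_deriv_cong_ev) (use eventually_nhds_in_open[OF \<open>open (- {1..2::real})\<close>, of t] that w0 in \<open>auto elim: eventually_mono\<close>)
    also have "(deriv ^^ k) (\<lambda>_. 0::real) = (\<lambda>_. 0)"
      by (induction k) auto
    finally show ?thesis by (simp add: W_def)
  qed
  have "\<exists>C. \<forall>t. norm (W k t) \<le> C" for k
  proof -
    have "bounded (W k ` {1..2})"
      by (intro compact_imp_bounded compact_continuous_image deriv_seq_continuous W) auto
    then obtain C where C: "\<forall>t\<in>{1..2}. norm (W k t) \<le> C"
      by (auto simp: bounded_iff)
    have "norm (W k t) \<le> max C 0" for t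
      by (cases "t \<in> {1..2}") (use C W0[of t k] in \<open>auto simp: max.coboundedI1\<close>)
    then show ?thesis by blast
  qed
  with W W1 W0 show thesis by (intro that[of W]) auto
qed

section \<open>Rudin--Shapiro polynomials\<close>

fun rs :: "nat \<Rightarrow> complex \<Rightarrow> complex \<times> complex" where
  "rs 0 w = (1, 1)"
| "rs (Suc N) w = (fst (rs N w) + w ^ 2 ^ N * snd (rs N w), fst (rs N w) - w ^ 2 ^ N * snd (rs N w))"

lemma rs_coeffs:
  "\<exists>a b :: nat \<Rightarrow> complex. (\<forall>k. norm (a k) = 1 \<and> norm (b k) = 1) \<and>
     (\<forall>w. rs N w = ((\<Sum>k<2^N. a k * w ^ k), (\<Sum>k<2^N. b k * w ^ k)))"
proof (induction N)
  case 0
  show ?case by (auto intro!: exI[of _ "\<lambda>_. 1"])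
next
  case (Suc N)
  then obtain a b :: "nat \<Rightarrow> complex" where ab: "\<And>k. norm (a k) = 1" "\<And>k. norm (b k) = 1"
    "\<And>w. rs N w = ((\<Sum>k<2^N. a k * w ^ k), (\<Sum>k<2^N. b k * w ^ k))" by blast
  have split: "(\<Sum>k<2^Suc N. g k) = (\<Sum>k<2^N. g k) + (\<Sum>k<2^N. g (2 ^ N + k))" for g :: "nat \<Rightarrow> complex"
  proof -
    have "(\<Sum>k<m+r. g k) = (\<Sum>k<m. g k) + (\<Sum>k<r. g (m + k))" for m r
      by (induction r) (auto simp: add.assoc)
    then show ?thesis by (simp add: mult_2)
  qed
  show ?case
  proof (intro exI conjI allI)
    show "norm (if k < 2^N then a k else b (k - 2^N)) = 1"
      "norm (if k < 2^N then a k else - b (k - 2^N)) = 1" for k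
      using ab by auto
    show "rs (Suc N) w = (\<Sum>k<2 ^ Suc N. (if k < 2^N then a k else b (k - 2^N)) * w ^ k,
              \<Sum>k<2 ^ Suc N. (if k < 2^N then a k else - b (k - 2^N)) * w ^ k)" for w
      unfolding split rs.simps(2) ab(3)
      by (simp add: power_add sum_distrib_left sum_negf mult_ac)
  qed
qed

text \<open>On the unit circle the parallelogram law doubles the sum of squares at each step. Off
  the circle the factor w^(2^N) may enlarge it; the exponents 1, 2, 4, ... of these losses add up to
  less than 2^N. Points off the circle are needed for Cauchy's estimates.\<close>

lemma rs_parallelogram:
  "norm (fst (rs N w)) ^ 2 + norm (snd (rs N w)) ^ 2 \<le> 2 ^ Suc N * (max 1 (norm w) ^ 2 ^ N) ^ 2"
proof (induction N)
  case 0
  show ?case by simp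
next
  case (Suc N)
  define P Q M where "P = fst (rs N w)" "Q = w ^ 2 ^ N * snd (rs N w)" "M = max 1 (norm w)"
  have M: "1 \<le> M ^ 2 ^ N" "norm w ^ 2 ^ N \<le> M ^ 2 ^ N" by (auto simp: P_Q_M_def intro!: power_mono)
  have "norm (P + Q) ^ 2 + norm (P - Q) ^ 2 = 2 * (norm P ^ 2 + norm Q ^ 2)"
    by (simp add: cmod_power2) (simp add: power2_eq_square algebra_simps)
  also have "norm Q ^ 2 \<le> (M ^ 2 ^ N) ^ 2 * norm (snd (rs N w)) ^ 2"
    using M by (auto simp: P_Q_M_def norm_mult norm_power power_mult_distrib intro!: mult_right_mono power_mono)
  also have "norm P ^ 2 \<le> (M ^ 2 ^ N) ^ 2 * norm (fst (rs N w)) ^ 2"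
    using mult_right_mono[of 1 "(M ^ 2 ^ N) ^ 2" "norm P ^ 2"] M(1) unfolding P_Q_M_def(1) by simp
  finally have "norm (P + Q) ^ 2 + norm (P - Q) ^ 2
      \<le> 2 * ((M ^ 2 ^ N) ^ 2 * (norm (fst (rs N w)) ^ 2 + norm (snd (rs N w)) ^ 2))"
    by (simp add: algebra_simps)
  also have "\<dots> \<le> 2 * ((M ^ 2 ^ N) ^ 2 * (2 ^ Suc N * (M ^ 2 ^ N) ^ 2))"
    using Suc.IH unfolding P_Q_M_def(3) by (intro mult_left_mono) auto
  also have "\<dots> = 2 ^ Suc (Suc N) * (M ^ 2 ^ Suc N) ^ 2"
  proof -
    have "M ^ 2 ^ Suc N = M ^ 2 ^ N * M ^ 2 ^ N" by (simp add: mult_2 power_add)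
    then show ?thesis by (simp add: power2_eq_square mult_ac)
  qed
  finally show ?case
    unfolding rs.simps(2) P_Q_M_def fst_conv snd_conv .
qed

lemma rs_norm_le:
  assumes "norm w ^ 2 ^ N \<le> exp 1"
  shows "norm (fst (rs N w)) \<le> 4 * sqrt (2 ^ N)"
proof -
  have "max 1 (norm w) ^ 2 ^ N \<le> exp 1" using assms by (auto simp: max_def)
  then have "(max 1 (norm w) ^ 2 ^ N)^2 \<le> (exp 1)^2" by (intro power_mono) auto
  \<comment> \<open>This rounding is the source of the constant 4: the square is at most 2 * 2^N * 8
    = (4 * sqrt (2^N))^2.\<close>
  also have "(exp 1 :: real)^2 \<le> 8"
    using e_less_272 power_mono[of "exp 1" "2.72::real" 2] by (simp add: power2_eq_square)
  finally have "norm (fst (rs N w)) ^ 2 + norm (snd (rs N w)) ^ 2 \<le> 2 ^ Suc N * 8"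
    by (intro order_trans[OF rs_parallelogram] mult_left_mono) auto
  then have "norm (fst (rs N w)) ^ 2 \<le> 2 ^ Suc N * 8"
    using zero_le_power2[of "norm (snd (rs N w))"] by linarith
  then have "norm (fst (rs N w)) ^ 2 \<le> (4 * sqrt (2 ^ N)) ^ 2" by (simp add: power_mult_distrib)
  then show ?thesis by (rule power2_le_imp_le) auto
qed

text \<open>
  As an entire function this stays bounded on the strip where |Im z| is at most 1 / (L * 2^N), so that
  Cauchy's estimates bound its derivatives on the real line by powers of L * 2^N.
\<close>

definition rs_b :: "nat \<Rightarrow> real \<Rightarrow> complex \<Rightarrow> complex" where
  "rs_b N L z = of_real (1 / sqrt (2 ^ N)) * fst (rs N (exp (\<i> * of_real L * z)))"

lemma rs_b_coeffs:
  "\<exists>c :: nat \<Rightarrow> complex. (\<forall>k. norm (c k) = 1 / sqrt (2 ^ N)) \<and>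
     (\<forall>L z. rs_b N L z = (\<Sum>k<2^N. c k * exp (\<i> * of_real (L * real k) * z)))"
proof -
  obtain a :: "nat \<Rightarrow> complex" where a: "\<And>k. norm (a k) = 1" "\<And>w. fst (rs N w) = (\<Sum>k<2^N. a k * w ^ k)"
    using rs_coeffs[of N] by force
  show ?thesis
  proof (intro exI conjI allI)
    show "norm (of_real (1 / sqrt (2 ^ N)) * a k) = 1 / sqrt (2 ^ N)" for k
      by (simp add: norm_mult a norm_divide)
    show "rs_b N L z = (\<Sum>k<2^N. of_real (1 / sqrt (2 ^ N)) * a k * exp (\<i> * of_real (L * real k) * z))" for L z
      unfolding rs_b_def a sum_distrib_left exp_of_nat_mult[symmetric]
      by (intro sum.cong refl) (simp add: mult_ac)
  qed
qed

lemma rs_b_holomorphic: "rs_b N L holomorphic_on UNIV"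
proof -
  obtain c :: "nat \<Rightarrow> complex" where "\<And>z. rs_b N L z = (\<Sum>k<2^N. c k * exp (\<i> * of_real (L * real k) * z))"
    using rs_b_coeffs by blast
  then show ?thesis
    by (subst holomorphic_cong[OF refl]) (auto intro!: holomorphic_intros)
qed

lemma rs_b_norm_le:
  assumes "0 \<le> L" "L * 2 ^ N * \<bar>Im z\<bar> \<le> 1"
  shows "norm (rs_b N L z) \<le> 4"
proof -
  have "norm (exp (\<i> * of_real L * z)) = exp (- L * Im z)" by (simp add: norm_exp_eq_Re)
  also have "\<dots> ^ 2 ^ N = exp (2 ^ N * (- L * Im z))"
    by (metis exp_of_nat_mult of_nat_numeral of_nat_power)
  also have "\<dots> \<le> exp 1"
  proof -
    have "2 ^ N * (- L * Im z) \<le> L * 2 ^ N * \<bar>Im z\<bar>"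
      using mult_left_mono[of "- Im z" "\<bar>Im z\<bar>" "L * 2 ^ N"] assms(1) by (simp add: mult_ac)
    then show ?thesis using assms(2) by simp
  qed
  finally have "norm (fst (rs N (exp (\<i> * of_real L * z)))) \<le> 4 * sqrt (2 ^ N)" by (rule rs_norm_le)
  then show ?thesis
    by (simp add: rs_b_def norm_mult norm_divide divide_simps)
qed

text \<open>Cauchy's estimate on a circle of radius 1 / R, which stays inside the strip of
  \<open>rs_b_norm_le\<close>. With R = 4^(j*delta), an x-derivative costs exactly what type (1,
  delta) allows.\<close>

lemma rs_b_higher_deriv:
  assumes "0 < R" "0 \<le> L" "L * 2 ^ N \<le> R"
  shows "norm ((deriv ^^ k) (rs_b N L) (of_real t)) \<le> 4 * fact k * R ^ k"
proof -
  have "norm ((deriv ^^ k) (rs_b N L) (of_real t)) \<le> fact k * 4 / (1 / R) ^ k"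
  proof (rule Cauchy_bound_entire[OF rs_b_holomorphic])
    fix w :: complex assume "norm (of_real t - w) = 1 / R"
    then have "\<bar>Im w\<bar> \<le> 1 / R" using abs_Im_le_cmod[of "of_real t - w"] by simp
    then have "L * 2 ^ N * \<bar>Im w\<bar> \<le> R * (1 / R)" using assms by (intro mult_mono) auto
    then show "norm (rs_b N L w) \<le> 4" using assms by (intro rs_b_norm_le) auto
  qed (use assms in auto)
  then show ?thesis using assms by (simp add: field_simps)
qed

section \<open>Integrals of tensor products\<close>

text \<open>Both measures agree on boxes. As a product measure, \<open>lborel\<close> on
  \<open>real^'n\<close> inherits Fubini's theorem in the only form used for tensor products: the
  integral of a product over the coordinates is the product of the integrals.\<close>

lemma lborel_vec:
  "(lborel :: (real^'n::finite) measure) = distr (\<Pi>\<^sub>M i\<in>UNIV. lborel) borel (\<lambda>f. \<chi> i. f i)"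
proof (rule lborel_eqI)
  interpret product_sigma_finite "\<lambda>_::'n. lborel :: real measure"
    by standard
  have meas [measurable]: "(\<lambda>f. \<chi> i. f i) \<in> measurable (\<Pi>\<^sub>M i\<in>(UNIV::'n set). lborel) (borel :: (real^'n) measure)"
    by (rule borel_measurable_euclidean_space[THEN iffD2]) (auto simp: Basis_vec_def inner_axis)
  fix l u :: "real^'n" assume le: "\<And>b. b \<in> Basis \<Longrightarrow> l \<bullet> b \<le> u \<bullet> b"
  have lei: "l$i \<le> u$i" for i
    using le[of "axis i 1"] by (auto simp: Basis_vec_def inner_axis)
  have "emeasure (distr (\<Pi>\<^sub>M i\<in>(UNIV::'n set). lborel) borel (\<lambda>f. \<chi> i. f i)) (box l u)
     = emeasure (\<Pi>\<^sub>M i\<in>(UNIV::'n set). lborel) (\<Pi>\<^sub>E i\<in>UNIV. {l$i<..<u$i})"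
    by (subst emeasure_distr[OF meas])
       (auto intro!: arg_cong[where f="emeasure _"] simp: space_PiM mem_box_cart PiE_iff)
  also have "\<dots> = (\<Prod>i\<in>UNIV. ennreal (u$i - l$i))"
    using lei by (subst emeasure_PiM) (auto intro!: prod.cong)
  also have "\<dots> = ennreal (\<Prod>i\<in>UNIV. (u - l)$i)"
    using lei by (subst prod_ennreal) auto
  also have "(\<Prod>i\<in>UNIV. (u - l)$i) = (\<Prod>b\<in>Basis. (u - l) \<bullet> b)"
    unfolding Basis_vec_def
    by (rule prod.reindex_cong[of "\<lambda>i. axis i 1", symmetric])
       (auto simp: inj_on_def axis_eq_axis inner_axis)
  finally show "emeasure (distr (\<Pi>\<^sub>M i\<in>(UNIV::'n set). lborel) borel (\<lambda>f. \<chi> i. f i)) (box l u)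
     = ennreal (\<Prod>b\<in>Basis. (u - l) \<bullet> b)" .
qed simp

lemma measurable_vec_lambda [measurable]:
  "(\<lambda>f. \<chi> i. f i) \<in> measurable (\<Pi>\<^sub>M i\<in>(UNIV::'n::finite set). lborel) (borel :: (real^'n) measure)"
  by (rule borel_measurable_euclidean_space[THEN iffD2]) (auto simp: Basis_vec_def inner_axis)

lemma measurable_vec_nth [measurable]: "(\<lambda>x::real^'n::finite. x $ i) \<in> borel_measurable borel"
  by (intro borel_measurable_continuous_onI continuous_intros)

lemma nn_integral_tensor:
  fixes f :: "'n::finite \<Rightarrow> real \<Rightarrow> ennreal"
  assumes [measurable]: "\<And>i. f i \<in> borel_measurable borel"
  shows "integral\<^sup>N lborel (\<lambda>x::real^'n. \<Prod>i\<in>UNIV. f i (x$i)) = (\<Prod>i\<in>UNIV. (\<integral>\<^sup>+ t. f i t \<partial>lborel))"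
proof -
  interpret product_sigma_finite "\<lambda>_::'n. lborel :: real measure"
    by standard
  show ?thesis
    unfolding lborel_vec
    by (subst nn_integral_distr) (auto intro: product_nn_integral_prod)
qed

lemma integral_tensor:
  fixes f :: "'n::finite \<Rightarrow> real \<Rightarrow> 'b::{real_normed_field,banach,second_countable_topology}"
  assumes f: "\<And>i. integrable lborel (f i)"
  shows "integrable lborel (\<lambda>x::real^'n. \<Prod>i\<in>UNIV. f i (x$i))"
    and "integral\<^sup>L lborel (\<lambda>x::real^'n. \<Prod>i\<in>UNIV. f i (x$i)) = (\<Prod>i\<in>UNIV. (\<integral> t. f i t \<partial>lborel))"
proof -
  interpret product_sigma_finite "\<lambda>_::'n. lborel :: real measure"
    by standard
  have [measurable]: "f i \<in> borel_measurable borel" for i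
    using borel_measurable_integrable[OF f] by simp
  show "integrable lborel (\<lambda>x::real^'n. \<Prod>i\<in>UNIV. f i (x$i))"
    unfolding lborel_vec
    by (subst integrable_distr_eq) (auto intro: product_integrable_prod f)
  show "integral\<^sup>L lborel (\<lambda>x::real^'n. \<Prod>i\<in>UNIV. f i (x$i)) = (\<Prod>i\<in>UNIV. (\<integral> t. f i t \<partial>lborel))"
    unfolding lborel_vec
    by (subst integral_distr) (auto intro: product_integral_prod f)
qed

lemma nn_integral_translate:
  fixes f :: "'a::euclidean_space \<Rightarrow> ennreal"
  assumes [measurable]: "f \<in> borel_measurable borel"
  shows "(\<integral>\<^sup>+ x. f (c + x) \<partial>lborel) = (\<integral>\<^sup>+ x. f x \<partial>lborel)"
proof -
  have "(\<integral>\<^sup>+ x. f x \<partial>lborel) = (\<integral>\<^sup>+ x. f x \<partial>distr lborel borel ((+) c))"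
    by (simp add: lborel_distr_plus)
  also have "\<dots> = (\<integral>\<^sup>+ x. f (c + x) \<partial>lborel)"
    by (subst nn_integral_distr) auto
  finally show ?thesis by simp
qed

lemma lborel_integral_translate:
  fixes f :: "'a::euclidean_space \<Rightarrow> 'b::{banach, second_countable_topology}"
  shows "integrable lborel f \<Longrightarrow> integrable lborel (\<lambda>x. f (c + x))"
    and "f \<in> borel_measurable borel \<Longrightarrow> (\<integral> x. f (c + x) \<partial>lborel) = (\<integral> x. f x \<partial>lborel)"
proof -
  have d: "distr lborel borel ((+) c) = (lborel :: 'a measure)"
    by (simp add: lborel_distr_plus)
  show "integrable lborel f \<Longrightarrow> integrable lborel (\<lambda>x. f (c + x))"
    using integrable_distr[of "(+) c" lborel borel f] by (simp add: d)
  show "f \<in> borel_measurable borel \<Longrightarrow> (\<integral> x. f (c + x) \<partial>lborel) = (\<integral> x. f x \<partial>lborel)"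
    by (subst (2) d[symmetric], subst integral_distr) auto
qed

subsection \<open>Decay weights\<close>

definition dec :: "real \<Rightarrow> real" where "dec t = 1 / (1 + \<bar>t\<bar>)"

text \<open>A product of one-dimensional weights rather than a power of 1 + |x|, so that integrals
  and lattice sums over R^n split into one-dimensional ones.\<close>

definition wt :: "nat \<Rightarrow> real^'n::finite \<Rightarrow> real" where "wt k x = (\<Prod>i\<in>UNIV. dec (x$i) ^ k)"

lemma dec_pos: "0 < dec t" and dec_le_1: "dec t \<le> 1"
  by (auto simp: dec_def field_simps)

lemma dec_nonneg: "0 \<le> dec t"
  using dec_pos less_imp_le by blast

lemma dec_continuous [continuous_intros]: "continuous_on A dec"
  unfolding dec_def by (intro continuous_intros) (auto simp: add_nonneg_eq_0_iff)

lemma measurable_dec [measurable]: "dec \<in> borel_measurable borel"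
  by (rule borel_measurable_continuous_onI) (rule dec_continuous)

lemma measurable_wt [measurable]: "wt k \<in> borel_measurable borel"
  unfolding wt_def by measurable

text \<open>Peetre's inequality: moving the centre of a weight by t costs a factor 1 + |t| for each
  power of decay.\<close>

lemma dec_submult: "dec (s + t) \<le> dec s * (1 + \<bar>t\<bar>)"
proof -
  have "1 + \<bar>s\<bar> \<le> (1 + \<bar>s + t\<bar>) * (1 + \<bar>t\<bar>)"
    by (simp add: algebra_simps) (smt (verit) abs_ge_zero mult_nonneg_nonneg)
  then show ?thesis by (simp add: dec_def field_simps)
qed

lemma wt_pos: "0 < wt k x" and wt_le_1: "wt k x \<le> 1"
  unfolding wt_def using dec_pos dec_le_1
  by (auto intro!: prod_pos prod_le_1 power_le_one simp: less_imp_le)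

lemma wt_nonneg: "0 \<le> wt k x"
  using wt_pos less_imp_le by blast

lemma wt_add: "wt (k + l) x = wt k x * wt l x"
  by (simp add: wt_def power_add prod.distrib)

lemma wt_mono: "k \<le> l \<Longrightarrow> wt l x \<le> wt k x"
  by (metis le_add_diff_inverse wt_add mult_left_le wt_le_1 wt_pos less_imp_le)

lemma norm_le_wt:
  fixes x :: "real^'n::finite"
  shows "1 / (1 + norm x) ^ (CARD('n) * k) \<le> wt k x"
proof -
  have "1 / (1 + norm x) ^ (CARD('n) * k) = (\<Prod>i\<in>(UNIV::'n set). (1 / (1 + norm x)) ^ k)"
    by (simp add: power_one_over power_mult[symmetric] mult.commute)
  also have "\<dots> \<le> wt k x"
    unfolding wt_def dec_def
    by (intro prod_mono conjI power_mono) (auto simp: component_le_norm_cart add_pos_nonneg intro!: divide_left_mono)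
  finally show ?thesis .
qed

text \<open>The largest coordinate controls the norm up to the factor n, and the other factors of
  the weight are at most 1.\<close>

lemma wt_le_norm:
  fixes x :: "real^'n::finite"
  shows "wt k x \<le> (real CARD('n) / (1 + norm x)) ^ k"
proof -
  obtain i where i: "norm x \<le> real CARD('n) * \<bar>x$i\<bar>"
  proof -
    obtain i where i: "\<And>j. \<bar>x$j\<bar> \<le> \<bar>x$i\<bar>"
    proof -
      have "Max (range (\<lambda>j. \<bar>x$j\<bar>)) \<in> range (\<lambda>j. \<bar>x$j\<bar>)" by (intro Max_in) auto
      then obtain i where "Max (range (\<lambda>j. \<bar>x$j\<bar>)) = \<bar>x$i\<bar>" by (rule rangeE)
      then have "\<bar>x$j\<bar> \<le> \<bar>x$i\<bar>" for j by (metis Max_ge finite finite_imageI rangeI)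
      then show thesis by (rule that)
    qed
    have "norm x \<le> (\<Sum>j\<in>UNIV. \<bar>x$j\<bar>)" by (rule norm_le_l1_cart)
    also have "\<dots> \<le> real CARD('n) * \<bar>x$i\<bar>" by (rule sum_bounded_above) (rule i)
    finally show thesis by (rule that)
  qed
  have "wt k x = dec (x$i) ^ k * (\<Prod>j\<in>UNIV-{i}. dec (x$j) ^ k)"
    unfolding wt_def by (rule prod.remove) auto
  also have "\<dots> \<le> dec (x$i) ^ k * 1"
    using dec_pos dec_le_1 by (intro mult_left_mono prod_le_1) (auto intro!: power_le_one simp: less_imp_le)
  also have "dec (x$i) ^ k \<le> (real CARD('n) / (1 + norm x)) ^ k"
  proof (intro power_mono)
    have "1 \<le> real CARD('n)" by simp
    then have "1 + norm x \<le> real CARD('n) + real CARD('n) * \<bar>x$i\<bar>" using i by (rule add_mono)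
    then have "1 + norm x \<le> real CARD('n) * (1 + \<bar>x$i\<bar>)" by (simp add: algebra_simps)
    then show "dec (x$i) \<le> real CARD('n) / (1 + norm x)"
      by (simp add: dec_def field_simps add_pos_nonneg)
  qed (simp add: dec_pos less_imp_le)
  finally show ?thesis by simp
qed

lemma dec_sq_integrable: "integrable lborel (\<lambda>t. dec t ^ 2)"
proof -
  have "set_integrable lborel (einterval (-\<infinity>) \<infinity>) (\<lambda>x. inverse (1 + x^2))"
    by (rule integrable_inverse_1_plus_square)
  then have i: "integrable lborel (\<lambda>x::real. inverse (1 + x^2))"
    by (simp add: set_integrable_def)
  show ?thesis
  proof (rule Bochner_Integration.integrable_bound[OF i])
    have "dec x ^ 2 \<le> inverse (1 + x^2)" for x
    proof -
      have "1 + x^2 \<le> (1 + \<bar>x\<bar>)^2" by (simp add: power2_eq_square algebra_simps)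
      then show ?thesis unfolding dec_def
        by (simp add: power_one_over inverse_eq_divide divide_simps add_pos_nonneg)
    qed
    then show "AE x in lborel. norm (dec x ^ 2) \<le> norm (inverse (1 + x^2))"
      by auto
  qed simp
qed

lemma dec_integrable: "2 \<le> k \<Longrightarrow> integrable lborel (\<lambda>t. dec t ^ k)"
  by (rule Bochner_Integration.integrable_bound[OF dec_sq_integrable])
     (auto intro!: power_decreasing simp: dec_pos dec_le_1 less_imp_le)

lemma wt_integrable: "2 \<le> k \<Longrightarrow> integrable lborel (wt k :: real^'n::finite \<Rightarrow> real)"
  unfolding wt_def[abs_def] by (intro integral_tensor dec_integrable)

section \<open>Gaussians\<close>

lemma gauss_fourier:
  fixes a s :: real
  assumes "0 < a"
  shows "integrable lborel (\<lambda>t. cis (s * t) * of_real (exp (- a * t^2)))"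
    and "(\<integral>t. cis (s * t) * of_real (exp (- a * t^2)) \<partial>lborel) = of_real (sqrt (pi / a) * exp (- (s^2) / (4 * a)))"
proof -
  \<comment> \<open>In the variable u = sigma * t the Gaussian exp(-a t^2) becomes exp(-u^2 / 2), so
    the characteristic function of the standard normal distribution applies.\<close>
  define \<sigma> where "\<sigma> = sqrt (2 * a)"
  have \<sigma>: "0 < \<sigma>" "\<sigma>^2 = 2 * a" using assms by (auto simp: \<sigma>_def)
  have d: "std_normal_density u *\<^sub>R iexp (s / \<sigma> * u) = of_real (1 / sqrt (2 * pi)) * (cis (s / \<sigma> * u) * of_real (exp (- (u^2) / 2)))" for u
    by (simp add: std_normal_density_def cis_conv_exp scaleR_conv_of_real mult_ac)
  have "integrable lborel (\<lambda>u. std_normal_density u *\<^sub>R iexp (s / \<sigma> * u))"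
  proof (rule Bochner_Integration.integrable_bound)
    show "integrable lborel std_normal_density"
      using integrable_std_normal_moment[of 0] by simp
  qed (auto simp: norm_mult)
  then have "integrable lborel (\<lambda>u. of_real (sqrt (2 * pi)) * (of_real (1 / sqrt (2 * pi)) * (cis (s / \<sigma> * u) * complex_of_real (exp (- (u^2) / 2)))))"
    unfolding d by (rule integrable_mult_right)
  then have int: "integrable lborel (\<lambda>u. cis (s / \<sigma> * u) * complex_of_real (exp (- (u^2) / 2)))"
    by simp
  have r: "cis (s / \<sigma> * (0 + \<sigma> * t)) * complex_of_real (exp (- ((0 + \<sigma> * t)^2) / 2)) = cis (s * t) * of_real (exp (- a * t^2))" for t
    using \<sigma> by (simp add: power_mult_distrib)
  have "integrable lborel (\<lambda>t. cis (s / \<sigma> * (0 + \<sigma> * t)) * complex_of_real (exp (- ((0 + \<sigma> * t)^2) / 2)))"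
    by (rule lborel_integrable_real_affine[OF int]) (use \<sigma> in auto)
  then show "integrable lborel (\<lambda>t. cis (s * t) * of_real (exp (- a * t^2)))"
    unfolding r .
  have "char std_normal_distribution (s / \<sigma>) = (\<integral>u. std_normal_density u *\<^sub>R iexp (s / \<sigma> * u) \<partial>lborel)"
    unfolding char_def by (subst integral_density) auto
  also have "\<dots> = of_real (1 / sqrt (2 * pi)) * (\<integral>u. cis (s / \<sigma> * u) * complex_of_real (exp (- (u^2) / 2)) \<partial>lborel)"
    unfolding d by (rule integral_mult_right_zero)
  finally have "(\<integral>u. cis (s / \<sigma> * u) * complex_of_real (exp (- (u^2) / 2)) \<partial>lborel)
      = of_real (sqrt (2 * pi) * exp (- ((s / \<sigma>)^2) / 2))"
    unfolding char_std_normal_distribution by (simp add: field_simps)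
  also have "(\<integral>u. cis (s / \<sigma> * u) * complex_of_real (exp (- (u^2) / 2)) \<partial>lborel)
     = \<bar>\<sigma>\<bar> *\<^sub>R (\<integral>t. cis (s / \<sigma> * (0 + \<sigma> * t)) * complex_of_real (exp (- ((0 + \<sigma> * t)^2) / 2)) \<partial>lborel)"
    by (rule lborel_integral_real_affine) (use \<sigma> in auto)
  finally have *: "of_real \<sigma> * (\<integral>t. cis (s * t) * of_real (exp (- a * t^2)) \<partial>lborel) = complex_of_real (sqrt (2 * pi) * exp (- ((s / \<sigma>)^2) / 2))"
    unfolding r using \<sigma> by (simp add: scaleR_conv_of_real)
  have "sqrt (2 * pi) / \<sigma> = sqrt (pi / a)" by (simp add: \<sigma>_def real_sqrt_divide real_sqrt_mult)
  moreover have "- ((s / \<sigma>)^2) / 2 = - (s^2) / (4 * a)" using \<sigma> by (simp add: power_divide)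
  ultimately have "complex_of_real (sqrt (2 * pi) * exp (- ((s / \<sigma>)^2) / 2)) = of_real \<sigma> * of_real (sqrt (pi / a) * exp (- (s^2) / (4 * a)))"
    using \<sigma> by (metis (no_types, lifting) less_irrefl mult.assoc nonzero_mult_div_cancel_left of_real_mult times_divide_eq_right)
  with * show "(\<integral>t. cis (s * t) * of_real (exp (- a * t^2)) \<partial>lborel) = of_real (sqrt (pi / a) * exp (- (s^2) / (4 * a)))"
    using \<sigma> by simp
qed

section \<open>Schwartz functions and the short-time Fourier transform\<close>

lemma schwartz_continuous: "G \<in> schwartz \<Longrightarrow> continuous_on UNIV G"
  unfolding schwartz_def smooth_dirs_def by (auto dest: spec[of _ "[]"])

lemma schwartz_measurable: "G \<in> schwartz \<Longrightarrow> G \<in> borel_measurable borel"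
  by (intro borel_measurable_continuous_onI schwartz_continuous)

lemma schwartz_wt_bound:
  fixes G :: "real^'n::finite \<Rightarrow> complex"
  assumes "G \<in> schwartz"
  obtains C where "0 \<le> C" "\<And>x. norm (G x) \<le> C * wt k x"
proof -
  obtain C where C: "\<And>x. (1 + norm x) ^ (CARD('n) * k) * norm (pd [] G x) \<le> C"
    using assms unfolding schwartz_def by blast
  then have C: "\<And>x. (1 + norm x) ^ (CARD('n) * k) * norm (G x) \<le> C"
    by (simp add: pd_def)
  from C[of 0] have C0: "0 \<le> C" by (simp add: order_trans[OF norm_ge_zero])
  have "norm (G x) \<le> C * wt k x" for x
  proof -
    have p: "0 < (1 + norm x) ^ (CARD('n) * k)" by (simp add: add_pos_nonneg)
    have "norm (G x) \<le> C * (1 / (1 + norm x) ^ (CARD('n) * k))"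
      using C[of x] p by (simp add: field_simps)
    also have "\<dots> \<le> C * wt k x" by (intro mult_left_mono norm_le_wt C0)
    finally show ?thesis .
  qed
  with C0 show thesis by (rule that)
qed

lemma schwartz_dderiv:
  fixes G :: "real^'n::finite \<Rightarrow> complex"
  assumes "G \<in> schwartz"
  shows "dderiv (axis i 1) G \<in> schwartz"
    and "((\<lambda>t. G (x + t *\<^sub>R axis i 1)) has_vector_derivative dderiv (axis i 1) G x) (at 0)"
proof -
  have app: "dderivs vs (dderiv v G) = dderivs (vs @ [v]) G" for vs v
    by (induction vs) auto
  have dir: "axis i 1 \<in> coord_dirs" by (auto simp: coord_dirs_def)
  have sm: "smooth_dirs coord_dirs G" using assms by (simp add: schwartz_def)
  have "smooth_dirs coord_dirs (dderiv (axis i 1) G)"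
    unfolding smooth_dirs_def
  proof (intro allI impI)
    fix vs :: "(real^'n) list" assume "set vs \<subseteq> coord_dirs"
    then have "set (vs @ [axis i 1]) \<subseteq> coord_dirs" using dir by auto
    then show "continuous_on UNIV (dderivs vs (dderiv (axis i 1) G)) \<and>
        (\<forall>v\<in>coord_dirs. \<forall>x. (\<lambda>t. dderivs vs (dderiv (axis i 1) G) (x + t *\<^sub>R v)) differentiable at 0)"
      using sm unfolding smooth_dirs_def app by blast
  qed
  moreover have "\<exists>C. \<forall>x. (1 + norm x) ^ N * norm (pd is (dderiv (axis i 1) G) x) \<le> C" for N "is"
  proof -
    have "pd is (dderiv (axis i 1) G) = pd (is @ [i]) G" by (simp add: pd_def app)
    then show ?thesis using assms unfolding schwartz_def by simp
  qed
  ultimately show "dderiv (axis i 1) G \<in> schwartz" by (simp add: schwartz_def)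
  have "(\<lambda>t. G (x + t *\<^sub>R axis i 1)) differentiable at 0"
    using sm dir unfolding smooth_dirs_def by (auto dest: spec[of _ "[]"])
  then show "((\<lambda>t. G (x + t *\<^sub>R axis i 1)) has_vector_derivative dderiv (axis i 1) G x) (at 0)"
    unfolding dderiv_def by (simp add: vector_derivative_works)
qed

lemma schwartz_has_vector_derivative_line:
  fixes G :: "real^'n::finite \<Rightarrow> complex"
  assumes "G \<in> schwartz"
  shows "((\<lambda>t. G (x + t *\<^sub>R axis i 1)) has_vector_derivative dderiv (axis i 1) G (x + s *\<^sub>R axis i 1)) (at s)"
proof -
  have "((\<lambda>t. G ((x + s *\<^sub>R axis i 1) + (t - s) *\<^sub>R axis i 1)) has_vector_derivative dderiv (axis i 1) G (x + s *\<^sub>R axis i 1)) (at s)"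
  proof -
    have 1: "((\<lambda>t. t - s) has_vector_derivative 1) (at s)"
      by (auto intro!: derivative_eq_intros)
    have 2: "((\<lambda>t. G ((x + s *\<^sub>R axis i 1) + t *\<^sub>R axis i 1)) has_vector_derivative
        dderiv (axis i 1) G (x + s *\<^sub>R axis i 1)) (at (s - s))"
      using schwartz_dderiv(2)[OF assms, where i=i and x="x + s *\<^sub>R axis i 1"] by simp
    from vector_diff_chain_at[OF 1 2] show ?thesis by (simp add: o_def)
  qed
  then show ?thesis by (simp add: algebra_simps)
qed

lemma schwartz_cnj:
  fixes G :: "real^'n::finite \<Rightarrow> complex"
  assumes "G \<in> schwartz"
  shows "(\<lambda>x. cnj (G x)) \<in> schwartz"
proof -
  have sm: "smooth_dirs coord_dirs G" using assms by (simp add: schwartz_def)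
  have hv: "((\<lambda>t. cnj (h t)) has_vector_derivative cnj d) (at a)"
    if "(h has_vector_derivative d) (at a)" for h :: "real \<Rightarrow> complex" and d a
    using bounded_linear.has_vector_derivative[OF bounded_linear_cnj that] .
  have d: "dderivs vs (\<lambda>x. cnj (G x)) = (\<lambda>x. cnj (dderivs vs G x))" if "set vs \<subseteq> coord_dirs" for vs
    using that
  proof (induction vs)
    case Nil
    show ?case by simp
  next
    case (Cons v vs)
    show ?case
    proof
      fix x
      have "(\<lambda>t. dderivs vs G (x + t *\<^sub>R v)) differentiable at 0"
        using sm Cons.prems unfolding smooth_dirs_def by auto
      then have "((\<lambda>t. dderivs vs G (x + t *\<^sub>R v)) has_vector_derivative dderivs (v # vs) G x) (at 0)"
        by (simp add: dderiv_def vector_derivative_works)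
      from hv[OF this] show "dderivs (v # vs) (\<lambda>x. cnj (G x)) x = cnj (dderivs (v # vs) G x)"
        using Cons by (simp add: dderiv_def vector_derivative_at)
    qed
  qed
  have "smooth_dirs coord_dirs (\<lambda>x. cnj (G x))"
    unfolding smooth_dirs_def
  proof (intro allI impI conjI ballI)
    fix vs :: "(real^'n) list" assume vs: "set vs \<subseteq> coord_dirs"
    show "continuous_on UNIV (dderivs vs (\<lambda>x. cnj (G x)))"
      using sm vs unfolding d[OF vs] smooth_dirs_def by (intro continuous_on_cnj) blast
    fix v :: "real^'n" and x assume "v \<in> coord_dirs"
    then have "(\<lambda>t. dderivs vs G (x + t *\<^sub>R v)) differentiable at 0"
      using sm vs unfolding smooth_dirs_def by auto
    then have "((\<lambda>t. dderivs vs G (x + t *\<^sub>R v)) has_vector_derivative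
        vector_derivative (\<lambda>t. dderivs vs G (x + t *\<^sub>R v)) (at 0)) (at 0)"
      by (simp add: vector_derivative_works)
    from hv[OF this] show "(\<lambda>t. dderivs vs (\<lambda>x. cnj (G x)) (x + t *\<^sub>R v)) differentiable at 0"
      unfolding d[OF vs] by (rule differentiableI_vector)
  qed
  moreover have "\<exists>C. \<forall>x. (1 + norm x) ^ N * norm (pd is (\<lambda>x. cnj (G x)) x) \<le> C" for N "is"
  proof -
    have "pd is (\<lambda>x. cnj (G x)) = (\<lambda>x. cnj (pd is G x))"
      unfolding pd_def by (rule d) (auto simp: coord_dirs_def)
    then show ?thesis using assms unfolding schwartz_def by simp
  qed
  ultimately show ?thesis by (simp add: schwartz_def)
qed

section \<open>Integration by parts on R^n\<close>

lemma wt_shift_axis: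
  assumes "\<bar>s\<bar> \<le> 1"
  shows "wt 2 (x + s *\<^sub>R axis i 1) \<le> 4 * wt 2 (x :: real^'n::finite)"
proof -
  have 1: "wt 2 y = dec (y$i) ^ 2 * (\<Prod>j\<in>UNIV-{i}. dec (y$j) ^ 2)" for y :: "real^'n"
    unfolding wt_def by (rule prod.remove) auto
  have "dec (x$i + s) \<le> 2 * dec (x$i)"
  proof -
    have "dec (x$i) * (1 + \<bar>s\<bar>) \<le> dec (x$i) * 2"
      using assms dec_pos[of "x$i"] by (intro mult_left_mono) auto
    then show ?thesis using dec_submult[of "x$i" s] by linarith
  qed
  then have "dec (x$i + s) ^ 2 \<le> (2 * dec (x$i)) ^ 2"
    by (intro power_mono) (auto simp: dec_pos less_imp_le)
  then have "dec (x$i + s) ^ 2 * (\<Prod>j\<in>UNIV-{i}. dec (x$j) ^ 2) \<le> (4 * dec (x$i) ^ 2) * (\<Prod>j\<in>UNIV-{i}. dec (x$j) ^ 2)"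
    by (intro mult_right_mono prod_nonneg) (auto simp: power_mult_distrib)
  moreover have "(x + s *\<^sub>R axis i 1) $ i = x$i + s" by simp
  moreover have "(\<Prod>j\<in>UNIV-{i}. dec ((x + s *\<^sub>R axis i 1)$j) ^ 2) = (\<Prod>j\<in>UNIV-{i}. dec (x$j) ^ 2)"
    by (intro prod.cong) (auto simp: axis_def)
  ultimately show ?thesis unfolding 1 by (simp add: mult_ac)
qed

lemma has_vector_derivative_quotient:
  fixes f :: "real \<Rightarrow> 'b::real_normed_vector"
  assumes "(f has_vector_derivative d) (at 0)"
  shows "((\<lambda>h. (f h - f 0) /\<^sub>R h) \<longlongrightarrow> d) (at 0)"
proof -
  have L: "((\<lambda>h. norm (f h - f 0 - h *\<^sub>R d) / norm h) \<longlongrightarrow> 0) (at 0)"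
    using assms by (simp add: has_vector_derivative_def has_derivative_at)
  have "((\<lambda>h. (f h - f 0) /\<^sub>R h - d) \<longlongrightarrow> 0) (at 0)"
  proof (rule tendsto_norm_zero_cancel, rule Lim_transform_eventually[OF L])
    have "norm (f h - f 0 - h *\<^sub>R d) / norm h = norm ((f h - f 0) /\<^sub>R h - d)" if "h \<noteq> 0" for h :: real
    proof -
      have "(f h - f 0) /\<^sub>R h - d = (f h - f 0 - h *\<^sub>R d) /\<^sub>R h"
        using that by (simp add: scaleR_diff_right)
      then show ?thesis by (simp add: divide_inverse mult.commute)
    qed
    then show "\<forall>\<^sub>F h in at 0. norm (f h - f 0 - h *\<^sub>R d) / norm h = norm ((f h - f 0) /\<^sub>R h - d)"
      by (auto simp: eventually_at_filter)
  qed
  then show ?thesis by (simp add: LIM_zero_iff)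
qed

text \<open>Difference quotients have integral zero by translation invariance, and they converge to
  \<open>u'\<close>. The mean value inequality and \<open>wt_shift_axis\<close>, valid for steps of
  length at most 1, provide the dominating function.\<close>

lemma integral_derivative_zero:
  fixes u u' :: "real^'n::finite \<Rightarrow> complex"
  assumes u: "integrable lborel u" and u': "u' \<in> borel_measurable borel"
    and d: "\<And>x s. ((\<lambda>t. u (x + t *\<^sub>R axis i 1)) has_vector_derivative u' (x + s *\<^sub>R axis i 1)) (at s)"
    and B: "\<And>x. norm (u' x) \<le> B * wt 2 x"
  shows "(\<integral>x. u' x \<partial>lborel) = 0"
proof -
  have "0 \<le> B * wt 2 (0::real^'n)" by (rule order_trans[OF norm_ge_zero B])
  then have B0: "0 \<le> B" using wt_pos[of 2 "0::real^'n"] by (simp add: zero_le_mult_iff)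
  define h :: "nat \<Rightarrow> real" where "h k = inverse (real (Suc k))" for k
  have h: "0 < h k" "h k \<le> 1" for k by (auto simp: h_def field_simps)
  have hl: "h \<longlonglongrightarrow> 0" unfolding h_def by (rule LIMSEQ_inverse_real_of_nat)
  define D where "D k x = (u (x + h k *\<^sub>R axis i 1) - u x) /\<^sub>R h k" for k x
  have um [measurable]: "u \<in> borel_measurable borel" using u by simp
  note tr = lborel_integral_translate[where f=u and c="h k *\<^sub>R axis i 1" for k, unfolded add.commute[of "_ *\<^sub>R _"]]
  have D0: "(\<integral>x. D k x \<partial>lborel) = 0" for k
    unfolding D_def using tr(1)[OF u] tr(2)[OF um] u by (simp add: Bochner_Integration.integral_diff)
  have "(\<lambda>k. \<integral>x. D k x \<partial>lborel) \<longlonglongrightarrow> (\<integral>x. u' x \<partial>lborel)"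
  proof (rule integral_dominated_convergence[where w="\<lambda>x. B * 4 * wt 2 x"])
    show "integrable lborel (\<lambda>x::real^'n. B * 4 * wt 2 x)" by (intro integrable_mult_right wt_integrable) simp
    show "AE x in lborel. (\<lambda>k. D k x) \<longlonglongrightarrow> u' x"
    proof (rule AE_I2)
      fix x
      have "((\<lambda>t. (u (x + t *\<^sub>R axis i 1) - u x) /\<^sub>R t) \<longlongrightarrow> u' x) (at 0)"
        using has_vector_derivative_quotient[of "\<lambda>t. u (x + t *\<^sub>R axis i 1)" "u' x"] d[of x 0] by simp
      moreover have "filterlim h (at 0) sequentially"
        using hl h(1) by (auto simp: filterlim_at less_imp_neq[symmetric] intro!: always_eventually)
      ultimately show "(\<lambda>k. D k x) \<longlonglongrightarrow> u' x"
        unfolding D_def by (rule filterlim_compose)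
    qed
    show "AE x in lborel. norm (D k x) \<le> B * 4 * wt 2 x" for k
    proof (rule AE_I2)
      fix x
      have "norm (u (x + h k *\<^sub>R axis i 1) - u (x + 0 *\<^sub>R axis i 1)) \<le> (B * 4 * wt 2 x) * norm (h k - 0)"
      proof (rule differentiable_bound[of "{0..h k}" "\<lambda>t. u (x + t *\<^sub>R axis i 1)" "\<lambda>s r. r *\<^sub>R u' (x + s *\<^sub>R axis i 1)"])
        fix s assume s: "s \<in> {0..h k}"
        show "((\<lambda>t. u (x + t *\<^sub>R axis i 1)) has_derivative (\<lambda>r. r *\<^sub>R u' (x + s *\<^sub>R axis i 1))) (at s within {0..h k})"
          using has_vector_derivative_at_within[OF d, of x s "{0..h k}"] by (simp add: has_vector_derivative_def)
        have "\<bar>s\<bar> \<le> 1" using s h[of k] by auto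
        then have "B * wt 2 (x + s *\<^sub>R axis i 1) \<le> B * (4 * wt 2 x)"
          by (intro mult_left_mono wt_shift_axis B0)
        then have "norm (u' (x + s *\<^sub>R axis i 1)) \<le> B * 4 * wt 2 x"
          using B[of "x + s *\<^sub>R axis i 1"] by simp
        then show "onorm (\<lambda>r. r *\<^sub>R u' (x + s *\<^sub>R axis i 1)) \<le> B * 4 * wt 2 x"
          by (intro onorm_le) (auto simp: mult.commute intro!: mult_left_mono)
      qed (use h[of k] in auto)
      moreover have "norm (D k x) = norm (u (x + h k *\<^sub>R axis i 1) - u x) / h k"
        unfolding D_def norm_scaleR using h[of k] by (simp add: divide_inverse mult.commute)
      ultimately show "norm (D k x) \<le> B * 4 * wt 2 x"
        using h[of k] by (simp add: pos_divide_le_eq)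
    qed
    show "D k \<in> borel_measurable lborel" for k unfolding D_def[abs_def] by measurable
  qed (use u' in simp)
  with D0 show ?thesis by (simp add: LIMSEQ_const_iff)
qed

text \<open>The window enters without conjugation, which makes the transform bilinear: integration
  by parts replaces either argument by its derivative, and the induction in
  \<open>stft2_bound\<close> treats both alike.\<close>

definition stft2 :: "(real^'n::finite \<Rightarrow> complex) \<Rightarrow> (real^'n \<Rightarrow> complex) \<Rightarrow> real^'n \<Rightarrow> real^'n \<Rightarrow> complex" where
  "stft2 G H x \<xi> = (\<integral>t. G t * H (t - x) * cis (- (\<xi> \<bullet> t)) \<partial>lborel)"

lemma stft_eq_stft2: "stft \<gamma> f = stft2 f (\<lambda>x. cnj (\<gamma> x))"
  by (simp add: stft_def stft2_def fun_eq_iff)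

text \<open>Peetre's inequality once more. It turns localisation of one factor near t = 0 and of the
  other near t = x into decay in x.\<close>

lemma wt_convolve: "wt k (t - x) * wt k t \<le> wt k (x :: real^'n::finite)"
proof -
  have "dec (a - b) * dec a \<le> dec b" for a b :: real
  proof -
    have "1 + \<bar>b\<bar> \<le> (1 + \<bar>a - b\<bar>) * (1 + \<bar>a\<bar>)"
      by (simp add: algebra_simps) (smt (verit) abs_ge_zero mult_nonneg_nonneg)
    then show ?thesis by (simp add: dec_def field_simps)
  qed
  then show ?thesis
    unfolding wt_def prod.distrib[symmetric] power_mult_distrib[symmetric]
    by (intro prod_mono conjI power_mono) (auto simp: dec_pos less_imp_le)
qed

lemma stft2_integrable:
  fixes G H :: "real^'n::finite \<Rightarrow> complex"
  assumes "G \<in> schwartz" "H \<in> schwartz"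
  shows "integrable lborel (\<lambda>t. G t * H (t - x) * cis (- (\<xi> \<bullet> t)))"
    and "\<exists>B. \<forall>x \<xi> t. norm (G t * H (t - x) * cis (- (\<xi> \<bullet> t))) \<le> B * wt 2 t * wt A x"
proof -
  \<comment> \<open>Of the A + 2 powers of decay of G, two make the integral over t converge; the
    other A combine with those of H into decay in x.\<close>
  obtain C1 where C1: "0 \<le> C1" "\<And>x. norm (G x) \<le> C1 * wt (A + 2) x" using schwartz_wt_bound[OF assms(1), where k="A + 2"] by blast
  obtain C2 where C2: "0 \<le> C2" "\<And>x. norm (H x) \<le> C2 * wt A x" using schwartz_wt_bound[OF assms(2), where k=A] by blast
  have b: "norm (G t * H (t - x) * cis (- (\<xi> \<bullet> t))) \<le> C1 * C2 * wt 2 t * wt A x" for x \<xi> t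
  proof -
    have "norm (G t * H (t - x) * cis (- (\<xi> \<bullet> t))) \<le> (C1 * wt (A + 2) t) * (C2 * wt A (t - x))"
    proof -
      have "norm (G t * H (t - x) * cis (- (\<xi> \<bullet> t))) = norm (G t) * norm (H (t - x))"
        by (simp add: norm_mult)
      then show ?thesis
        by (simp only:) (intro mult_mono C1 C2 mult_nonneg_nonneg norm_ge_zero wt_nonneg)
    qed
    also have "\<dots> = C1 * C2 * wt 2 t * (wt A (t - x) * wt A t)" by (simp only: wt_add mult_ac)
    also have "\<dots> \<le> C1 * C2 * wt 2 t * wt A x"
      by (intro mult_left_mono wt_convolve mult_nonneg_nonneg C1 C2 wt_nonneg)
    finally show ?thesis .
  qed
  then show "\<exists>B. \<forall>x \<xi> t. norm (G t * H (t - x) * cis (- (\<xi> \<bullet> t))) \<le> B * wt 2 t * wt A x" by blast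
  have [measurable]: "G \<in> borel_measurable borel" "H \<in> borel_measurable borel"
    using assms by (auto intro: schwartz_measurable)
  have [measurable]: "(\<lambda>t. cis (- (\<xi> \<bullet> t))) \<in> borel_measurable borel"
    by (intro borel_measurable_continuous_onI continuous_intros)
  show "integrable lborel (\<lambda>t. G t * H (t - x) * cis (- (\<xi> \<bullet> t)))"
  proof (rule Bochner_Integration.integrable_bound)
    show "integrable lborel (\<lambda>t::real^'n. C1 * C2 * wt A x * wt 2 t)" by (intro integrable_mult_right wt_integrable) simp
    show "AE t in lborel. norm (G t * H (t - x) * cis (- (\<xi> \<bullet> t))) \<le> norm (C1 * C2 * wt A x * wt 2 t)"
      by (intro AE_I2 order_trans[OF b]) (simp add: mult_ac)
  qed measurable
qed

text \<open>Integration by parts: a factor i * xi_i in front of the transform becomes a derivative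
  on G or on H. Both stay Schwartz functions, so the induction on k runs over all pairs G,
  H.\<close>

lemma stft2_bound:
  fixes G H :: "real^'n::finite \<Rightarrow> complex"
  assumes "G \<in> schwartz" "H \<in> schwartz"
  shows "\<exists>C. \<forall>x \<xi>. \<bar>\<xi>$i\<bar> ^ k * norm (stft2 G H x \<xi>) \<le> C * wt A x"
  using assms
proof (induction k arbitrary: G H)
  case 0
  obtain B where B: "\<And>x \<xi> t. norm (G t * H (t - x) * cis (- (\<xi> \<bullet> t))) \<le> B * wt 2 t * wt A x"
    using stft2_integrable(2)[OF 0] by blast
  have "norm (stft2 G H x \<xi>) \<le> (B * (\<integral>t. wt 2 (t :: real^'n) \<partial>lborel)) * wt A x" for x \<xi>
  proof -
    have "norm (stft2 G H x \<xi>) \<le> (\<integral>t. (B * wt A x) * wt 2 (t :: real^'n) \<partial>lborel)"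
      unfolding stft2_def
      by (rule Bochner_Integration.integral_norm_bound_integral[OF stft2_integrable(1)[OF 0]])
         (use B[of _ x \<xi>] wt_integrable in \<open>auto simp: mult_ac\<close>)
    also have "\<dots> = (B * (\<integral>t. wt 2 (t :: real^'n) \<partial>lborel)) * wt A x" by simp
    finally show ?thesis .
  qed
  then show ?case by auto
next
  case (Suc k)
  let ?G' = "dderiv (axis i 1) G" and ?H' = "dderiv (axis i 1) H"
  note S = schwartz_dderiv(1)[OF Suc.prems(1), of i] schwartz_dderiv(1)[OF Suc.prems(2), of i]
  obtain C1 where C1: "\<And>x \<xi>. \<bar>\<xi>$i\<bar> ^ k * norm (stft2 ?G' H x \<xi>) \<le> C1 * wt A x"
    using Suc.IH[OF S(1) Suc.prems(2)] by blast
  obtain C2 where C2: "\<And>x \<xi>. \<bar>\<xi>$i\<bar> ^ k * norm (stft2 G ?H' x \<xi>) \<le> C2 * wt A x"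
    using Suc.IH[OF Suc.prems(1) S(2)] by blast
  have *: "\<i> * (\<xi>$i) * stft2 G H x \<xi> = stft2 ?G' H x \<xi> + stft2 G ?H' x \<xi>" for x \<xi>
  proof -
    let ?e = "\<lambda>t. cis (- (\<xi> \<bullet> t))"
    let ?u' = "\<lambda>t. (?G' t * H (t - x) * ?e t + G t * ?H' (t - x) * ?e t) + (- \<i> * (\<xi>$i)) * (G t * H (t - x) * ?e t)"
    note ints = stft2_integrable(1)[OF S(1) Suc.prems(2), of x \<xi>] stft2_integrable(1)[OF Suc.prems(1) S(2), of x \<xi>]
       stft2_integrable(1)[OF Suc.prems, of x \<xi>]
    obtain B1 where B1: "\<And>t. norm (?G' t * H (t - x) * ?e t) \<le> B1 * wt 2 t * wt 0 x"
      using stft2_integrable(2)[OF S(1) Suc.prems(2), of 0] by blast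
    obtain B2 where B2: "\<And>t. norm (G t * ?H' (t - x) * ?e t) \<le> B2 * wt 2 t * wt 0 x"
      using stft2_integrable(2)[OF Suc.prems(1) S(2), of 0] by blast
    obtain B3 where B3: "\<And>t. norm (G t * H (t - x) * ?e t) \<le> B3 * wt 2 t * wt 0 x"
      using stft2_integrable(2)[OF Suc.prems, of 0] by blast
    have "(\<integral>t. ?u' t \<partial>lborel) = 0"
    proof (rule integral_derivative_zero[where i=i and B="B1 * wt 0 x + B2 * wt 0 x + \<bar>\<xi>$i\<bar> * (B3 * wt 0 x)"])
      show "integrable lborel (\<lambda>t. G t * H (t - x) * ?e t)" by (rule ints)
      show "?u' \<in> borel_measurable borel"
        using ints[THEN borel_measurable_integrable]
        by (intro borel_measurable_add borel_measurable_times[OF borel_measurable_const]) simp_all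
      fix t
      have "norm (?u' t) \<le> (B1 * wt 2 t * wt 0 x + B2 * wt 2 t * wt 0 x) + \<bar>\<xi>$i\<bar> * (B3 * wt 2 t * wt 0 x)"
      proof (intro norm_triangle_le add_mono B1 B2)
        have "norm (- \<i> * (\<xi>$i) * (G t * H (t - x) * ?e t)) = \<bar>\<xi>$i\<bar> * norm (G t * H (t - x) * ?e t)"
          by (simp add: norm_mult)
        then show "norm (- \<i> * (\<xi>$i) * (G t * H (t - x) * ?e t)) \<le> \<bar>\<xi>$i\<bar> * (B3 * wt 2 t * wt 0 x)"
          by (simp only:) (intro mult_left_mono B3 abs_ge_zero)
      qed
      then show "norm (?u' t) \<le> (B1 * wt 0 x + B2 * wt 0 x + \<bar>\<xi>$i\<bar> * (B3 * wt 0 x)) * wt 2 t"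
        by (simp add: algebra_simps)
      fix s
      have dG: "((\<lambda>r. G (t + r *\<^sub>R axis i 1)) has_vector_derivative ?G' (t + s *\<^sub>R axis i 1)) (at s)"
        by (rule schwartz_has_vector_derivative_line[OF Suc.prems(1)])
      have "((\<lambda>r. H ((t - x) + r *\<^sub>R axis i 1)) has_vector_derivative ?H' ((t - x) + s *\<^sub>R axis i 1)) (at s)"
        by (rule schwartz_has_vector_derivative_line[OF Suc.prems(2)])
      then have dH: "((\<lambda>r. H (t + r *\<^sub>R axis i 1 - x)) has_vector_derivative ?H' (t + s *\<^sub>R axis i 1 - x)) (at s)"
        by (simp add: algebra_simps)
      have de: "((\<lambda>r. ?e (t + r *\<^sub>R axis i 1)) has_vector_derivative (- \<i> * (\<xi>$i)) * ?e (t + s *\<^sub>R axis i 1)) (at s)"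
      proof -
        have eq: "?e (t + r *\<^sub>R axis i 1) = cis (- (\<xi> \<bullet> t)) * exp (- \<i> * (\<xi>$i) * of_real r)" for r
          by (simp add: inner_add_right inner_axis cis_conv_exp exp_add[symmetric] algebra_simps)
        have "((\<lambda>z. cis (- (\<xi> \<bullet> t)) * exp (- \<i> * (\<xi>$i) * z)) has_field_derivative
            (- \<i> * (\<xi>$i)) * (cis (- (\<xi> \<bullet> t)) * exp (- \<i> * (\<xi>$i) * of_real s))) (at (of_real s))"
          by (auto intro!: derivative_eq_intros)
        from has_vector_derivative_real_field[OF this] show ?thesis unfolding eq .
      qed
      show "((\<lambda>r. G (t + r *\<^sub>R axis i 1) * H (t + r *\<^sub>R axis i 1 - x) * ?e (t + r *\<^sub>R axis i 1)) has_vector_derivative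
         ?u' (t + s *\<^sub>R axis i 1)) (at s)"
        by (rule has_vector_derivative_eq_rhs[OF has_vector_derivative_mult[OF has_vector_derivative_mult[OF dG dH] de]])
           (simp add: algebra_simps)
    qed
    then show ?thesis
      unfolding stft2_def using ints by (simp add: Bochner_Integration.integral_add)
  qed
  have "\<bar>\<xi>$i\<bar> ^ Suc k * norm (stft2 G H x \<xi>) \<le> (C1 + C2) * wt A x" for x \<xi>
  proof -
    have "\<bar>\<xi>$i\<bar> ^ Suc k * norm (stft2 G H x \<xi>) = \<bar>\<xi>$i\<bar> ^ k * norm (\<i> * (\<xi>$i) * stft2 G H x \<xi>)"
      by (simp add: norm_mult)
    also have "\<dots> \<le> \<bar>\<xi>$i\<bar> ^ k * (norm (stft2 ?G' H x \<xi>) + norm (stft2 G ?H' x \<xi>))"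
      unfolding * by (intro mult_left_mono norm_triangle_ineq) auto
    also have "\<dots> \<le> (C1 + C2) * wt A x"
      using C1[of \<xi> x] C2[of \<xi> x] by (simp add: algebra_simps)
    finally show ?thesis .
  qed
  then show ?case by blast
qed

lemma stft2_wt_bound:
  fixes G H :: "real^'n::finite \<Rightarrow> complex"
  assumes "G \<in> schwartz" "H \<in> schwartz"
  obtains C where "0 < C" "\<And>x \<xi>. norm (stft2 G H x \<xi>) \<le> C * wt A x * wt k \<xi>"
proof -
  \<comment> \<open>n * k powers of decay in the largest coordinate pay for k powers in each of the
    n coordinates.\<close>
  define K where "K = CARD('n) * k"
  obtain C0 where C0: "\<And>x \<xi>. norm (stft2 G H x \<xi>) \<le> C0 * wt A x"
    using stft2_bound[OF assms, of undefined 0 A] by auto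
  obtain C where C: "\<And>i x \<xi>. \<bar>\<xi>$i\<bar> ^ K * norm (stft2 G H x \<xi>) \<le> C i * wt A x"
  proof -
    have "\<forall>i. \<exists>C. \<forall>x \<xi>. \<bar>\<xi>$i\<bar> ^ K * norm (stft2 G H x \<xi>) \<le> C * wt A x"
      using stft2_bound[OF assms] by blast
    from choice[OF this] show thesis using that by blast
  qed
  have pos: "0 \<le> C0" "0 \<le> C i" for i
  proof -
    have *: "0 \<le> a" if "0 \<le> a * wt A (0::real^'n)" for a
      using that wt_pos[of A "0::real^'n"] by (simp add: zero_le_mult_iff)
    have "0 \<le> C0 * wt A (0::real^'n)" by (rule order_trans[OF norm_ge_zero C0])
    then show "0 \<le> C0" by (rule *)
    have "0 \<le> C i * wt A (0::real^'n)"
      by (rule order_trans[OF _ C[of 0 i]]) auto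
    then show "0 \<le> C i" by (rule *)
  qed
  define B where "B = 2 ^ K * (C0 + (\<Sum>i\<in>UNIV. C i))"
  have "norm (stft2 G H x \<xi>) \<le> (B + 1) * wt A x * wt k \<xi>" for x \<xi>
  proof -
    have "Max (range (\<lambda>j. \<bar>\<xi>$j\<bar>)) \<in> range (\<lambda>j. \<bar>\<xi>$j\<bar>)" by (intro Max_in) auto
    then obtain i where "Max (range (\<lambda>j. \<bar>\<xi>$j\<bar>)) = \<bar>\<xi>$i\<bar>" by (rule rangeE)
    then have i: "\<bar>\<xi>$j\<bar> \<le> \<bar>\<xi>$i\<bar>" for j by (metis Max_ge finite finite_imageI rangeI)
    have "dec (\<xi>$i) ^ K = (\<Prod>j\<in>(UNIV::'n set). dec (\<xi>$i) ^ k)"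
      by (simp add: K_def power_mult[symmetric] mult.commute)
    also have "\<dots> \<le> wt k \<xi>"
      unfolding wt_def dec_def using i by (intro prod_mono conjI power_mono) (auto intro!: divide_left_mono simp: add_pos_nonneg)
    finally have w: "dec (\<xi>$i) ^ K \<le> wt k \<xi>" .
    have "(1 + \<bar>\<xi>$i\<bar>) ^ K \<le> (2 * max 1 \<bar>\<xi>$i\<bar>) ^ K" by (intro power_mono) auto
    also have "\<dots> \<le> 2 ^ K * (1 + \<bar>\<xi>$i\<bar> ^ K)" by (simp add: power_mult_distrib max_def)
    finally have "(1 + \<bar>\<xi>$i\<bar>) ^ K * norm (stft2 G H x \<xi>) \<le> 2 ^ K * (1 + \<bar>\<xi>$i\<bar> ^ K) * norm (stft2 G H x \<xi>)"
      by (intro mult_right_mono) auto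
    also have "\<dots> = 2 ^ K * (norm (stft2 G H x \<xi>) + \<bar>\<xi>$i\<bar> ^ K * norm (stft2 G H x \<xi>))"
      by (simp add: algebra_simps)
    also have "\<dots> \<le> 2 ^ K * (C0 * wt A x + C i * wt A x)"
      by (intro mult_left_mono add_mono C0 C) auto
    also have "\<dots> \<le> 2 ^ K * (C0 * wt A x + (\<Sum>i\<in>UNIV. C i) * wt A x)"
      using pos by (intro mult_left_mono add_mono mult_right_mono member_le_sum) (auto simp: wt_nonneg)
    also have "\<dots> = B * wt A x" by (simp add: B_def algebra_simps)
    finally have "norm (stft2 G H x \<xi>) \<le> B * wt A x * dec (\<xi>$i) ^ K"
      by (simp add: dec_def field_simps add_pos_nonneg)
    also have "\<dots> \<le> (B + 1) * wt A x * wt k \<xi>"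
      using pos by (intro mult_mono w mult_right_mono) (auto simp: B_def wt_nonneg dec_nonneg sum_nonneg intro!: mult_nonneg_nonneg add_nonneg_nonneg)
    finally show ?thesis .
  qed
  moreover have "0 < B + 1" using pos by (simp add: B_def sum_nonneg add_nonneg_pos)
  ultimately show thesis by (intro that[of "B + 1"])
qed

text \<open>By dominated convergence. Continuity will turn one nonzero value of the transform into a
  lower bound on a product of balls.\<close>

lemma stft2_continuous:
  fixes G H :: "real^'n::finite \<Rightarrow> complex"
  assumes "G \<in> schwartz" "H \<in> schwartz"
  shows "continuous_on UNIV (\<lambda>(x, \<xi>). stft2 G H x \<xi>)"
  unfolding continuous_on_sequentially
proof (intro allI ballI impI, elim conjE)
  fix a :: "(real^'n) \<times> (real^'n)" and z assume "z \<longlonglongrightarrow> a"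
  then have l: "(\<lambda>n. fst (z n)) \<longlonglongrightarrow> fst a" "(\<lambda>n. snd (z n)) \<longlonglongrightarrow> snd a"
    by (auto intro: tendsto_fst tendsto_snd)
  obtain B where B: "\<And>x \<xi> t. norm (G t * H (t - x) * cis (- (\<xi> \<bullet> t))) \<le> B * wt 2 t * wt 0 x"
    using stft2_integrable(2)[OF assms] by blast
  have "(\<lambda>n. stft2 G H (fst (z n)) (snd (z n))) \<longlonglongrightarrow> stft2 G H (fst a) (snd a)"
    unfolding stft2_def
  proof (rule integral_dominated_convergence[where w="\<lambda>t. B * wt 2 t"])
    show "integrable lborel (\<lambda>x::real^'n. B * wt 2 x)" by (intro integrable_mult_right wt_integrable) simp
    show "AE t in lborel. (\<lambda>n. G t * H (t - fst (z n)) * cis (- (snd (z n) \<bullet> t))) \<longlonglongrightarrow> G t * H (t - fst a) * cis (- (snd a \<bullet> t))"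
      by (intro AE_I2 tendsto_mult tendsto_const continuous_on_tendsto_compose[OF schwartz_continuous[OF assms(2)]]
          continuous_on_tendsto_compose[OF continuous_on_cis[OF continuous_on_id, of UNIV], simplified id_def]
          tendsto_diff tendsto_minus tendsto_inner l) auto
    show "AE t in lborel. norm (G t * H (t - fst (z n)) * cis (- (snd (z n) \<bullet> t))) \<le> B * wt 2 t" for n
      using B[where x="fst (z n)"] by (simp add: wt_def)
  qed (use stft2_integrable(1)[OF assms, THEN borel_measurable_integrable] in auto)
  then show "((\<lambda>(x, \<xi>). stft2 G H x \<xi>) \<circ> z) \<longlonglongrightarrow> (\<lambda>(x, \<xi>). stft2 G H x \<xi>) a"
    by (simp add: case_prod_unfold o_def)
qed

section \<open>Trigonometric polynomials times Gaussians\<close>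

text \<open>The argument is complex so that Cauchy's estimates apply. The index set consists of
  integers because products with the conjugate of b produce differences of indices.\<close>

definition tgauss :: "real \<Rightarrow> int set \<Rightarrow> (int \<Rightarrow> complex) \<Rightarrow> (int \<Rightarrow> real) \<Rightarrow> complex \<Rightarrow> complex" where
  "tgauss a K c \<eta> z = (\<Sum>k\<in>K. c k * exp (\<i> * of_real (\<eta> k) * z)) * exp (- (of_real a * z\<^sup>2))"

definition tgauss_vec :: "real \<Rightarrow> int set \<Rightarrow> (int \<Rightarrow> complex) \<Rightarrow> (int \<Rightarrow> real) \<Rightarrow> real^'n::finite \<Rightarrow> complex" where
  "tgauss_vec a K c \<eta> x = (\<Prod>i\<in>UNIV. tgauss a K c \<eta> (of_real (x$i)))"

definition gauss :: "real \<Rightarrow> real^'n::finite \<Rightarrow> complex" where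
  "gauss a x = (\<Prod>i\<in>UNIV. of_real (exp (- a * (x$i)\<^sup>2)))"

text \<open>Since 1 + |t| <= exp |t|, it is enough to maximise N |t| - b t^2, which is done by
  completing the square.\<close>

lemma poly_exp_bound:
  fixes b :: real
  assumes "0 < b"
  shows "(1 + \<bar>t\<bar>) ^ N * exp (- b * t\<^sup>2) \<le> exp (real N ^ 2 / (4 * b))"
proof -
  have "(1 + \<bar>t\<bar>) ^ N \<le> exp \<bar>t\<bar> ^ N" by (intro power_mono exp_ge_add_one_self) auto
  also have "\<dots> = exp (real N * \<bar>t\<bar>)" by (simp add: exp_of_nat_mult)
  finally have "(1 + \<bar>t\<bar>) ^ N * exp (- b * t\<^sup>2) \<le> exp (real N * \<bar>t\<bar>) * exp (- b * t\<^sup>2)"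
    by (intro mult_right_mono) auto
  also have "\<dots> = exp (real N * \<bar>t\<bar> - b * t\<^sup>2)" by (simp add: exp_add[symmetric])
  also have "\<dots> \<le> exp (real N ^ 2 / (4 * b))"
  proof -
    have "0 \<le> (2 * b * \<bar>t\<bar> - real N) ^ 2 / (4 * b)" using assms by simp
    also have "\<dots> = b * t\<^sup>2 - real N * \<bar>t\<bar> + real N ^ 2 / (4 * b)"
      using assms by (simp add: power2_diff power_mult_distrib field_simps power2_eq_square)
    finally show ?thesis by simp
  qed
  finally show ?thesis .
qed

lemma tgauss_holomorphic: "tgauss a K c \<eta> holomorphic_on UNIV"
  unfolding tgauss_def[abs_def] by (intro holomorphic_intros)

lemma tgauss_deriv_bound:
  assumes "0 < a"
  shows "\<exists>C. \<forall>t. (1 + \<bar>t\<bar>) ^ N * norm ((deriv ^^ k) (tgauss a K c \<eta>) (of_real t)) \<le> C"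
proof -
  define S where "S = (\<Sum>k\<in>K. norm (c k) * exp \<bar>\<eta> k\<bar>)"
  have S0: "0 \<le> S" unfolding S_def by (intro sum_nonneg) auto
  have b: "norm ((deriv ^^ k) (tgauss a K c \<eta>) (of_real t)) \<le> fact k * (S * exp (2 * a) * exp (- (a / 2) * t\<^sup>2))" for t
  proof -
    have "norm ((deriv ^^ k) (tgauss a K c \<eta>) (of_real t)) \<le> fact k * (S * exp (2 * a) * exp (- (a / 2) * t\<^sup>2)) / 1 ^ k"
    proof (rule Cauchy_bound_entire[OF tgauss_holomorphic])
      fix w :: complex assume w: "norm (of_real t - w) = 1"
      have im: "\<bar>Im w\<bar> \<le> 1" using abs_Im_le_cmod[of "of_real t - w"] w by simp
      have re: "\<bar>t - Re w\<bar> \<le> 1" using abs_Re_le_cmod[of "of_real t - w"] w by simp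
      have "norm (\<Sum>k\<in>K. c k * exp (\<i> * of_real (\<eta> k) * w)) \<le> S"
        unfolding S_def
      proof (rule sum_norm_le)
        fix k
        have "- (\<eta> k * Im w) \<le> \<bar>\<eta> k\<bar> * \<bar>Im w\<bar>" by (metis abs_ge_minus_self abs_mult)
        also have "\<dots> \<le> \<bar>\<eta> k\<bar> * 1" by (intro mult_left_mono im) auto
        finally show "norm (c k * exp (\<i> * of_real (\<eta> k) * w)) \<le> norm (c k) * exp \<bar>\<eta> k\<bar>"
          by (simp add: norm_mult norm_exp_eq_Re mult_left_mono)
      qed
      \<comment> \<open>On the circle of radius 1 around t one has |Im w| <= 1 and t^2 <= 2 (Re w)^2
        + 2, hence Re (w^2) >= t^2 / 2 - 2: half of the Gaussian decay survives.\<close>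
      moreover have "norm (exp (- (of_real a * w\<^sup>2))) \<le> exp (2 * a) * exp (- (a / 2) * t\<^sup>2)"
      proof -
        have "(Im w)^2 \<le> 1" using im by (simp add: abs_square_le_1)
        moreover have "t\<^sup>2 \<le> 2 * (Re w)^2 + 2"
        proof -
          have "(t - Re w)^2 \<le> 1" using re by (simp add: abs_square_le_1)
          moreover have "0 \<le> (t - 2 * Re w)^2" by simp
          ultimately show ?thesis by (simp add: power2_eq_square algebra_simps)
        qed
        ultimately have "a * (t\<^sup>2 / 2 - 2) \<le> a * ((Re w)^2 - (Im w)^2)" using assms by (intro mult_left_mono) auto
        then have "- (a * ((Re w)^2 - (Im w)^2)) \<le> 2 * a + - (a / 2) * t\<^sup>2" by (simp add: algebra_simps)
        moreover have "Re (- (of_real a * w\<^sup>2)) = - (a * ((Re w)^2 - (Im w)^2))" by (simp add: power2_eq_square)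
        ultimately show ?thesis by (simp only: norm_exp_eq_Re exp_add[symmetric] exp_le_cancel_iff)
      qed
      ultimately show "norm (tgauss a K c \<eta> w) \<le> S * exp (2 * a) * exp (- (a / 2) * t\<^sup>2)"
        unfolding tgauss_def norm_mult mult.assoc[of S] by (intro mult_mono S0) auto
    qed auto
    then show ?thesis by simp
  qed
  have "(1 + \<bar>t\<bar>) ^ N * norm ((deriv ^^ k) (tgauss a K c \<eta>) (of_real t)) \<le> fact k * S * exp (2 * a) * exp (real N ^ 2 / (4 * (a / 2)))" for t
  proof -
    have "(1 + \<bar>t\<bar>) ^ N * norm ((deriv ^^ k) (tgauss a K c \<eta>) (of_real t)) \<le> (1 + \<bar>t\<bar>) ^ N * (fact k * (S * exp (2 * a) * exp (- (a / 2) * t\<^sup>2)))"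
      by (intro mult_left_mono b) auto
    also have "\<dots> = fact k * S * exp (2 * a) * ((1 + \<bar>t\<bar>) ^ N * exp (- (a / 2) * t\<^sup>2))" by simp
    also have "\<dots> \<le> fact k * S * exp (2 * a) * exp (real N ^ 2 / (4 * (a / 2)))"
      using assms S0 poly_exp_bound[of "a / 2" t N] by (intro mult_left_mono) auto
    finally show ?thesis .
  qed
  then show ?thesis by blast
qed

lemma tgauss_vec_schwartz:
  assumes "0 < a"
  shows "(tgauss_vec a K c \<eta> :: real^'n::finite \<Rightarrow> complex) \<in> schwartz"
proof -
  define W where "W = (\<lambda>(i::'n) k t. (deriv ^^ k) (tgauss a K c \<eta>) (complex_of_real t))"
  have W: "deriv_seq (W i)" for i unfolding W_def by (rule deriv_seq_entire[OF tgauss_holomorphic])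
  have le: "(y + t *\<^sub>R axis r 1) $ s = y $ s + (if s = r then t else 0)" for y :: "real^'n" and t r s
    by (simp add: axis_def)
  have tgauss_vec: "tgauss_vec a K c \<eta> = (\<lambda>y. 1 * (\<Prod>i\<in>UNIV. W i 0 (y$i)))"
    by (simp add: tgauss_vec_def W_def fun_eq_iff)
  have "smooth_dirs (range (\<lambda>i. axis i 1)) (tgauss_vec a K c \<eta> :: real^'n \<Rightarrow> complex)"
    unfolding tgauss_vec by (rule smooth_dirs_tensor[OF le _ W]) (intro continuous_intros)
  moreover have "\<exists>C. \<forall>x::real^'n. (1 + norm x) ^ N * norm (pd is (tgauss_vec a K c \<eta>) x) \<le> C" for N and "is" :: "'n list"
  proof -
    have pd: "pd is (tgauss_vec a K c \<eta>) = (\<lambda>y::real^'n. 1 * (\<Prod>i\<in>UNIV. W i (count_list is i) (y$i)))"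
      unfolding tgauss_vec pd_def by (rule dderivs_tensor[OF le W])
    have "\<forall>i. \<exists>C. \<forall>t. (1 + \<bar>t\<bar>) ^ N * norm (W i (count_list is i) t) \<le> C"
      unfolding W_def using tgauss_deriv_bound[OF assms] by blast
    from choice[OF this] obtain C where C: "\<And>i t. (1 + \<bar>t\<bar>) ^ N * norm (W i (count_list is i) t) \<le> C i" by blast
    have "(1 + norm x) ^ N * norm (pd is (tgauss_vec a K c \<eta>) x) \<le> real CARD('n) ^ N * (\<Prod>i\<in>UNIV. C i)" for x :: "real^'n"
    proof -
      have "wt N x \<le> real CARD('n) ^ N / (1 + norm x) ^ N" using wt_le_norm[of N x] by (simp add: power_divide)
      then have "(1 + norm x) ^ N \<le> real CARD('n) ^ N * (1 / wt N x)"
        using wt_pos[of N x] by (simp add: field_simps add_pos_nonneg)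
      also have "1 / wt N x = (\<Prod>i\<in>UNIV. (1 + \<bar>x$i\<bar>) ^ N)"
        by (simp add: wt_def dec_def prod_dividef power_one_over)
      finally have "(1 + norm x) ^ N * norm (pd is (tgauss_vec a K c \<eta>) x) \<le> (real CARD('n) ^ N * (\<Prod>i\<in>UNIV. (1 + \<bar>x$i\<bar>) ^ N)) * norm (pd is (tgauss_vec a K c \<eta>) x)"
        by (rule mult_right_mono) auto
      also have "\<dots> = real CARD('n) ^ N * (\<Prod>i\<in>UNIV. (1 + \<bar>x$i\<bar>) ^ N * norm (W i (count_list is i) (x$i)))"
        unfolding pd by (simp add: prod.distrib prod_norm)
      also have "\<dots> \<le> real CARD('n) ^ N * (\<Prod>i\<in>UNIV. C i)"
        by (intro mult_left_mono prod_mono conjI C) auto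
      finally show ?thesis .
    qed
    then show ?thesis by blast
  qed
  ultimately show ?thesis by (simp add: schwartz_def coord_dirs_def)
qed

lemma gauss_eq_tgauss_vec: "gauss a = tgauss_vec a {0} (\<lambda>_. 1) (\<lambda>_. 0)"
  by (simp add: gauss_def tgauss_vec_def tgauss_def fun_eq_iff exp_of_real[symmetric])

lemma gauss_schwartz: "0 < a \<Longrightarrow> gauss a \<in> schwartz"
  unfolding gauss_eq_tgauss_vec by (rule tgauss_vec_schwartz)

definition freq :: "(int \<Rightarrow> real) \<Rightarrow> ('n::finite \<Rightarrow> int) \<Rightarrow> real^'n" where
  "freq \<eta> \<kappa> = (\<chi> i. \<eta> (\<kappa> i))"

lemma prod_cis: "(\<Prod>i\<in>A. cis (f i)) = cis (\<Sum>i\<in>A. f i)"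
  by (induction A rule: infinite_finite_induct) (auto simp: cis_mult)

lemma tgauss_vec_expand:
  fixes x :: "real^'n::finite"
  assumes "finite K"
  shows "tgauss_vec a K c \<eta> x = (\<Sum>\<kappa>\<in>UNIV \<rightarrow>\<^sub>E K. (\<Prod>i\<in>UNIV. c (\<kappa> i)) * (cis (freq \<eta> \<kappa> \<bullet> x) * gauss a x))"
proof -
  have "tgauss_vec a K c \<eta> x = (\<Prod>i\<in>UNIV. \<Sum>k\<in>K. c k * (cis (\<eta> k * x$i) * of_real (exp (- a * (x$i)\<^sup>2))))"
    unfolding tgauss_vec_def tgauss_def
    by (intro prod.cong refl) (simp add: sum_distrib_left cis_conv_exp mult_ac exp_of_real[symmetric])
  also have "\<dots> = (\<Sum>\<kappa>\<in>UNIV \<rightarrow>\<^sub>E K. \<Prod>i\<in>UNIV. c (\<kappa> i) * (cis (\<eta> (\<kappa> i) * x$i) * of_real (exp (- a * (x$i)\<^sup>2))))"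
    by (rule prod_sum_PiE) (use assms in auto)
  also have "\<dots> = (\<Sum>\<kappa>\<in>UNIV \<rightarrow>\<^sub>E K. (\<Prod>i\<in>UNIV. c (\<kappa> i)) * (cis (freq \<eta> \<kappa> \<bullet> x) * gauss a x))"
    by (simp add: prod.distrib prod_cis gauss_def freq_def inner_vec_def)
  finally show ?thesis .
qed

text \<open>Modulation of a function translates its transform in frequency, so each packet
  contributes a translate of one fixed function.\<close>

lemma stft2_tgauss_vec:
  fixes H :: "real^'n::finite \<Rightarrow> complex"
  assumes "finite K" "0 < a" "H \<in> schwartz"
  shows "stft2 (tgauss_vec a K c \<eta>) H x \<xi> = (\<Sum>\<kappa>\<in>UNIV \<rightarrow>\<^sub>E K. (\<Prod>i\<in>UNIV. c (\<kappa> i)) * stft2 (gauss a) H x (\<xi> - freq \<eta> \<kappa>))"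
proof -
  have "stft2 (tgauss_vec a K c \<eta>) H x \<xi> = (\<integral>t. (\<Sum>\<kappa>\<in>UNIV \<rightarrow>\<^sub>E K. (\<Prod>i\<in>UNIV. c (\<kappa> i)) * (gauss a t * H (t - x) * cis (- ((\<xi> - freq \<eta> \<kappa>) \<bullet> t)))) \<partial>lborel)"
  proof -
    have "cis (- ((\<xi> - freq \<eta> \<kappa>) \<bullet> t)) = cis (freq \<eta> \<kappa> \<bullet> t) * cis (- (\<xi> \<bullet> t))" for \<kappa> t
      by (simp add: cis_mult inner_diff_left)
    then show ?thesis
      unfolding stft2_def tgauss_vec_expand[OF assms(1)]
      by (intro Bochner_Integration.integral_cong refl) (simp add: sum_distrib_left mult_ac)
  qed
  also have "\<dots> = (\<Sum>\<kappa>\<in>UNIV \<rightarrow>\<^sub>E K. (\<integral>t. (\<Prod>i\<in>UNIV. c (\<kappa> i)) * (gauss a t * H (t - x) * cis (- ((\<xi> - freq \<eta> \<kappa>) \<bullet> t))) \<partial>lborel))"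
    by (rule Bochner_Integration.integral_sum)
       (intro integrable_mult_right stft2_integrable gauss_schwartz assms)
  finally show ?thesis by (simp add: stft2_def)
qed

text \<open>After taking absolute values, the sum over multi-indices factors into n one-dimensional
  sums because the frequency weight is a product.\<close>

lemma stft2_tgauss_vec_upper:
  fixes H :: "real^'n::finite \<Rightarrow> complex"
  assumes "finite K" "0 < a" "H \<in> schwartz"
    and C: "0 \<le> C" "\<And>x \<xi>. norm (stft2 (gauss a) H x \<xi>) \<le> C * wt 2 x * wt 3 \<xi>"
  shows "norm (stft2 (tgauss_vec a K c \<eta>) H x \<xi>) \<le> C * wt 2 x * (\<Prod>i\<in>UNIV. \<Sum>k\<in>K. norm (c k) * dec (\<xi>$i - \<eta> k) ^ 3)"
proof -
  have "norm (stft2 (tgauss_vec a K c \<eta>) H x \<xi>) \<le> (\<Sum>\<kappa>\<in>UNIV \<rightarrow>\<^sub>E K. (C * wt 2 x) * (\<Prod>i\<in>UNIV. norm (c (\<kappa> i)) * dec (\<xi>$i - \<eta> (\<kappa> i)) ^ 3))"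
    unfolding stft2_tgauss_vec[OF assms(1-3)]
  proof (rule sum_norm_le)
    fix \<kappa>
    have "norm ((\<Prod>i\<in>UNIV. c (\<kappa> i)) * stft2 (gauss a) H x (\<xi> - freq \<eta> \<kappa>)) \<le> (\<Prod>i\<in>UNIV. norm (c (\<kappa> i))) * (C * wt 2 x * wt 3 (\<xi> - freq \<eta> \<kappa>))"
      unfolding norm_mult prod_norm[symmetric] by (intro mult_left_mono C prod_nonneg) auto
    also have "\<dots> = (C * wt 2 x) * (\<Prod>i\<in>UNIV. norm (c (\<kappa> i)) * dec (\<xi>$i - \<eta> (\<kappa> i)) ^ 3)"
      by (simp add: wt_def[of 3] freq_def prod.distrib)
    finally show "norm ((\<Prod>i\<in>UNIV. c (\<kappa> i)) * stft2 (gauss a) H x (\<xi> - freq \<eta> \<kappa>)) \<le> (C * wt 2 x) * (\<Prod>i\<in>UNIV. norm (c (\<kappa> i)) * dec (\<xi>$i - \<eta> (\<kappa> i)) ^ 3)" .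
  qed
  also have "\<dots> = C * wt 2 x * (\<Prod>i\<in>UNIV. \<Sum>k\<in>K. norm (c k) * dec (\<xi>$i - \<eta> k) ^ 3)"
    using assms(1) by (simp add: prod_sum_PiE sum_distrib_left)
  finally show ?thesis .
qed

definition dec_sum_const :: real where
  "dec_sum_const = 2 * (\<Sum>m. 4 * inverse (real (Suc m) ^ 2))"

text \<open>At most two integers l lie at a given distance from the integer part of u / L, and 1 +
  that distance is at most 2 (1 + |u - L l|). Each side contributes a series of inverse squares,
  whence the factors 2 and 4 in \<open>dec_sum_const\<close>, which does not depend on L.\<close>

lemma dec_sum_bound:
  fixes u L :: real
  assumes "1 \<le> L" "finite K"
  shows "(\<Sum>l\<in>K. dec (u - L * real_of_int l) ^ 2) \<le> dec_sum_const"
proof -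
  define j where "j = \<lfloor>u / L\<rfloor>"
  define g where "g m = 4 * inverse (real (Suc m) ^ 2)" for m
  have sg: "summable g" unfolding g_def
    by (intro summable_mult) (use inverse_squares_sums in \<open>simp add: sums_iff inverse_eq_divide add.commute\<close>)
  have g0: "0 \<le> g m" for m by (simp add: g_def)
  have b: "dec (u - L * real_of_int l) ^ 2 \<le> g (nat \<bar>l - j\<bar>)" for l
  proof -
    have j: "real_of_int j \<le> u / L" "u / L < real_of_int j + 1" unfolding j_def by linarith+
    have "\<bar>real_of_int (l - j)\<bar> - 1 \<le> \<bar>u / L - real_of_int l\<bar>" unfolding of_int_diff using j by linarith
    also have "\<dots> \<le> L * \<bar>u / L - real_of_int l\<bar>" using assms(1) mult_right_mono[of 1 L "\<bar>u / L - real_of_int l\<bar>"] by simp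
    also have "\<dots> = \<bar>L * (u / L - real_of_int l)\<bar>" using assms(1) by (simp add: abs_mult)
    also have "L * (u / L - real_of_int l) = u - L * real_of_int l" using assms(1) by (simp add: field_simps)
    finally have "\<bar>real_of_int (l - j)\<bar> \<le> 1 + \<bar>u - L * real_of_int l\<bar>" by simp
    then have "1 + \<bar>real_of_int (l - j)\<bar> \<le> 2 * (1 + \<bar>u - L * real_of_int l\<bar>)"
    proof -
      have "1 + X \<le> 2 * (1 + Y)" if "X \<le> 1 + Y" "0 \<le> Y" for X Y :: real using that by simp
      from this[OF _ abs_ge_zero] show ?thesis using \<open>\<bar>real_of_int (l - j)\<bar> \<le> 1 + \<bar>u - L * real_of_int l\<bar>\<close> .
    qed
    also have "1 + \<bar>real_of_int (l - j)\<bar> = real (Suc (nat \<bar>l - j\<bar>))" by simp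
    finally have "real (Suc (nat \<bar>l - j\<bar>)) \<le> 2 * (1 + \<bar>u - L * real_of_int l\<bar>)" .
    then have "dec (u - L * real_of_int l) \<le> 2 / real (Suc (nat \<bar>l - j\<bar>))"
      by (simp add: dec_def field_simps)
    then have "dec (u - L * real_of_int l) ^ 2 \<le> (2 / real (Suc (nat \<bar>l - j\<bar>))) ^ 2"
      by (intro power_mono) (auto simp: dec_nonneg)
    then show ?thesis by (simp add: g_def power_divide inverse_eq_divide)
  qed
  have "(\<Sum>l\<in>K. dec (u - L * real_of_int l) ^ 2) \<le> (\<Sum>l\<in>K. g (nat \<bar>l - j\<bar>))"
    by (intro sum_mono b)
  also have "\<dots> = (\<Sum>l\<in>K \<inter> {j..}. g (nat \<bar>l - j\<bar>)) + (\<Sum>l\<in>K - {j..}. g (nat \<bar>l - j\<bar>))"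
    using assms(2) by (rule sum.Int_Diff)
  also have "(\<Sum>l\<in>K \<inter> {j..}. g (nat \<bar>l - j\<bar>)) = sum g ((\<lambda>l. nat \<bar>l - j\<bar>) ` (K \<inter> {j..}))"
    by (subst sum.reindex) (auto simp: inj_on_def)
  also have "\<dots> \<le> suminf g"
    using assms(2) by (intro sum_le_suminf sg g0) auto
  also have "(\<Sum>l\<in>K - {j..}. g (nat \<bar>l - j\<bar>)) = sum g ((\<lambda>l. nat \<bar>l - j\<bar>) ` (K - {j..}))"
    by (subst sum.reindex) (auto simp: inj_on_def)
  also have "\<dots> \<le> suminf g"
    using assms(2) by (intro sum_le_suminf sg g0) auto
  finally have "(\<Sum>l\<in>K. dec (u - L * real_of_int l) ^ 2) \<le> 2 * suminf g" by simp
  also have "2 * suminf g = dec_sum_const" unfolding dec_sum_const_def g_def ..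
  finally show ?thesis .
qed

text \<open>Near the frequency of \<open>\<kappa>0\<close> its own packet dominates. Any other
  packet is at least L / 2 away in some coordinate; giving up one of the three powers of decay
  yields a factor 2 / L, and the remaining two powers are summable uniformly in L. The third
  condition on L makes the total disturbance at most half of the main term.\<close>

lemma stft2_tgauss_vec_lower:
  fixes H :: "real^'n::finite \<Rightarrow> complex"
  assumes K: "finite K" "0 < a" "H \<in> schwartz"
    and C: "0 < C" "\<And>x \<xi>. norm (stft2 (gauss a) H x \<xi>) \<le> C * wt 2 x * wt 3 \<xi>"
    and L: "1 \<le> L" "2 * T \<le> L" "4 * C * dec_sum_const ^ CARD('n) \<le> e * L"
    and \<eta>: "\<And>l. \<eta> l = \<omega> + L * real_of_int l"
    and c: "\<And>l. l \<in> K \<Longrightarrow> norm (c l) \<le> cm"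
    and \<kappa>0: "\<kappa>0 \<in> UNIV \<rightarrow>\<^sub>E K" "\<And>i. norm (c (\<kappa>0 i)) = cm"
    and low: "e \<le> norm (stft2 (gauss a) H x (\<xi> - freq \<eta> \<kappa>0))" "norm (\<xi> - freq \<eta> \<kappa>0) \<le> T"
  shows "cm ^ CARD('n) * (e / 2) \<le> norm (stft2 (tgauss_vec a K c \<eta>) H x \<xi>)"
proof -
  let ?n = "CARD('n)"
  have cm0: "0 \<le> cm" using \<kappa>0(2)[of undefined] norm_ge_zero by metis
  define P where "P \<kappa> = (\<Prod>i\<in>UNIV. c (\<kappa> i))" for \<kappa> :: "'n \<Rightarrow> int"
  have Pn: "norm (P \<kappa>) \<le> cm ^ ?n" if "\<kappa> \<in> UNIV \<rightarrow>\<^sub>E K" for \<kappa>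
  proof -
    have "norm (P \<kappa>) \<le> (\<Prod>i\<in>(UNIV::'n set). cm)"
      unfolding P_def prod_norm[symmetric] using that by (intro prod_mono conjI c) auto
    then show ?thesis by simp
  qed
  have P0: "norm (P \<kappa>0) = cm ^ ?n" by (simp add: P_def prod_norm[symmetric] \<kappa>0(2))
  have fin: "finite (UNIV \<rightarrow>\<^sub>E K :: ('n \<Rightarrow> int) set)" using K(1) by (intro finite_PiE) auto
  have "norm (\<Sum>\<kappa>\<in>(UNIV \<rightarrow>\<^sub>E K) - {\<kappa>0}. P \<kappa> * stft2 (gauss a) H x (\<xi> - freq \<eta> \<kappa>)) \<le> (\<Sum>\<kappa>\<in>(UNIV \<rightarrow>\<^sub>E K) - {\<kappa>0}. cm ^ ?n * (C * (2 / L * wt 2 (\<xi> - freq \<eta> \<kappa>))))"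
  proof (rule sum_norm_le)
    fix \<kappa> assume \<kappa>: "\<kappa> \<in> (UNIV \<rightarrow>\<^sub>E K) - {\<kappa>0}"
    then obtain i where i: "\<kappa> i \<noteq> \<kappa>0 i" by (auto simp: fun_eq_iff)
    define z where "z = \<xi> - freq \<eta> \<kappa>"
    have "1 \<le> \<bar>\<kappa>0 i - \<kappa> i\<bar>" using i by linarith
    then have "L * 1 \<le> L * real_of_int \<bar>\<kappa>0 i - \<kappa> i\<bar>" using L(1) by (intro mult_left_mono) linarith+
    also have "\<dots> = \<bar>L * (real_of_int (\<kappa>0 i) - real_of_int (\<kappa> i))\<bar>" using L(1) by (simp add: abs_mult)
    also have "L * (real_of_int (\<kappa>0 i) - real_of_int (\<kappa> i)) = z $ i - (\<xi> - freq \<eta> \<kappa>0) $ i"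
      by (simp add: z_def freq_def \<eta> algebra_simps)
    finally have "L \<le> \<bar>z $ i\<bar> + \<bar>(\<xi> - freq \<eta> \<kappa>0) $ i\<bar>" by linarith
    also have "\<bar>(\<xi> - freq \<eta> \<kappa>0) $ i\<bar> \<le> T" using component_le_norm_cart low(2) order_trans by blast
    finally have "L / 2 \<le> \<bar>z $ i\<bar>" using L(2) by simp
    then have "dec (z $ i) \<le> 2 / L" using L(1) by (simp add: dec_def field_simps)
    moreover have "wt 1 z \<le> dec (z $ i)"
    proof -
      have "wt 1 z = dec (z $ i) ^ 1 * (\<Prod>j\<in>UNIV-{i}. dec (z $ j) ^ 1)" unfolding wt_def by (rule prod.remove) auto
      also have "\<dots> \<le> dec (z $ i) ^ 1 * 1"
        using dec_pos dec_le_1 by (intro mult_left_mono prod_le_1) (auto simp: less_imp_le)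
      finally show ?thesis by simp
    qed
    ultimately have w1: "wt 1 z \<le> 2 / L" by simp
    have "norm (stft2 (gauss a) H x z) \<le> C * wt 2 x * wt 3 z" by (rule C)
    also have "\<dots> \<le> C * 1 * wt 3 z" using C(1) by (intro mult_mono mult_nonneg_nonneg wt_le_1) (auto simp: wt_nonneg)
    \<comment> \<open>One power of the weight for the separation, two for the summation.\<close>
    also have "wt 3 z = wt 1 z * wt 2 z" using wt_add[of 1 2 z] by (simp add: eval_nat_numeral)
    also have "C * 1 * (wt 1 z * wt 2 z) \<le> C * 1 * (2 / L * wt 2 z)"
      using C(1) w1 by (intro mult_left_mono mult_right_mono) (auto simp: wt_nonneg)
    finally have "norm (stft2 (gauss a) H x z) \<le> C * (2 / L * wt 2 z)" by simp
    then show "norm (P \<kappa> * stft2 (gauss a) H x (\<xi> - freq \<eta> \<kappa>)) \<le> cm ^ ?n * (C * (2 / L * wt 2 (\<xi> - freq \<eta> \<kappa>)))"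
      unfolding norm_mult z_def using \<kappa> cm0 by (intro mult_mono Pn) auto
  qed
  also have "\<dots> \<le> (\<Sum>\<kappa>\<in>UNIV \<rightarrow>\<^sub>E K. cm ^ ?n * (C * (2 / L * wt 2 (\<xi> - freq \<eta> \<kappa>))))"
    using C(1) cm0 L(1) fin by (intro sum_mono2) (auto simp: wt_nonneg)
  also have "\<dots> = cm ^ ?n * (C * (2 / L * (\<Prod>i\<in>(UNIV::'n set). \<Sum>l\<in>K. dec ((\<xi>$i - \<omega>) - L * real_of_int l) ^ 2)))"
    using K(1) by (simp add: prod_sum_PiE sum_distrib_left wt_def freq_def \<eta> diff_diff_eq)
  also have "\<dots> \<le> cm ^ ?n * (C * (2 / L * (\<Prod>i\<in>(UNIV::'n set). dec_sum_const)))"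
    using C(1) cm0 L(1) by (intro mult_left_mono prod_mono conjI dec_sum_bound K) (auto intro: sum_nonneg)
  also have "\<dots> = cm ^ ?n * (2 * C * dec_sum_const ^ ?n / L)" by simp
  also have "\<dots> \<le> cm ^ ?n * (e / 2)" using L cm0 by (intro mult_left_mono) (auto simp: field_simps)
  finally have rest: "norm (\<Sum>\<kappa>\<in>(UNIV \<rightarrow>\<^sub>E K) - {\<kappa>0}. P \<kappa> * stft2 (gauss a) H x (\<xi> - freq \<eta> \<kappa>)) \<le> cm ^ ?n * (e / 2)" .
  have "stft2 (tgauss_vec a K c \<eta>) H x \<xi> = P \<kappa>0 * stft2 (gauss a) H x (\<xi> - freq \<eta> \<kappa>0) + (\<Sum>\<kappa>\<in>(UNIV \<rightarrow>\<^sub>E K) - {\<kappa>0}. P \<kappa> * stft2 (gauss a) H x (\<xi> - freq \<eta> \<kappa>))"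
    unfolding stft2_tgauss_vec[OF K] P_def by (rule sum.remove[OF fin \<kappa>0(1)])
  moreover have "cm ^ ?n * e \<le> norm (P \<kappa>0 * stft2 (gauss a) H x (\<xi> - freq \<eta> \<kappa>0))"
    unfolding norm_mult P0 using cm0 low by (intro mult_left_mono) auto
  ultimately show ?thesis
    using rest norm_diff_ineq[of "P \<kappa>0 * stft2 (gauss a) H x (\<xi> - freq \<eta> \<kappa>0)" "\<Sum>\<kappa>\<in>(UNIV \<rightarrow>\<^sub>E K) - {\<kappa>0}. P \<kappa> * stft2 (gauss a) H x (\<xi> - freq \<eta> \<kappa>)"]
    by simp
qed

section \<open>Fourier transforms of trigonometric polynomials times Gaussians\<close>

definition tgauss_hat :: "real \<Rightarrow> int set \<Rightarrow> (int \<Rightarrow> complex) \<Rightarrow> (int \<Rightarrow> real) \<Rightarrow> real \<Rightarrow> complex" where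
  "tgauss_hat a K c \<eta> s = (\<Sum>k\<in>K. c k * of_real (sqrt (pi / a) * exp (- (1 / (4 * a)) * (s - \<eta> k)\<^sup>2)))"

lemma tgauss_fourier:
  assumes "0 < a" "finite K"
  shows "integrable lborel (\<lambda>t. cis (- s * t) * tgauss a K c \<eta> (of_real t))"
    and "(\<integral>t. cis (- s * t) * tgauss a K c \<eta> (of_real t) \<partial>lborel) = tgauss_hat a K c \<eta> s"
proof -
  have eq: "cis (- s * t) * tgauss a K c \<eta> (of_real t) = (\<Sum>k\<in>K. c k * (cis ((\<eta> k - s) * t) * of_real (exp (- a * t\<^sup>2))))" for t
  proof -
    have 1: "cis (- s * t) * exp (\<i> * of_real (\<eta> k) * of_real t) = cis ((\<eta> k - s) * t)" for k
      by (simp add: cis_conv_exp exp_add[symmetric] algebra_simps)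
    have 2: "exp (- (of_real a * (of_real t)\<^sup>2)) = complex_of_real (exp (- a * t\<^sup>2))"
      by (simp add: exp_of_real[symmetric])
    show ?thesis
      unfolding tgauss_def sum_distrib_left sum_distrib_right 1[symmetric] 2
      by (intro sum.cong refl) (simp only: mult_ac)
  qed
  note g = gauss_fourier[OF assms(1)]
  show "integrable lborel (\<lambda>t. cis (- s * t) * tgauss a K c \<eta> (of_real t))"
    unfolding eq by (intro Bochner_Integration.integrable_sum integrable_mult_right g)
  have "(\<integral>t. cis (- s * t) * tgauss a K c \<eta> (of_real t) \<partial>lborel)
      = (\<Sum>k\<in>K. \<integral>t. c k * (cis ((\<eta> k - s) * t) * of_real (exp (- a * t\<^sup>2))) \<partial>lborel)"
    unfolding eq by (intro Bochner_Integration.integral_sum integrable_mult_right g)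
  also have "\<dots> = tgauss_hat a K c \<eta> s"
    unfolding tgauss_hat_def integral_mult_right_zero g(2)
    by (intro sum.cong refl) (simp add: power2_commute)
  finally show "(\<integral>t. cis (- s * t) * tgauss a K c \<eta> (of_real t) \<partial>lborel) = tgauss_hat a K c \<eta> s" .
qed

text \<open>Verified directly: the transform is a sum of translated Gaussians of parameter b = 1 /
  (4 * a), to which \<open>gauss_fourier\<close> applies again. The two prefactors multiply to 2 pi
  because a * b = 1/4.\<close>

lemma tgauss_hat_inversion:
  assumes "0 < a" "finite K"
  shows "integrable lborel (\<lambda>s. cis (x * s) * tgauss_hat a K c \<eta> s)"
    and "(\<integral>s. cis (x * s) * tgauss_hat a K c \<eta> s \<partial>lborel) = of_real (2 * pi) * tgauss a K c \<eta> (of_real x)"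
proof -
  define b where "b = 1 / (4 * a)"
  have b: "0 < b" using assms by (simp add: b_def)
  have eq: "cis (x * s) * tgauss_hat a K c \<eta> s = (\<Sum>k\<in>K. (c k * of_real (sqrt (pi / a)) * cis (x * \<eta> k)) *
      (cis (x * (- \<eta> k + s)) * of_real (exp (- b * (- \<eta> k + s)\<^sup>2))))" for s
  proof -
    have 1: "cis (x * s) = cis (x * \<eta> k) * cis (x * (- \<eta> k + s))" for k
      by (simp add: cis_mult algebra_simps)
    have 2: "(s - \<eta> k)\<^sup>2 = (- \<eta> k + s)\<^sup>2" for k by simp
    show ?thesis
      unfolding tgauss_hat_def sum_distrib_left b_def[symmetric] of_real_mult 2
    proof (intro sum.cong refl)
      fix k
      show "cis (x * s) * (c k * (of_real (sqrt (pi / a)) * of_real (exp (- b * (- \<eta> k + s)\<^sup>2)))) =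
          c k * of_real (sqrt (pi / a)) * cis (x * \<eta> k) * (cis (x * (- \<eta> k + s)) * of_real (exp (- b * (- \<eta> k + s)\<^sup>2)))"
        unfolding 1[of k] by (simp only: mult_ac)
    qed
  qed
  note g = gauss_fourier[OF b, of x]
  have i: "integrable lborel (\<lambda>s. cis (x * (- \<eta> k + s)) * complex_of_real (exp (- b * (- \<eta> k + s)\<^sup>2)))" for k
    by (rule lborel_integral_translate(1)[OF g(1)])
  have v: "(\<integral>s. cis (x * (- \<eta> k + s)) * complex_of_real (exp (- b * (- \<eta> k + s)\<^sup>2)) \<partial>lborel) = of_real (sqrt (pi / b) * exp (- (x\<^sup>2) / (4 * b)))" for k
    using lborel_integral_translate(2)[of "\<lambda>s. cis (x * s) * complex_of_real (exp (- b * s\<^sup>2))" "- \<eta> k"] borel_measurable_integrable[OF g(1)] g(2) by simp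
  show "integrable lborel (\<lambda>s. cis (x * s) * tgauss_hat a K c \<eta> s)"
    unfolding eq by (intro Bochner_Integration.integrable_sum integrable_mult_right i)
  have "(\<integral>s. cis (x * s) * tgauss_hat a K c \<eta> s \<partial>lborel) =
     (\<Sum>k\<in>K. \<integral>s. (c k * of_real (sqrt (pi / a)) * cis (x * \<eta> k)) *
      (cis (x * (- \<eta> k + s)) * of_real (exp (- b * (- \<eta> k + s)\<^sup>2))) \<partial>lborel)"
    unfolding eq by (intro Bochner_Integration.integral_sum integrable_mult_right i)
  also have "\<dots> = (\<Sum>k\<in>K. (c k * of_real (sqrt (pi / a)) * cis (x * \<eta> k)) * of_real (sqrt (pi / b) * exp (- (x\<^sup>2) / (4 * b))))"
    unfolding integral_mult_right_zero v ..
  also have "\<dots> = of_real (2 * pi) * tgauss a K c \<eta> (of_real x)"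
  proof -
    have "sqrt (pi / a) * sqrt (pi / b) = sqrt ((2 * pi)\<^sup>2)"
      unfolding real_sqrt_mult[symmetric] using assms by (simp add: b_def power2_eq_square)
    then have "sqrt (pi / a) * sqrt (pi / b) = 2 * pi" unfolding real_sqrt_abs by simp
    then have 1: "complex_of_real (sqrt (pi / a)) * complex_of_real (sqrt (pi / b)) = of_real (2 * pi)"
      by (metis of_real_mult)
    have 2: "complex_of_real (exp (- (x\<^sup>2) / (4 * b))) = exp (- (of_real a * (of_real x)\<^sup>2))"
      using assms by (simp add: b_def exp_of_real[symmetric] mult.commute)
    have 3: "cis (x * \<eta> k) = exp (\<i> * of_real (\<eta> k) * of_real x)" for k
      by (simp add: cis_conv_exp mult_ac)
    show ?thesis
      unfolding tgauss_def 2[symmetric] 3[symmetric] 1[symmetric]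
      unfolding sum_distrib_left sum_distrib_right of_real_mult
      by (intro sum.cong refl) (simp only: mult_ac)
  qed
  finally show "(\<integral>s. cis (x * s) * tgauss_hat a K c \<eta> s \<partial>lborel) = of_real (2 * pi) * tgauss a K c \<eta> (of_real x)" .
qed

lemma cis_inner: "cis (x \<bullet> y) = (\<Prod>i\<in>UNIV. cis (x$i * y$i))" for x y :: "real^'n::finite"
  by (simp add: prod_cis inner_vec_def)

lemma fourier_tgauss_vec:
  assumes "0 < a" "finite K"
  shows "fourier (tgauss_vec a K c \<eta>) \<xi> = (\<Prod>i\<in>UNIV. tgauss_hat a K c \<eta> (\<xi>$i))"
proof -
  have "cis (- (\<xi> \<bullet> x)) * tgauss_vec a K c \<eta> x = (\<Prod>i\<in>UNIV. cis (- \<xi>$i * x$i) * tgauss a K c \<eta> (of_real (x$i)))" for x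
    using cis_inner[of "- \<xi>" x] by (simp add: tgauss_vec_def prod.distrib)
  then show ?thesis
    unfolding fourier_def using integral_tensor(2)[OF tgauss_fourier(1)[OF assms]] tgauss_fourier(2)[OF assms] by simp
qed

lemma fourier_tgauss_vec_inversion:
  fixes x :: "real^'n::finite"
  assumes "0 < a" "finite K"
  shows "integrable lborel (\<lambda>\<xi>. cis (x \<bullet> \<xi>) * fourier (tgauss_vec a K c \<eta>) \<xi>)"
    and "complex_of_real ((2 * pi) powr (- real CARD('n))) * (\<integral>\<xi>. cis (x \<bullet> \<xi>) * fourier (tgauss_vec a K c \<eta>) \<xi> \<partial>lborel) = tgauss_vec a K c \<eta> x"
proof -
  have eq: "cis (x \<bullet> \<xi>) * fourier (tgauss_vec a K c \<eta>) \<xi> = (\<Prod>i\<in>UNIV. cis (x$i * \<xi>$i) * tgauss_hat a K c \<eta> (\<xi>$i))" for \<xi>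
    unfolding fourier_tgauss_vec[OF assms] cis_inner by (simp add: prod.distrib)
  show "integrable lborel (\<lambda>\<xi>. cis (x \<bullet> \<xi>) * fourier (tgauss_vec a K c \<eta>) \<xi>)"
    unfolding eq by (rule integral_tensor) (rule tgauss_hat_inversion[OF assms])
  have "(\<integral>\<xi>. cis (x \<bullet> \<xi>) * fourier (tgauss_vec a K c \<eta>) \<xi> \<partial>lborel) = (\<Prod>i\<in>UNIV. of_real (2 * pi) * tgauss a K c \<eta> (of_real (x$i)))"
    unfolding eq by (subst integral_tensor(2)) (simp_all add: tgauss_hat_inversion[OF assms])
  also have "\<dots> = of_real ((2 * pi) ^ CARD('n)) * tgauss_vec a K c \<eta> x"
    by (simp add: tgauss_vec_def prod.distrib)
  also have "(2 * pi) ^ CARD('n) = (2 * pi) powr real CARD('n)" by (simp add: powr_realpow)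
  finally show "complex_of_real ((2 * pi) powr (- real CARD('n))) * (\<integral>\<xi>. cis (x \<bullet> \<xi>) * fourier (tgauss_vec a K c \<eta>) \<xi> \<partial>lborel) = tgauss_vec a K c \<eta> x"
    by (simp only: mult.assoc[symmetric] of_real_mult[symmetric] powr_add[symmetric]) simp
qed

text \<open>The maximum from \<open>poly_exp_bound\<close> at b = 1 / (4 * a), the parameter of the
  transformed Gaussian, times its height sqrt (pi / a).\<close>

definition gauss_dec_const :: "real \<Rightarrow> nat \<Rightarrow> real" where
  "gauss_dec_const a M = sqrt (pi / a) * exp (real M ^ 2 * a)"

text \<open>Each Gaussian decays away from its own frequency; recentring all of them at omega costs
  a factor 1 + R per power by Peetre's inequality. This is harmless at distances from omega much
  larger than R.\<close>

lemma tgauss_hat_bound: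
  assumes "0 < a" "\<And>k. k \<in> K \<Longrightarrow> \<bar>\<eta> k - \<omega>\<bar> \<le> R"
  shows "norm (tgauss_hat a K c \<eta> s) \<le> (\<Sum>k\<in>K. norm (c k)) * gauss_dec_const a M * ((1 + R) * dec (s - \<omega>)) ^ M"
  unfolding tgauss_hat_def sum_distrib_right
proof (rule sum_norm_le)
  fix k assume k: "k \<in> K"
  have "(1 + \<bar>s - \<eta> k\<bar>) ^ M * exp (- (1 / (4 * a)) * (s - \<eta> k)\<^sup>2) \<le> exp (real M ^ 2 * a)"
    using poly_exp_bound[of "1 / (4 * a)" "s - \<eta> k" M] assms(1) by simp
  then have "exp (- (1 / (4 * a)) * (s - \<eta> k)\<^sup>2) \<le> exp (real M ^ 2 * a) * dec (s - \<eta> k) ^ M"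
    by (simp add: dec_def power_one_over field_simps add_pos_nonneg)
  also have "dec (s - \<eta> k) ^ M \<le> ((1 + R) * dec (s - \<omega>)) ^ M"
  proof (intro power_mono)
    have "dec (s - \<eta> k) \<le> dec (s - \<omega>) * (1 + \<bar>\<omega> - \<eta> k\<bar>)"
      using dec_submult[of "s - \<omega>" "\<omega> - \<eta> k"] by simp
    also have "\<dots> \<le> dec (s - \<omega>) * (1 + R)"
      using assms(2)[OF k] dec_pos[of "s - \<omega>"] by (intro mult_left_mono) (auto simp: abs_minus_commute)
    finally show "dec (s - \<eta> k) \<le> (1 + R) * dec (s - \<omega>)" by (simp add: mult.commute)
  qed (simp add: dec_nonneg)
  finally have e: "exp (- (1 / (4 * a)) * (s - \<eta> k)\<^sup>2) \<le> exp (real M ^ 2 * a) * ((1 + R) * dec (s - \<omega>)) ^ M" by simp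
  have "norm (c k * of_real (sqrt (pi / a) * exp (- (1 / (4 * a)) * (s - \<eta> k)\<^sup>2))) = norm (c k) * (sqrt (pi / a) * exp (- (1 / (4 * a)) * (s - \<eta> k)\<^sup>2))"
    using assms(1) by (simp only: norm_mult norm_of_real) simp
  also have "\<dots> \<le> norm (c k) * (sqrt (pi / a) * (exp (real M ^ 2 * a) * ((1 + R) * dec (s - \<omega>)) ^ M))"
    using assms(1) by (intro mult_left_mono e) auto
  finally show "norm (c k * of_real (sqrt (pi / a) * exp (- (1 / (4 * a)) * (s - \<eta> k)\<^sup>2))) \<le> norm (c k) * gauss_dec_const a M * ((1 + R) * dec (s - \<omega>)) ^ M"
    by (simp add: gauss_dec_const_def mult_ac)
qed

section \<open>Masses of Gaussians and their concentration at a point\<close>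

lemma gauss_facts:
  assumes "0 < a"
  shows "integrable lborel (gauss a :: real^'n::finite \<Rightarrow> complex)"
    and "integral\<^sup>L lborel (gauss a :: real^'n::finite \<Rightarrow> complex) = of_real (sqrt (pi / a) ^ CARD('n))"
    and "norm (gauss a (x::real^'n)) = exp (- a * (norm x)\<^sup>2)"
    and "gauss a x = of_real (exp (- a * (norm x)\<^sup>2))"
proof -
  note g = gauss_fourier[OF assms, of 0]
  show "integrable lborel (gauss a :: real^'n::finite \<Rightarrow> complex)"
    unfolding gauss_def[abs_def] by (rule integral_tensor) (use g in simp)
  show "integral\<^sup>L lborel (gauss a :: real^'n::finite \<Rightarrow> complex) = of_real (sqrt (pi / a) ^ CARD('n))"
    unfolding gauss_def[abs_def] by (subst integral_tensor(2)) (use g in simp_all)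
  show e: "gauss a x = of_real (exp (- a * (norm x)\<^sup>2))"
  proof -
    have "(\<Sum>i\<in>UNIV. - a * (x$i)\<^sup>2) = - a * (norm x)\<^sup>2"
      by (simp add: sum_distrib_left[symmetric] sum_negf norm_vec_def L2_set_def sum_nonneg)
    moreover have "(\<Prod>i\<in>UNIV. exp (- a * (x$i)\<^sup>2)) = exp (\<Sum>i\<in>UNIV. - a * (x$i)\<^sup>2)"
      by (simp add: exp_sum)
    ultimately show ?thesis unfolding gauss_def of_real_prod[symmetric] by simp
  qed
  show "norm (gauss a x) = exp (- a * (norm x)\<^sup>2)" unfolding e by (simp only: norm_of_real) simp
qed

lemma integral_norm_gauss:
  assumes "0 < a"
  shows "(\<integral>t. norm (gauss a (t::real^'n::finite)) \<partial>lborel) = sqrt (pi / a) ^ CARD('n)"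
proof -
  have "(gauss a :: real^'n \<Rightarrow> complex) = (\<lambda>t. complex_of_real (norm (gauss a t)))"
    by (simp add: fun_eq_iff gauss_facts(4)[OF assms])
  then have "complex_of_real (\<integral>t. norm (gauss a (t::real^'n)) \<partial>lborel) = integral\<^sup>L lborel (gauss a :: real^'n \<Rightarrow> complex)"
    by (metis integral_complex_of_real)
  then show ?thesis unfolding gauss_facts(2)[OF assms] by (metis of_real_eq_iff)
qed

text \<open>Narrow Gaussians form an approximate identity: at frequency 0, with a translation that
  moves a point \<open>t1\<close> with H(t1) nonzero to the origin, the transform divided by the
  mass of the Gaussian tends to H(t1).\<close>

lemma stft2_gauss_nonzero:
  fixes H :: "real^'n::finite \<Rightarrow> complex"
  assumes H: "H \<in> schwartz" "H \<noteq> (\<lambda>_. 0)"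
  shows "\<exists>a x. 1 \<le> a \<and> stft2 (gauss a) H x 0 \<noteq> 0"
proof (rule ccontr)
  let ?n = "CARD('n)"
  assume "\<not> ?thesis"
  then have z: "stft2 (gauss a) H x 0 = 0" if "1 \<le> a" for a x using that by blast
  obtain t1 where t1: "H t1 \<noteq> 0" using H(2) by auto
  define e where "e = norm (H t1) / 2"
  have e: "0 < e" using t1 by (simp add: e_def)
  have cont: "isCont H t1" using schwartz_continuous[OF H(1)] by (simp add: continuous_on_eq_continuous_at)
  then obtain r where r: "0 < r" "\<And>y. dist y t1 < r \<Longrightarrow> dist (H y) (H t1) < e"
    using e unfolding continuous_at_eps_delta by blast
  obtain B where B: "0 \<le> B" "\<And>x. norm (H x) \<le> B * wt 0 x" using schwartz_wt_bound[OF H(1), of 0] by blast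
  then have B: "0 \<le> B" "\<And>x. norm (H x) \<le> B" by (auto simp: wt_def)
  define I where "I = sqrt pi ^ ?n"
  have I: "(\<integral>t. norm (gauss 1 (t::real^'n)) \<partial>lborel) = I"
    by (simp add: integral_norm_gauss I_def)
  \<comment> \<open>For |t| < r the error in replacing H(t + t1) by H(t1) is at most e = |H(t1)| /
    2, which consumes half of the left side. For |t| >= r, \<open>gauss a\<close> is at most exp(-(a
    - 1) r^2) times \<open>gauss 1\<close>, an exponentially small remainder.\<close>
  have main: "e * sqrt (pi / a) ^ ?n \<le> 2 * B * exp (- (a - 1) * r\<^sup>2) * I" if a: "1 \<le> a" for a
  proof -
    have a0: "0 < a" using a by simp
    have Hm [measurable]: "H \<in> borel_measurable borel" by (rule schwartz_measurable[OF H(1)])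
    have gm [measurable]: "(gauss a :: real^'n \<Rightarrow> complex) \<in> borel_measurable borel"
      by (rule schwartz_measurable[OF gauss_schwartz[OF a0]])
    have ga: "integrable lborel (gauss a :: real^'n \<Rightarrow> complex)" "integrable lborel (gauss 1 :: real^'n \<Rightarrow> complex)"
      using a0 by (auto intro: gauss_facts)
    have i1: "integrable lborel (\<lambda>t. gauss a t * H (t + t1))"
      using stft2_integrable(1)[OF gauss_schwartz[OF a0] H(1), of "- t1" 0] by simp
    have z': "(\<integral>t. gauss a t * H (t + t1) \<partial>lborel) = 0"
      using z[OF a, of "- t1"] by (simp add: stft2_def)
    note Ia = integral_norm_gauss[OF a0, where 'n='n]
    have "2 * e * sqrt (pi / a) ^ ?n = norm (\<integral>t. gauss a t * H t1 \<partial>(lborel :: (real^'n) measure))"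
      using a0 by (simp add: gauss_facts(2)[OF a0] norm_mult e_def norm_power)
    also have "(\<integral>t. gauss a t * H t1 \<partial>(lborel :: (real^'n) measure)) = (\<integral>t. gauss a t * H t1 - gauss a t * H (t + t1) \<partial>lborel)"
      using ga i1 z' by (simp add: Bochner_Integration.integral_diff)
    also have "norm \<dots> \<le> (\<integral>t. e * norm (gauss a (t::real^'n)) + 2 * B * exp (- (a - 1) * r\<^sup>2) * norm (gauss 1 t) \<partial>lborel)"
    proof (rule Bochner_Integration.integral_norm_bound_integral)
      fix t :: "real^'n"
      have "norm (gauss a t * H t1 - gauss a t * H (t + t1)) = norm (gauss a t) * norm (H (t + t1) - H t1)"
        by (simp add: right_diff_distrib[symmetric] norm_mult norm_minus_commute)
      also have "\<dots> \<le> e * norm (gauss a t) + 2 * B * exp (- (a - 1) * r\<^sup>2) * norm (gauss 1 t)"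
      proof (cases "norm t < r")
        case True
        then have "norm (H (t + t1) - H t1) \<le> e" using r(2)[of "t + t1"] by (simp add: dist_norm)
        then have "norm (gauss a t) * norm (H (t + t1) - H t1) \<le> e * norm (gauss a t)"
            by (subst mult.commute) (intro mult_right_mono, auto)
        moreover have "0 \<le> 2 * B * exp (- (a - 1) * r\<^sup>2) * norm (gauss 1 t)" using B by auto
        ultimately show ?thesis by linarith
      next
        case False
        then have "r\<^sup>2 \<le> (norm t)\<^sup>2" using r by (intro power_mono) auto
        then have "(a - 1) * r\<^sup>2 \<le> (a - 1) * (norm t)\<^sup>2" using a by (intro mult_left_mono) auto
        then have "norm (gauss a t) \<le> exp (- (a - 1) * r\<^sup>2) * norm (gauss 1 t)"
          unfolding gauss_facts(3)[OF a0] gauss_facts(3)[OF zero_less_one] exp_add[symmetric] by (simp add: algebra_simps)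
        moreover have "norm (H (t + t1) - H t1) \<le> 2 * B"
          using norm_triangle_ineq4[of "H (t + t1)" "H t1"] B(2)[of "t + t1"] B(2)[of t1] by simp
        ultimately have "norm (gauss a t) * norm (H (t + t1) - H t1) \<le> (exp (- (a - 1) * r\<^sup>2) * norm (gauss 1 t)) * (2 * B)"
          by (intro mult_mono) auto
        moreover have "0 \<le> e * norm (gauss a t)" using e by simp
        ultimately show ?thesis by (simp add: mult_ac)
      qed
      finally show "norm (gauss a t * H t1 - gauss a t * H (t + t1)) \<le> e * norm (gauss a t) + 2 * B * exp (- (a - 1) * r\<^sup>2) * norm (gauss 1 t)" .
    qed (use ga i1 in auto)
    also have "\<dots> = e * sqrt (pi / a) ^ ?n + 2 * B * exp (- (a - 1) * r\<^sup>2) * I"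
      using ga by (subst Bochner_Integration.integral_add) (auto simp: Ia I)
    finally show ?thesis by simp
  qed
  have lim: "((\<lambda>a::real. 2 * B * I * exp (r\<^sup>2) * (a ^ ?n * exp (- (a * r\<^sup>2)))) \<longlongrightarrow> 2 * B * I * exp (r\<^sup>2) * 0) at_top"
  proof (intro tendsto_intros)
    have "((\<lambda>a. (1 / (r\<^sup>2) ^ ?n) * ((a * r\<^sup>2) ^ ?n / exp (a * r\<^sup>2))) \<longlongrightarrow> (1 / (r\<^sup>2) ^ ?n) * 0) at_top"
      by (intro tendsto_mult tendsto_const filterlim_compose[OF tendsto_power_div_exp_0] filterlim_at_top_mult_tendsto_pos[where c="r\<^sup>2"] filterlim_ident)
         (use r in \<open>auto simp: mult.commute intro!: filterlim_tendsto_pos_mult_at_top[OF tendsto_const] filterlim_ident\<close>)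
    moreover have "(1 / (r\<^sup>2) ^ ?n) * ((a * r\<^sup>2) ^ ?n / exp (a * r\<^sup>2)) = a ^ ?n * exp (- (a * r\<^sup>2))" for a
      using r by (simp add: power_mult_distrib exp_minus field_simps)
    ultimately show "((\<lambda>a. a ^ ?n * exp (- (a * r\<^sup>2))) \<longlongrightarrow> 0) at_top" by simp
  qed
  have "\<forall>\<^sub>F a in at_top. e \<le> 2 * B * I * exp (r\<^sup>2) * (a ^ ?n * exp (- (a * r\<^sup>2)))"
    using eventually_ge_at_top[of "1::real"]
  proof eventually_elim
    case (elim a)
    \<comment> \<open>Replaces the root by a power of 1 / a, so that the limit of a power against an
      exponential settles the contradiction.\<close>
    have "1 / a \<le> sqrt (pi / a)"
    proof (rule real_le_rsqrt)
      have "1 \<le> a * pi" using elim mult_mono[of 1 a 1 pi] pi_ge_two by simp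
      then show "(1 / a)\<^sup>2 \<le> pi / a" using elim by (simp add: power2_eq_square field_simps)
    qed
    then have "e * (1 / a) ^ ?n \<le> e * sqrt (pi / a) ^ ?n" using e elim by (intro mult_left_mono power_mono) auto
    also have "\<dots> \<le> 2 * B * exp (- (a - 1) * r\<^sup>2) * I" by (rule main[OF elim])
    also have "exp (- (a - 1) * r\<^sup>2) = exp (r\<^sup>2) * exp (- (a * r\<^sup>2))" by (simp add: exp_add[symmetric] algebra_simps)
    finally show ?case using elim by (simp add: power_one_over field_simps)
  qed
  then have "e \<le> 2 * B * I * exp (r\<^sup>2) * 0"
    by (rule tendsto_lowerbound[OF lim]) simp
  with e show False by simp
qed

section \<open>Bounds for the modulation space norm\<close>

lemma enn_powr_mono:
  assumes "a \<le> b" "0 \<le> r"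
  shows "enn_powr a r \<le> enn_powr b r"
proof (cases "b = \<infinity>")
  case False
  then have "a \<noteq> \<infinity>" "enn2real a \<le> enn2real b" using assms by (auto simp: top_unique less_top intro!: enn2real_mono)
  then show ?thesis using False assms by (auto simp: enn_powr_def intro!: ennreal_leI powr_mono2)
qed (simp add: enn_powr_def)

lemma enn_powr_ennreal: "0 \<le> x \<Longrightarrow> enn_powr (ennreal x) r = ennreal (x powr r)"
  by (simp add: enn_powr_def)

text \<open>With a separable majorant the mixed norm factors. As \<open>wt 2\<close> is at most 1
  and p >= 1, its p-th power may be replaced by itself, so one integral serves all p; the n
  frequency integrals give the power n / q of J.\<close>

lemma mod_norm_upper:
  fixes \<gamma> f :: "real^'n::finite \<Rightarrow> complex"
  assumes p: "1 \<le> p" and q: "1 \<le> q"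
    and C: "0 \<le> C" and s: "\<And>t. 0 \<le> s t" "s \<in> borel_measurable borel"
    and b: "\<And>x \<xi>. norm (stft \<gamma> f x \<xi>) \<le> C * wt 2 x * (\<Prod>i\<in>UNIV. s (\<xi>$i))"
    and J: "0 \<le> J" "(\<integral>\<^sup>+ t. ennreal (s t powr q) \<partial>lborel) \<le> ennreal J"
  shows "mod_norm p q \<gamma> f \<le> ennreal (C * (\<integral>x. wt 2 (x::real^'n) \<partial>lborel) powr (1 / p) * J powr (real CARD('n) / q))"
proof -
  let ?n = "real CARD('n)"
  define I where "I = (\<integral>x. wt 2 (x::real^'n) \<partial>lborel)"
  have I0: "0 \<le> I" unfolding I_def by (rule integral_nonneg_AE) (auto simp: wt_nonneg)
  have I: "(\<integral>\<^sup>+ x. ennreal (wt 2 (x::real^'n)) \<partial>lborel) = ennreal I"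
    unfolding I_def by (rule nn_integral_eq_integral) (auto simp: wt_nonneg wt_integrable)
  define S where "S \<xi> = (\<Prod>i\<in>UNIV. s (\<xi>$i))" for \<xi> :: "real^'n"
  have S0: "0 \<le> S \<xi>" for \<xi> unfolding S_def by (intro prod_nonneg) (use s in auto)
  have inner: "(\<integral>\<^sup>+ x. ennreal (norm (stft \<gamma> f x \<xi>) powr p) \<partial>lborel) \<le> ennreal ((C * S \<xi>) powr p * I)" for \<xi>
  proof -
    have "(\<integral>\<^sup>+ x. ennreal (norm (stft \<gamma> f x \<xi>) powr p) \<partial>lborel) \<le> (\<integral>\<^sup>+ x. ennreal ((C * S \<xi>) powr p) * ennreal (wt 2 (x::real^'n)) \<partial>lborel)"
    proof (intro nn_integral_mono)
      fix x :: "real^'n"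
      have "norm (stft \<gamma> f x \<xi>) powr p \<le> ((C * S \<xi>) * wt 2 x) powr p"
        using b[of x \<xi>] p by (intro powr_mono2) (auto simp: S_def mult_ac)
      also have "\<dots> = (C * S \<xi>) powr p * wt 2 x powr p"
        using C S0 by (simp add: powr_mult)
      also have "wt 2 x powr p \<le> wt 2 x powr 1"
        using p by (intro powr_mono') (auto simp: wt_nonneg wt_le_1)
      finally have "norm (stft \<gamma> f x \<xi>) powr p \<le> (C * S \<xi>) powr p * wt 2 x"
        using wt_pos[of 2 x] by (simp add: mult_left_mono)
      then show "ennreal (norm (stft \<gamma> f x \<xi>) powr p) \<le> ennreal ((C * S \<xi>) powr p) * ennreal (wt 2 x)"
        by (subst ennreal_mult[symmetric]) (auto simp: wt_nonneg intro: ennreal_leI)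
    qed
    also have "\<dots> = ennreal ((C * S \<xi>) powr p * I)"
      using I0 by (subst nn_integral_cmult) (auto simp: I ennreal_mult)
    finally show ?thesis .
  qed
  have mid: "enn_powr (\<integral>\<^sup>+ x. ennreal (norm (stft \<gamma> f x \<xi>) powr p) \<partial>lborel) (q / p) \<le> ennreal (C powr q * I powr (q / p)) * (\<Prod>i\<in>UNIV. ennreal (s (\<xi>$i) powr q))" for \<xi>
  proof -
    have "enn_powr (\<integral>\<^sup>+ x. ennreal (norm (stft \<gamma> f x \<xi>) powr p) \<partial>lborel) (q / p) \<le> enn_powr (ennreal ((C * S \<xi>) powr p * I)) (q / p)"
      using p q by (intro enn_powr_mono inner) auto
    also have "\<dots> = ennreal (((C * S \<xi>) powr p * I) powr (q / p))"
      using I0 by (intro enn_powr_ennreal) auto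
    also have "((C * S \<xi>) powr p * I) powr (q / p) = (C powr q * I powr (q / p)) * S \<xi> powr q"
      using C S0 I0 p by (simp add: powr_mult powr_powr)
    also have "S \<xi> powr q = (\<Prod>i\<in>UNIV. s (\<xi>$i) powr q)"
      unfolding S_def using s(1) by (simp add: prod_powr_distrib)
    also have "ennreal ((C powr q * I powr (q / p)) * (\<Prod>i\<in>UNIV. s (\<xi>$i) powr q)) = ennreal (C powr q * I powr (q / p)) * (\<Prod>i\<in>UNIV. ennreal (s (\<xi>$i) powr q))"
      by (subst ennreal_mult) (auto simp: prod_ennreal prod_nonneg)
    finally show ?thesis .
  qed
  have [measurable]: "s \<in> borel_measurable borel" by (rule s)
  have "(\<integral>\<^sup>+ \<xi>. enn_powr (\<integral>\<^sup>+ x. ennreal (norm (stft \<gamma> f x \<xi>) powr p) \<partial>lborel) (q / p) \<partial>lborel)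
      \<le> (\<integral>\<^sup>+ \<xi>. ennreal (C powr q * I powr (q / p)) * (\<Prod>i\<in>(UNIV::'n set). ennreal (s (\<xi>$i) powr q)) \<partial>lborel)"
    by (intro nn_integral_mono mid)
  also have "\<dots> = ennreal (C powr q * I powr (q / p)) * (\<Prod>i\<in>(UNIV::'n set). (\<integral>\<^sup>+ t. ennreal (s t powr q) \<partial>lborel))"
    by (subst nn_integral_cmult) (auto simp: nn_integral_tensor[where f="\<lambda>_ t. ennreal (s t powr q)"])
  also have "\<dots> \<le> ennreal (C powr q * I powr (q / p)) * (\<Prod>i\<in>(UNIV::'n set). ennreal J)"
  proof -
    have "(\<integral>\<^sup>+ t. ennreal (s t powr q) \<partial>lborel) ^ k \<le> ennreal J ^ k" for k
      by (induction k) (auto intro!: mult_mono J)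
    then show ?thesis by (simp add: mult_left_mono)
  qed
  also have "\<dots> = ennreal (C powr q * I powr (q / p) * J ^ CARD('n))"
    using J(1) by (subst ennreal_mult) (auto simp: ennreal_power)
  finally have "mod_norm p q \<gamma> f \<le> enn_powr (ennreal (C powr q * I powr (q / p) * J ^ CARD('n))) (1 / q)"
    unfolding mod_norm_def using q by (intro enn_powr_mono) auto
  also have "\<dots> = ennreal ((C powr q * I powr (q / p) * J ^ CARD('n)) powr (1 / q))"
    using J(1) by (intro enn_powr_ennreal) auto
  also have "(C powr q * I powr (q / p) * J ^ CARD('n)) powr (1 / q) = C * I powr (1 / p) * J powr (?n / q)"
  proof (cases "J = 0")
    case True
    then show ?thesis using q by (simp add: power_0_left)
  next
    case False
    then have "J ^ CARD('n) = J powr ?n" using J(1) by (simp add: powr_realpow)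
    then show ?thesis using C I0 J(1) q by (simp add: powr_mult powr_powr)
  qed
  finally show ?thesis by (simp add: I_def)
qed

text \<open>X will be a ball in position and Y a union of disjoint balls around packet frequencies,
  so that \<open>\<nu>\<close> is proportional to the number of packets.\<close>

lemma mod_norm_lower:
  fixes \<gamma> f :: "real^'n::finite \<Rightarrow> complex"
  assumes p: "1 \<le> p" and q: "1 \<le> q"
    and v: "0 \<le> v" "\<And>x \<xi>. x \<in> X \<Longrightarrow> \<xi> \<in> Y \<Longrightarrow> v \<le> norm (stft \<gamma> f x \<xi>)"
    and X: "X \<in> sets borel" "emeasure lborel X = ennreal \<mu>" "0 \<le> \<mu>"
    and Y: "Y \<in> sets borel" "emeasure lborel Y = ennreal \<nu>" "0 \<le> \<nu>"
  shows "ennreal (v * \<mu> powr (1 / p) * \<nu> powr (1 / q)) \<le> mod_norm p q \<gamma> f"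
proof -
  have inner: "ennreal (v powr p * \<mu>) \<le> (\<integral>\<^sup>+ x. ennreal (norm (stft \<gamma> f x \<xi>) powr p) \<partial>lborel)" if "\<xi> \<in> Y" for \<xi>
  proof -
    have "ennreal (v powr p * \<mu>) = (\<integral>\<^sup>+ x. ennreal (v powr p) * indicator X x \<partial>lborel)"
      using X by (simp add: nn_integral_cmult_indicator ennreal_mult)
    also have "\<dots> \<le> (\<integral>\<^sup>+ x. ennreal (norm (stft \<gamma> f x \<xi>) powr p) \<partial>lborel)"
      using v that p by (intro nn_integral_mono) (auto simp: indicator_def intro!: ennreal_leI powr_mono2)
    finally show ?thesis .
  qed
  have mid: "ennreal (v powr q * \<mu> powr (q / p)) * indicator Y \<xi> \<le> enn_powr (\<integral>\<^sup>+ x. ennreal (norm (stft \<gamma> f x \<xi>) powr p) \<partial>lborel) (q / p)" for \<xi>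
  proof (cases "\<xi> \<in> Y")
    case True
    have "ennreal (v powr q * \<mu> powr (q / p)) = enn_powr (ennreal (v powr p * \<mu>)) (q / p)"
      using X(3) v(1) p by (subst enn_powr_ennreal) (auto simp: powr_mult powr_powr)
    also have "\<dots> \<le> enn_powr (\<integral>\<^sup>+ x. ennreal (norm (stft \<gamma> f x \<xi>) powr p) \<partial>lborel) (q / p)"
      using p q by (intro enn_powr_mono inner True) auto
    finally show ?thesis using True by simp
  qed simp
  have "ennreal (v powr q * \<mu> powr (q / p) * \<nu>) = (\<integral>\<^sup>+ \<xi>. ennreal (v powr q * \<mu> powr (q / p)) * indicator Y \<xi> \<partial>lborel)"
    using Y by (simp add: nn_integral_cmult_indicator ennreal_mult)
  also have "\<dots> \<le> (\<integral>\<^sup>+ \<xi>. enn_powr (\<integral>\<^sup>+ x. ennreal (norm (stft \<gamma> f x \<xi>) powr p) \<partial>lborel) (q / p) \<partial>lborel)"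
    by (intro nn_integral_mono mid)
  finally have "enn_powr (ennreal (v powr q * \<mu> powr (q / p) * \<nu>)) (1 / q) \<le> mod_norm p q \<gamma> f"
    unfolding mod_norm_def using q by (intro enn_powr_mono) auto
  moreover have "enn_powr (ennreal (v powr q * \<mu> powr (q / p) * \<nu>)) (1 / q) = ennreal (v * \<mu> powr (1 / p) * \<nu> powr (1 / q))"
    using v(1) X(3) Y(3) q by (subst enn_powr_ennreal) (auto simp: powr_mult powr_powr)
  ultimately show ?thesis by simp
qed

text \<open>The sum u of the weights is bounded uniformly, so u^q <= const^(q-1) * u. This reduces
  the q-th power to an integral linear in the packets, and their number comes out with exponent one,
  as for disjoint packets.\<close>

lemma dec_sum_powr_integral:
  fixes K :: "int set"
  assumes K: "finite K" and q: "1 \<le> q" and L: "1 \<le> L" and \<eta>: "\<And>l. \<eta> l = \<omega> + L * real_of_int l" and A: "0 \<le> A"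
  shows "(\<integral>\<^sup>+ t. ennreal ((\<Sum>k\<in>K. A * dec (t - \<eta> k) ^ 3) powr q) \<partial>lborel)
    \<le> ennreal (A powr q * dec_sum_const powr (q - 1) * (real (card K) * (\<integral>t. dec t ^ 3 \<partial>lborel)))"
proof -
  have i3: "integrable lborel (\<lambda>t. dec t ^ 3)" by (rule dec_integrable) simp
  define J where "J = (\<integral>t. dec t ^ 3 \<partial>lborel)"
  have J0: "0 \<le> J" unfolding J_def by (rule integral_nonneg_AE) (auto simp: dec_nonneg)
  have J: "(\<integral>\<^sup>+ t. ennreal (dec t ^ 3) \<partial>lborel) = ennreal J"
    unfolding J_def by (rule nn_integral_eq_integral[OF i3]) (auto simp: dec_nonneg)
  have b: "(\<Sum>k\<in>K. A * dec (t - \<eta> k) ^ 3) powr q \<le> A powr q * dec_sum_const powr (q - 1) * (\<Sum>k\<in>K. dec (t - \<eta> k) ^ 3)" for t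
  proof -
    define u where "u = (\<Sum>k\<in>K. dec (t - \<eta> k) ^ 3)"
    have u0: "0 \<le> u" unfolding u_def by (intro sum_nonneg) (auto simp: dec_nonneg)
    have "u \<le> (\<Sum>k\<in>K. dec ((t - \<omega>) - L * real_of_int k) ^ 2)"
      unfolding u_def by (intro sum_mono) (auto simp: \<eta> diff_diff_eq dec_nonneg dec_le_1 intro!: power_decreasing)
    also have "\<dots> \<le> dec_sum_const" by (intro dec_sum_bound L K)
    finally have uc: "u \<le> dec_sum_const" .
    have "(\<Sum>k\<in>K. A * dec (t - \<eta> k) ^ 3) powr q = A powr q * u powr q"
      unfolding u_def using A by (subst sum_distrib_left[symmetric], subst powr_mult) (auto intro!: sum_nonneg simp: dec_nonneg)
    also have "u powr q = u powr (q - 1) * u"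
      using u0 by (cases "u = 0") (simp_all add: powr_diff)
    also have "u powr (q - 1) * u \<le> dec_sum_const powr (q - 1) * u"
      using u0 uc q by (intro mult_right_mono powr_mono2) auto
    finally show ?thesis by (simp add: u_def mult_left_mono mult.assoc)
  qed
  have "(\<integral>\<^sup>+ t. ennreal ((\<Sum>k\<in>K. A * dec (t - \<eta> k) ^ 3) powr q) \<partial>lborel)
    \<le> (\<integral>\<^sup>+ t. ennreal (A powr q * dec_sum_const powr (q - 1)) * (\<Sum>k\<in>K. ennreal (dec (t - \<eta> k) ^ 3)) \<partial>lborel)"
  proof (intro nn_integral_mono)
    fix t
    have "ennreal ((\<Sum>k\<in>K. A * dec (t - \<eta> k) ^ 3) powr q) \<le> ennreal (A powr q * dec_sum_const powr (q - 1) * (\<Sum>k\<in>K. dec (t - \<eta> k) ^ 3))"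
      by (intro ennreal_leI b)
    also have "\<dots> = ennreal (A powr q * dec_sum_const powr (q - 1)) * (\<Sum>k\<in>K. ennreal (dec (t - \<eta> k) ^ 3))"
      by (subst ennreal_mult) (auto simp: dec_nonneg intro!: sum_nonneg)
    finally show "ennreal ((\<Sum>k\<in>K. A * dec (t - \<eta> k) ^ 3) powr q) \<le> \<dots>" .
  qed
  also have "\<dots> = ennreal (A powr q * dec_sum_const powr (q - 1)) * (\<Sum>k\<in>K. (\<integral>\<^sup>+ t. ennreal (dec (t - \<eta> k) ^ 3) \<partial>lborel))"
    by (subst nn_integral_cmult) (auto simp: nn_integral_sum)
  also have "\<dots> = ennreal (A powr q * dec_sum_const powr (q - 1)) * (\<Sum>k\<in>K. ennreal J)"
  proof -
    have "(\<integral>\<^sup>+ t. ennreal (dec (t - \<eta> k) ^ 3) \<partial>lborel) = ennreal J" for k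
      using nn_integral_translate[of "\<lambda>t. ennreal (dec t ^ 3)" "- \<eta> k"] by (simp add: J)
    then show ?thesis by (simp only:)
  qed
  also have "ennreal (A powr q * dec_sum_const powr (q - 1)) * (\<Sum>k\<in>K. ennreal J) = ennreal (A powr q * dec_sum_const powr (q - 1) * (real (card K) * J))"
    using J0 by (simp add: ennreal_mult ennreal_of_nat_eq_real_of_nat)
  finally show ?thesis by (simp add: J_def)
qed

section \<open>The symbol\<close>

lemma prod_UNIV_sum:
  fixes f :: "'a::finite + 'b::finite \<Rightarrow> 'c::comm_monoid_mult"
  shows "(\<Prod>s\<in>UNIV. f s) = (\<Prod>i\<in>UNIV. f (Inl i)) * (\<Prod>i\<in>UNIV. f (Inr i))"
  unfolding UNIV_Plus_UNIV[symmetric] by (subst prod.Plus) auto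

text \<open>The exponent in a symbol estimate may have either sign: a <= b is used for E >= 0 and b
  <= c * a for E < 0.\<close>

lemma powr_le_comparable:
  fixes a b c E :: real
  assumes "0 < a" "a \<le> b" "b \<le> c * a" "1 \<le> c"
  shows "a powr E \<le> c powr \<bar>E\<bar> * b powr E"
proof (cases "0 \<le> E")
  case True
  then have "a powr E \<le> b powr E" using assms by (intro powr_mono2) auto
  moreover have "1 \<le> c powr \<bar>E\<bar>" using assms by (intro ge_one_powr_ge_zero) auto
  ultimately show ?thesis using mult_right_mono[of 1 "c powr \<bar>E\<bar>" "b powr E"] by simp
next
  case False
  have "a powr E \<le> (b / c) powr E"
    using assms False by (intro powr_mono2') (auto simp: field_simps)
  also have "\<dots> = c powr \<bar>E\<bar> * b powr E"
    using assms False by (simp add: powr_divide powr_minus field_simps)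
  finally show ?thesis .
qed

lemma count_list_map_Inl_Inr:
  fixes \<alpha> :: "'b list" and \<beta> :: "'a list"
  shows "count_list (map Inr \<alpha> @ map Inl \<beta>) (Inl i) = count_list \<beta> i"
  "count_list (map Inr \<alpha> @ map Inl \<beta>) (Inr k) = count_list \<alpha> k"
proof -
  have "count_list (map Inr \<alpha>) (Inl i) = 0" for \<alpha> :: "'b list" by (induction \<alpha>) auto
  moreover have "count_list (map Inl \<beta>) (Inl i) = count_list \<beta> i" by (induction \<beta>) auto
  ultimately show "count_list (map Inr \<alpha> @ map Inl \<beta>) (Inl i) = count_list \<beta> i" by simp
next
  have "count_list (map Inl \<beta>) (Inr k) = 0" for \<beta> :: "'a list" by (induction \<beta>) auto
  moreover have "count_list (map Inr \<alpha>) (Inr k) = count_list \<alpha> k" by (induction \<alpha>) auto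
  ultimately show "count_list (map Inr \<alpha> @ map Inl \<beta>) (Inr k) = count_list \<alpha> k" by simp
qed

lemma sum_count_list_UNIV: "(\<Sum>i\<in>UNIV. count_list xs i) = length (xs :: 'n::finite list)"
  by (rule sum_count_set) auto

text \<open>The base 4 exceeds the ratio 2 between the ends of the support of the cutoff, so the
  scales are separated by gaps.\<close>

lemma four_power_separated:
  fixes t :: real
  assumes "4 ^ j \<le> t" "t \<le> 2 * 4 ^ j" "4 ^ k \<le> t" "t \<le> 2 * 4 ^ k"
  shows "j = k"
proof -
  have "\<not> j < k" if "4 ^ j \<le> t" "t \<le> 2 * 4 ^ j" "4 ^ k \<le> t" for j k
  proof
    assume "j < k"
    then have "(4::real) ^ Suc j \<le> 4 ^ k" by (intro power_increasing) auto
    then have "(4::real) * 4 ^ j \<le> 4 ^ k" by simp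
    then show False using that zero_less_power[of "4::real" j] by linarith
  qed
  then show ?thesis using assms by (meson linorder_neqE_nat)
qed

text \<open>The symbol estimates see only the product of the gap \<open>L j\<close> and the number
  \<open>2 ^ N j\<close> of frequencies. How 4^(j*delta) is divided between the two is left open
  until the final theorem.\<close>

locale lacunary_symbol =
  fixes m \<delta> :: real and N :: "nat \<Rightarrow> nat" and L :: "nat \<Rightarrow> real" and W :: "nat \<Rightarrow> real \<Rightarrow> complex"
  assumes \<delta>: "0 < \<delta>" "\<delta> < 1"
    and L: "\<And>j. 0 \<le> L j" "\<And>j. L j * 2 ^ N j = (4 ^ j) powr \<delta>"
    and W: "deriv_seq W" "\<And>t. t \<in> {5/4..7/4} \<Longrightarrow> W 0 t = 1"
      "\<And>k t. t \<notin> {1..2} \<Longrightarrow> W k t = 0" "\<And>k. \<exists>C. \<forall>t. norm (W k t) \<le> C"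
begin

definition bf :: "nat \<Rightarrow> real^'n::finite \<Rightarrow> complex" where
  "bf j x = (\<Prod>i\<in>UNIV. rs_b (N j) (L j) (of_real (x$i)))"

definition psi :: "nat \<Rightarrow> real^'n::finite \<Rightarrow> complex" where
  "psi j \<xi> = (\<Prod>i\<in>UNIV. W 0 (\<xi>$i / 4 ^ j))"

definition piece :: "nat \<Rightarrow> (real^'n::finite) \<times> (real^'n) \<Rightarrow> complex" where
  "piece j y = of_real ((4 ^ j) powr m) * (bf j (fst y) * psi j (snd y))"

text \<open>
  The supports of the functions psi j are disjoint; where all of them vanish, the value of the choice
  operator is irrelevant because then every piece vanishes.
\<close>

definition sig :: "(real^'n::finite) \<times> (real^'n) \<Rightarrow> complex" where
  "sig y = piece (SOME j. psi j (snd y) \<noteq> 0) y"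

text \<open>Phase space gets coordinates indexed by \<open>'n + 'n\<close>, with \<open>Inl\<close>
  for position and \<open>Inr\<close> for frequency. Together with \<open>lin\<close> and
  \<open>dir\<close> this brings \<open>piece\<close> into the form of
  \<open>dderivs_tensor\<close>; the power of 1 / 4^j is the chain rule factor of the rescaled
  cutoff.\<close>

definition fac :: "nat \<Rightarrow> 'n + 'n \<Rightarrow> nat \<Rightarrow> real \<Rightarrow> complex" where
  "fac j s k t = (case s of Inl i \<Rightarrow> (deriv ^^ k) (rs_b (N j) (L j)) (of_real t)
                  | Inr i \<Rightarrow> of_real ((1 / 4 ^ j) ^ k) * W k (t / 4 ^ j))"

definition lin :: "'n + 'n \<Rightarrow> (real^'n::finite) \<times> (real^'n) \<Rightarrow> real" where
  "lin s y = (case s of Inl i \<Rightarrow> fst y $ i | Inr i \<Rightarrow> snd y $ i)"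

definition dir :: "'n + 'n \<Rightarrow> (real^'n::finite) \<times> (real^'n)" where
  "dir s = (case s of Inl i \<Rightarrow> x_dir i | Inr i \<Rightarrow> xi_dir i)"

lemma lin_dir: "lin s (y + t *\<^sub>R dir r) = lin s y + (if s = r then t else 0)"
  by (cases s; cases r) (auto simp: lin_def dir_def x_dir_def xi_dir_def axis_def)

lemma lin_continuous: "continuous_on UNIV (lin s)"
  unfolding lin_def by (cases s) (auto intro!: continuous_intros)

lemma range_dir: "range dir = range x_dir \<union> range xi_dir"
  unfolding UNIV_Plus_UNIV[symmetric] Plus_def by (simp add: image_Un image_image dir_def)

lemma deriv_seq_fac: "deriv_seq (fac j s)"
proof (cases s)
  case (Inl i)
  have "fac j s = (\<lambda>k t. (deriv ^^ k) (rs_b (N j) (L j)) (of_real t))"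
    by (simp add: fun_eq_iff fac_def Inl)
  then show ?thesis using deriv_seq_entire[OF rs_b_holomorphic] by simp
next
  case (Inr i)
  have eq: "fac j s k = (\<lambda>t. of_real ((1 / 4 ^ j) ^ k) * W k (t / 4 ^ j))" for k
    by (simp add: fun_eq_iff fac_def Inr)
  show ?thesis unfolding deriv_seq_def
  proof (intro allI)
    fix k t
    have 1: "((\<lambda>t::real. t / 4 ^ j) has_vector_derivative 1 / 4 ^ j) (at t)"
      by (auto intro!: derivative_eq_intros)
    have "((\<lambda>t. W k (t / 4 ^ j)) has_vector_derivative (1 / 4 ^ j) *\<^sub>R W (Suc k) (t / 4 ^ j)) (at t)"
      using vector_diff_chain_at[OF 1 deriv_seqD[OF W(1)]] by (simp add: o_def)
    from has_vector_derivative_mult_right[OF this, of "of_real ((1 / 4 ^ j) ^ k)"]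
    show "(fac j s k has_vector_derivative fac j s (Suc k) t) (at t)"
      unfolding eq by (simp add: scaleR_conv_of_real mult_ac)
  qed
qed

lemma piece_tensor: "piece j = (\<lambda>y. of_real ((4 ^ j) powr m) * (\<Prod>s\<in>UNIV. fac j s 0 (lin s y)))"
  by (simp add: fun_eq_iff piece_def prod_UNIV_sum fac_def lin_def bf_def psi_def)

lemma smooth_piece: "smooth_dirs (range x_dir \<union> range xi_dir) (piece j)"
  unfolding piece_tensor range_dir[symmetric]
  by (rule smooth_dirs_tensor[OF lin_dir lin_continuous deriv_seq_fac])

lemma dderivs_piece:
  "dderivs (map xi_dir \<alpha> @ map x_dir \<beta>) (piece j) (x, \<xi>) = of_real ((4 ^ j) powr m) *
     ((\<Prod>i\<in>UNIV. (deriv ^^ count_list \<beta> i) (rs_b (N j) (L j)) (of_real (x$i))) *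
      (\<Prod>i\<in>UNIV. of_real ((1 / 4 ^ j) ^ count_list \<alpha> i) * W (count_list \<alpha> i) (\<xi>$i / 4 ^ j)))"
proof -
  have "map xi_dir \<alpha> @ map x_dir \<beta> = map dir (map Inr \<alpha> @ map Inl \<beta>)"
    by (simp add: dir_def o_def)
  then have "dderivs (map xi_dir \<alpha> @ map x_dir \<beta>) (piece j) (x, \<xi>) = of_real ((4 ^ j) powr m) *
      (\<Prod>s\<in>UNIV. fac j s (count_list (map Inr \<alpha> @ map Inl \<beta>) s) (lin s (x, \<xi>)))"
    unfolding piece_tensor by (simp only: dderivs_tensor[OF lin_dir deriv_seq_fac])
  also have "\<dots> = of_real ((4 ^ j) powr m) *
     ((\<Prod>i\<in>UNIV. (deriv ^^ count_list \<beta> i) (rs_b (N j) (L j)) (of_real (x$i))) *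
      (\<Prod>i\<in>UNIV. of_real ((1 / 4 ^ j) ^ count_list \<alpha> i) * W (count_list \<alpha> i) (\<xi>$i / 4 ^ j)))"
    unfolding prod_UNIV_sum count_list_map_Inl_Inr by (simp add: fac_def lin_def)
  finally show ?thesis .
qed

lemma psi_nonzero:
  fixes \<xi> :: "real^'n::finite"
  assumes "psi j \<xi> \<noteq> 0"
  shows "4 ^ j \<le> \<xi>$i" "\<xi>$i \<le> 2 * 4 ^ j"
proof -
  have "W 0 (\<xi>$i / 4 ^ j) \<noteq> 0" using assms by (auto simp: psi_def)
  then have "\<xi>$i / 4 ^ j \<in> {1..2}" using W(3) by blast
  then show "4 ^ j \<le> \<xi>$i" "\<xi>$i \<le> 2 * 4 ^ j" by (auto simp: field_simps)
qed

lemma sig_eq_piece: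
  assumes "\<And>k. k \<noteq> j \<Longrightarrow> psi k (snd y) = 0"
  shows "sig y = piece j y"
proof (cases "psi j (snd y) = 0")
  case True
  then have "psi k (snd y) = 0" for k using assms by (cases "k = j") auto
  then show ?thesis by (simp add: sig_def piece_def)
next
  case False
  then have "(SOME k. psi k (snd y) \<noteq> 0) = j"
    using assms by (intro some_equality) auto
  then show ?thesis by (simp add: sig_def)
qed

lemma sig_local:
  fixes y :: "(real^'n::finite) \<times> (real^'n)"
  shows "\<exists>U j. open U \<and> y \<in> U \<and> (\<forall>z\<in>U. sig z = piece j z)"
proof -
  \<comment> \<open>Any single coordinate of the frequency reveals the scale, since
    \<open>psi_nonzero\<close> confines every coordinate.\<close>
  define i :: 'n where "i = undefined"
  define t where "t = snd y $ i"
  define k where "k = (LEAST k. t < 4 ^ k)"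
  have "\<exists>k. t < 4 ^ k" by (rule real_arch_pow) simp
  then have k: "t < 4 ^ k" unfolding k_def by (rule LeastI_ex)
  have cont: "continuous_on UNIV (\<lambda>z::(real^'n) \<times> (real^'n). snd z $ i)" by (intro continuous_intros)
  show ?thesis
  proof (cases k)
    case 0
    define U where "U = {z::(real^'n) \<times> (real^'n). snd z $ i < 1}"
    have "open U" unfolding U_def by (intro open_Collect_less cont continuous_on_const)
    moreover have "y \<in> U" using k 0 by (simp add: U_def t_def)
    moreover have "sig z = piece 0 z" if "z \<in> U" for z
    proof (rule sig_eq_piece, rule ccontr)
      fix l assume "psi l (snd z) \<noteq> 0"
      from psi_nonzero(1)[OF this, of i] that have "(4::real) ^ l < 1" by (simp add: U_def)
      then show False using one_le_power[of "4::real" l] by linarith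
    qed
    ultimately show ?thesis by blast
  next
    case (Suc j)
    have "\<not> t < 4 ^ j" unfolding k_def using Suc not_less_Least[of j "\<lambda>k. t < 4 ^ k"] k_def by simp
    then have t: "4 ^ j \<le> t" "t < 4 ^ Suc j" using k Suc by auto
    \<comment> \<open>On this slab only scale j can be active: smaller scales end at 2 * 4^l <= 4^j
      / 2, larger ones begin at 4^l >= 4^(j+1).\<close>
    define U where "U = {z::(real^'n) \<times> (real^'n). 4 ^ j / 2 < snd z $ i} \<inter> {z. snd z $ i < 4 ^ Suc j}"
    have "open U" unfolding U_def by (intro open_Int open_Collect_less cont continuous_on_const)
    moreover have "y \<in> U"
    proof -
      have "(4::real) ^ j / 2 < 4 ^ j" by simp
      then show ?thesis using t by (simp add: U_def t_def[symmetric])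
    qed
    moreover have "sig z = piece j z" if "z \<in> U" for z
    proof (rule sig_eq_piece, rule ccontr)
      fix l assume "l \<noteq> j" and nz: "psi l (snd z) \<noteq> 0"
      show False
      proof (cases "l < j")
        case True
        then have "(4::real) ^ Suc l \<le> 4 ^ j" by (intro power_increasing) auto
        then show False using psi_nonzero(2)[OF nz, of i] that by (simp add: U_def)
      next
        case False
        then have "(4::real) ^ Suc j \<le> 4 ^ l" using \<open>l \<noteq> j\<close> by (intro power_increasing) auto
        then show False using psi_nonzero(1)[OF nz, of i] that by (simp add: U_def)
      qed
    qed
    ultimately show ?thesis by blast
  qed
qed

lemma smooth_sig: "smooth_dirs (range x_dir \<union> range xi_dir) sig"
proof (rule smooth_dirs_local)
  fix y :: "(real^'a) \<times> (real^'a)"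
  show "\<exists>U g. open U \<and> y \<in> U \<and> smooth_dirs (range x_dir \<union> range xi_dir) g \<and> (\<forall>z\<in>U. sig z = g z)"
    using sig_local[of y] smooth_piece by blast
qed

text \<open>On the support of a piece every coordinate of the frequency lies between 4^j and 2 *
  4^j, so 1 + |xi| is comparable to 4^j with constant c = 1 + 2 n. Each x-derivative costs
  4^(j*delta) and each xi-derivative gains 4^(-j), which is the required exponent with constants
  free of j.\<close>

lemma dderivs_piece_bound:
  "\<exists>C. \<forall>j x \<xi>. norm (dderivs (map xi_dir \<alpha> @ map x_dir \<beta>) (piece j) (x, \<xi> :: real^'n::finite))
     \<le> C * (1 + norm \<xi>) powr (m - real (length \<alpha>) + \<delta> * real (length \<beta>))"
proof -
  let ?E = "m - real (length \<alpha>) + \<delta> * real (length \<beta>)"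
  obtain Cw where Cw: "\<And>k t. norm (W k t) \<le> Cw k"
    using W(4) by metis
  define A where "A = (\<Prod>i\<in>(UNIV::'n set). 4 * fact (count_list \<beta> i)) * (\<Prod>i\<in>(UNIV::'n set). Cw (count_list \<alpha> i))"
  have Cw0: "0 \<le> Cw k" for k using Cw[of k 0] norm_ge_zero order_trans by blast
  have A0: "0 \<le> A" unfolding A_def using Cw0 by (intro mult_nonneg_nonneg prod_nonneg) auto
  define c where "c = 1 + 2 * real CARD('n)"
  have "norm (dderivs (map xi_dir \<alpha> @ map x_dir \<beta>) (piece j) (x, \<xi>)) \<le> (A * c powr \<bar>?E\<bar>) * (1 + norm \<xi>) powr ?E" for j x and \<xi> :: "real^'n"
  proof (cases "\<forall>i. \<xi>$i / 4 ^ j \<in> {1..2}")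
    case False
    then obtain i where "\<xi>$i / 4 ^ j \<notin> {1..2}" by blast
    then have z: "(\<Prod>i\<in>UNIV. of_real ((1 / 4 ^ j) ^ count_list \<alpha> i) * W (count_list \<alpha> i) (\<xi>$i / 4 ^ j)) = 0"
      by (intro prod_zero) (auto intro!: bexI[of _ i] W(3))
    then show ?thesis unfolding dderivs_piece z using A0 by simp
  next
    case True
    let ?l = "(4::real) ^ j"
    have x: "?l \<le> \<xi>$i \<and> \<xi>$i \<le> 2 * ?l" for i
      using True by (auto simp: field_simps)
    have "norm (dderivs (map xi_dir \<alpha> @ map x_dir \<beta>) (piece j) (x, \<xi>)) = ?l powr m *
       ((\<Prod>i\<in>UNIV. norm ((deriv ^^ count_list \<beta> i) (rs_b (N j) (L j)) (of_real (x$i)))) *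
        (\<Prod>i\<in>UNIV. norm (of_real ((1 / ?l) ^ count_list \<alpha> i) * W (count_list \<alpha> i) (\<xi>$i / ?l))))"
      unfolding dderivs_piece norm_mult prod_norm[symmetric] by simp
    also have "\<dots> \<le> ?l powr m * ((\<Prod>i\<in>(UNIV::'n set). 4 * fact (count_list \<beta> i) * (?l powr \<delta>) ^ count_list \<beta> i) *
        (\<Prod>i\<in>(UNIV::'n set). (1 / ?l) ^ count_list \<alpha> i * Cw (count_list \<alpha> i)))"
    proof (intro mult_left_mono mult_mono prod_mono conjI prod_nonneg)
      show "norm ((deriv ^^ count_list \<beta> i) (rs_b (N j) (L j)) (of_real (x$i))) \<le> 4 * fact (count_list \<beta> i) * (?l powr \<delta>) ^ count_list \<beta> i" for i
        using L[of j] by (intro rs_b_higher_deriv) auto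
      show "norm (of_real ((1 / ?l) ^ count_list \<alpha> i) * W (count_list \<alpha> i) (\<xi>$i / ?l)) \<le> (1 / ?l) ^ count_list \<alpha> i * Cw (count_list \<alpha> i)" for i
        unfolding norm_mult by (intro mult_mono Cw) (auto simp: norm_power norm_divide)
    qed auto
    also have "\<dots> = ?l powr m * (A * ((?l powr \<delta>) ^ length \<beta> * (1 / ?l) ^ length \<alpha>))"
      by (simp only: prod.distrib power_sum[symmetric] sum_count_list_UNIV A_def mult_ac)
    also have "\<dots> = A * ?l powr ?E"
    proof -
      have "(?l powr \<delta>) ^ length \<beta> = ?l powr (\<delta> * real (length \<beta>))" by (simp add: powr_realpow[symmetric] powr_powr mult.assoc)
      moreover have "(1 / ?l) ^ length \<alpha> = ?l powr (- real (length \<alpha>))" by (simp add: powr_minus powr_realpow power_one_over inverse_eq_divide)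
      moreover have "?l powr m * (?l powr (\<delta> * real (length \<beta>)) * ?l powr (- real (length \<alpha>))) = ?l powr ?E"
        unfolding powr_add[symmetric] by (rule arg_cong2[where f="(powr)"]) auto
      ultimately show ?thesis by (simp only: mult.left_commute[of _ A])
    qed
    also have "\<dots> \<le> A * (c powr \<bar>?E\<bar> * (1 + norm \<xi>) powr ?E)"
    proof (intro mult_left_mono powr_le_comparable A0)
      have "?l \<le> \<bar>\<xi>$undefined\<bar>" using x[of undefined] by simp
      also have "\<dots> \<le> norm \<xi>" by (rule component_le_norm_cart)
      finally show "?l \<le> 1 + norm \<xi>" by simp
      have "norm \<xi> \<le> (\<Sum>i\<in>UNIV. \<bar>\<xi>$i\<bar>)" by (rule norm_le_l1_cart)
      also have "\<dots> \<le> (\<Sum>i\<in>(UNIV::'n set). 2 * ?l)"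
      proof (rule sum_mono)
        fix i show "\<bar>\<xi>$i\<bar> \<le> 2 * ?l" using x[of i] zero_less_power[of "4::real" j] by linarith
      qed
      finally have "norm \<xi> \<le> 2 * real CARD('n) * ?l" by simp
      moreover have "1 \<le> ?l" by simp
      moreover have "c * ?l = ?l + 2 * real CARD('n) * ?l" by (simp add: c_def algebra_simps)
      ultimately show "1 + norm \<xi> \<le> c * ?l" by linarith
    qed (auto simp: c_def)
    finally show ?thesis by (simp add: mult.assoc)
  qed
  then show ?thesis by blast
qed

lemma sig_symbol_class: "sig \<in> symbol_class m 1 \<delta>"
proof -
  have "\<exists>C. \<forall>x \<xi>. norm (dderivs (map xi_dir \<alpha> @ map x_dir \<beta>) sig (x, \<xi>))
          \<le> C * (1 + norm \<xi>) powr (m - 1 * real (length \<alpha>) + \<delta> * real (length \<beta>))" for \<alpha> \<beta> :: "'a list"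
  proof -
    obtain C where C: "\<And>j x \<xi>. norm (dderivs (map xi_dir \<alpha> @ map x_dir \<beta>) (piece j) (x, \<xi>))
     \<le> C * (1 + norm \<xi>) powr (m - real (length \<alpha>) + \<delta> * real (length \<beta>))"
      using dderivs_piece_bound by blast
    have "norm (dderivs (map xi_dir \<alpha> @ map x_dir \<beta>) sig (x, \<xi>))
          \<le> C * (1 + norm \<xi>) powr (m - 1 * real (length \<alpha>) + \<delta> * real (length \<beta>))" for x \<xi>
    proof -
      obtain U j where U: "open U" "(x, \<xi>) \<in> U" "\<And>z. z \<in> U \<Longrightarrow> sig z = piece j z"
        using sig_local[of "(x, \<xi>)"] by blast
      have "dderivs (map xi_dir \<alpha> @ map x_dir \<beta>) sig (x, \<xi>) = dderivs (map xi_dir \<alpha> @ map x_dir \<beta>) (piece j) (x, \<xi>)"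
        by (rule dderivs_cong_open[OF U(1) U(3) U(2)])
      then show ?thesis using C[of j x \<xi>] by simp
    qed
    then show ?thesis by blast
  qed
  then show ?thesis using smooth_sig by (auto simp: symbol_class_def)
qed

lemma sig_continuous: "continuous_on UNIV sig"
  using smooth_sig unfolding smooth_dirs_def by (auto dest: spec[of _ "[]"])

lemma sig_bound:
  obtains C where "0 \<le> C" "\<And>x \<xi>. norm (sig (x, \<xi> :: real^'n::finite)) \<le> C * (1 + norm \<xi>) powr m"
proof -
  have "\<exists>C. \<forall>x \<xi>. norm (dderivs (map xi_dir [] @ map x_dir []) sig (x, \<xi> :: real^'n))
          \<le> C * (1 + norm \<xi>) powr (m - 1 * real (length ([]::'n list)) + \<delta> * real (length ([]::'n list)))"
    using sig_symbol_class unfolding symbol_class_def by blast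
  then obtain C where C: "\<And>x \<xi>. norm (sig (x, \<xi> :: real^'n)) \<le> C * (1 + norm \<xi>) powr m" by auto
  have "norm (sig (x, \<xi> :: real^'n)) \<le> \<bar>C\<bar> * (1 + norm \<xi>) powr m" for x \<xi>
    by (rule order_trans[OF C]) (intro mult_right_mono, auto)
  then show thesis by (intro that[of "\<bar>C\<bar>"]) auto
qed

lemma sig_plateau:
  fixes \<xi> :: "real^'n::finite"
  assumes "\<And>i. \<xi>$i / 4 ^ j \<in> {5/4..7/4}"
  shows "sig (x, \<xi>) = of_real ((4 ^ j) powr m) * bf j x"
proof -
  have p: "psi j \<xi> = 1" using assms by (simp add: psi_def W(2))
  then have nz: "psi j \<xi> \<noteq> 0" by simp
  have "sig (x, \<xi>) = piece j (x, \<xi>)"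
  proof (rule sig_eq_piece, rule ccontr)
    fix k assume "k \<noteq> j" and "psi k (snd (x, \<xi>)) \<noteq> 0"
    then show False
      using four_power_separated[OF psi_nonzero[OF nz] psi_nonzero[of k \<xi>]] by simp
  qed
  then show ?thesis by (simp add: piece_def p)
qed

lemma bf_bound: "norm (bf j (x :: real^'n::finite)) \<le> 4 ^ CARD('n)"
proof -
  have "norm (bf j x) \<le> (\<Prod>i\<in>(UNIV::'n set). 4)"
    unfolding bf_def prod_norm[symmetric] using L[of j] by (intro prod_mono conjI rs_b_norm_le) auto
  then show ?thesis by simp
qed

end

section \<open>The operator acts as multiplication by b_j up to a negligible error\<close>

lemma one_plus_norm_le_prod:
  fixes x :: "real^'n::finite"
  shows "1 + norm x \<le> (\<Prod>i\<in>UNIV. 1 + \<bar>x$i\<bar>)"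
proof -
  have "1 + (\<Sum>i\<in>A. \<bar>x$i\<bar>) \<le> (\<Prod>i\<in>A. 1 + \<bar>x$i\<bar>)" if "finite A" for A
    using that
  proof (induction A)
    case (insert i A)
    have "1 + (\<bar>x$i\<bar> + (\<Sum>i\<in>A. \<bar>x$i\<bar>)) \<le> (1 + \<bar>x$i\<bar>) * (1 + (\<Sum>i\<in>A. \<bar>x$i\<bar>))"
      by (simp add: algebra_simps sum_nonneg)
    also have "\<dots> \<le> (1 + \<bar>x$i\<bar>) * (\<Prod>i\<in>A. 1 + \<bar>x$i\<bar>)"
      using insert.IH by (intro mult_left_mono) auto
    finally show ?case using insert.hyps by simp
  qed simp
  from this[of UNIV] norm_le_l1_cart[of x] show ?thesis by simp
qed

context lacunary_symbol
begin

definition ctr :: "nat \<Rightarrow> real^'n::finite" where "ctr j = (\<chi> i. 3/2 * 4 ^ j)"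

text \<open>A coordinate far from the centre uses M0 + Q powers of decay, the others only M0; the
  maximum covers both constants.\<close>

definition gauss_max :: "real \<Rightarrow> nat \<Rightarrow> nat \<Rightarrow> real" where
  "gauss_max a M0 Q = max (gauss_dec_const a M0) (gauss_dec_const a (M0 + Q))"

text \<open>The frequencies spread over 4^(j*delta) only, so in a coordinate at distance at least
  4^j / 4 from the centre each extra power of decay gains (1 + 4^(j*delta)) * 4 / 4^j <= 8 *
  4^(j*(delta-1)). The M0 other powers remain as a weight for the integration. Q = 0 is the bound
  valid at every frequency.\<close>

lemma fourier_tgauss_vec_tail:
  fixes \<xi> :: "real^'n::finite"
  assumes a: "0 < a" "finite K"
    and \<eta>: "\<And>k. k \<in> K \<Longrightarrow> \<bar>\<eta> k - 3/2 * 4 ^ j\<bar> \<le> (4 ^ j) powr \<delta>"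
    and c: "(\<Sum>k\<in>K. norm (c k)) \<le> 4 ^ j"
    and Q: "Q = 0 \<or> (\<exists>i. 4 ^ j / 4 \<le> \<bar>(\<xi> - ctr j)$i\<bar>)"
  shows "norm (fourier (tgauss_vec a K c \<eta>) \<xi>) \<le> (4 ^ j * gauss_max a M0 Q * (2 * 4 ^ j) ^ M0) ^ CARD('n) *
     (8 * (4 ^ j) powr (\<delta> - 1)) ^ Q * wt M0 (\<xi> - ctr j)"
proof -
  define l where "l = (4::real) ^ j"
  define R where "R = l powr \<delta>"
  define G where "G = gauss_max a M0 Q"
  define T where "T = l * G * (2 * l) ^ M0"
  define q where "q = 8 * l powr (\<delta> - 1)"
  define t where "t i = (\<xi> - ctr j)$i" for i
  have l1: "1 \<le> l" by (simp add: l_def)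
  have R: "1 \<le> R" "R \<le> l"
    using l1 \<delta> powr_mono[of \<delta> 1 l] by (auto simp: R_def ge_one_powr_ge_zero)
  have gd0: "0 \<le> gauss_dec_const a M" for M using a by (simp add: gauss_dec_const_def)
  have G0: "0 \<le> G" unfolding G_def gauss_max_def using gd0 by (auto simp: le_max_iff_disj)
  have T0: "0 \<le> T" using G0 l1 by (simp add: T_def)
  have q0: "0 \<le> q" by (simp add: q_def)
  have b: "norm (tgauss_hat a K c \<eta> (\<xi>$i)) \<le> l * gauss_dec_const a M * ((1 + R) * dec (t i)) ^ M" for i M
  proof -
    have "norm (tgauss_hat a K c \<eta> (\<xi>$i)) \<le> (\<Sum>k\<in>K. norm (c k)) * gauss_dec_const a M * ((1 + R) * dec (\<xi>$i - 3/2 * 4 ^ j)) ^ M"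
      by (rule tgauss_hat_bound[OF a(1)]) (use \<eta> in \<open>auto simp: R_def l_def\<close>)
    also have "\<dots> \<le> l * gauss_dec_const a M * ((1 + R) * dec (t i)) ^ M"
      using c R gd0 dec_pos by (intro mult_mono) (auto simp: l_def t_def ctr_def less_imp_le intro!: mult_nonneg_nonneg)
    finally show ?thesis .
  qed
  have rd: "((1 + R) * dec (t i)) ^ M0 \<le> (2 * l) ^ M0 * dec (t i) ^ M0" for i
    unfolding power_mult_distrib[symmetric] using R l1 dec_pos by (intro power_mono mult_right_mono) (auto simp: less_imp_le)
  have b0: "norm (tgauss_hat a K c \<eta> (\<xi>$i)) \<le> T * dec (t i) ^ M0" for i
  proof -
    have "l * gauss_dec_const a M0 * ((1 + R) * dec (t i)) ^ M0 \<le> l * G * ((2 * l) ^ M0 * dec (t i) ^ M0)"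
      using l1 gd0 R dec_pos G0 by (intro mult_mono rd) (auto simp: G_def gauss_max_def less_imp_le intro!: mult_nonneg_nonneg)
    then show ?thesis using b[of i M0] by (simp add: T_def mult_ac)
  qed
  have bQ: "norm (tgauss_hat a K c \<eta> (\<xi>$i)) \<le> T * dec (t i) ^ M0 * q ^ Q" if i: "l / 4 \<le> \<bar>t i\<bar>" for i
  proof -
    have "dec (t i) \<le> 4 / l" using i l1 by (simp add: dec_def field_simps)
    then have "(1 + R) * dec (t i) \<le> (2 * R) * (4 / l)"
      using R l1 dec_pos by (intro mult_mono) (auto simp: less_imp_le)
    also have "\<dots> = q" using l1 by (simp add: q_def R_def powr_diff)
    finally have "((1 + R) * dec (t i)) ^ Q \<le> q ^ Q"
      using R dec_pos by (intro power_mono mult_nonneg_nonneg) (auto simp: less_imp_le)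
    then have "l * gauss_dec_const a (M0 + Q) * (((1 + R) * dec (t i)) ^ M0 * ((1 + R) * dec (t i)) ^ Q) \<le> l * G * (((2 * l) ^ M0 * dec (t i) ^ M0) * q ^ Q)"
      using l1 gd0 R dec_pos G0 q0 by (intro mult_mono rd) (auto simp: G_def gauss_max_def less_imp_le intro!: mult_nonneg_nonneg)
    then show ?thesis using b[of i "M0 + Q"] by (simp add: T_def power_add mult_ac)
  qed
  have "norm (fourier (tgauss_vec a K c \<eta>) \<xi>) = (\<Prod>i\<in>UNIV. norm (tgauss_hat a K c \<eta> (\<xi>$i)))"
    by (simp add: fourier_tgauss_vec[OF a] prod_norm)
  also have "\<dots> \<le> (\<Prod>i\<in>UNIV. T * dec (t i) ^ M0) * q ^ Q"
    using Q
  proof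
    assume "Q = 0"
    then show ?thesis using b0 by (auto intro!: prod_mono)
  next
    assume "\<exists>i. 4 ^ j / 4 \<le> \<bar>(\<xi> - ctr j)$i\<bar>"
    then obtain i where i: "l / 4 \<le> \<bar>t i\<bar>" by (auto simp: l_def t_def)
    have rem: "(\<Prod>i\<in>UNIV. g i) = g i * (\<Prod>k\<in>UNIV-{i}. g k)" for g :: "'n \<Rightarrow> real"
      by (rule prod.remove) auto
    have "(\<Prod>i\<in>UNIV. norm (tgauss_hat a K c \<eta> (\<xi>$i))) \<le> (T * dec (t i) ^ M0 * q ^ Q) * (\<Prod>k\<in>UNIV-{i}. T * dec (t k) ^ M0)"
      unfolding rem using b0 bQ[OF i] T0 q0 dec_pos
      by (intro mult_mono prod_mono) (auto intro!: prod_nonneg mult_nonneg_nonneg simp: less_imp_le)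
    then show ?thesis unfolding rem[of "\<lambda>i. T * dec (t i) ^ M0"] by (simp add: mult_ac)
  qed
  also have "(\<Prod>i\<in>UNIV. T * dec (t i) ^ M0) = T ^ CARD('n) * wt M0 (\<xi> - ctr j)"
    by (simp add: prod.distrib wt_def t_def)
  finally show ?thesis unfolding T_def q_def G_def l_def by (simp add: mult_ac)
qed

text \<open>Deliberately crude: growth in powers of 4^j and of the distance to the centre is
  acceptable, since the tail estimate can supply any number of compensating powers. Both bounds
  share one form so that the difference of symbol and plateau value can be estimated at
  once.\<close>

lemma sig_bound_ctr:
  obtains C \<mu> where "0 \<le> C"
    "\<And>j x \<xi>. norm (sig (x, \<xi> :: real^'n::finite)) \<le> C * (4 ^ j) ^ \<mu> * (1 / wt \<mu> (\<xi> - ctr j))"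
    "\<And>j x (\<xi> :: real^'n). norm (of_real ((4 ^ j) powr m) * bf j (x :: real^'n)) \<le> C * (4 ^ j) ^ \<mu> * (1 / wt \<mu> (\<xi> - ctr j))"
proof -
  let ?n = "CARD('n)"
  obtain C where C: "0 \<le> C" "\<And>x \<xi>. norm (sig (x, \<xi> :: real^'n)) \<le> C * (1 + norm \<xi>) powr m"
    using sig_bound by blast
  define v where "v = nat \<lceil>\<bar>m\<bar>\<rceil>"
  have v: "m \<le> real v" unfolding v_def by linarith
  define \<mu> where "\<mu> = ?n * v"
  have pm: "y powr m \<le> y ^ v" if "1 \<le> y" for y :: real
    using that v by (subst powr_realpow[symmetric]) (auto intro: powr_mono)
  have vm: "v \<le> \<mu>" by (simp add: \<mu>_def)
  have s1: "norm (sig (x, \<xi>)) \<le> (C * 3 ^ \<mu> + 4 ^ ?n) * (4 ^ j) ^ \<mu> * (1 / wt \<mu> (\<xi> - ctr j))" for j x and \<xi> :: "real^'n"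
  proof -
    let ?l = "(4::real) ^ j"
    have l1: "1 \<le> ?l" by simp
    have w: "0 < 1 / wt k z" "1 \<le> 1 / wt k z" for k and z :: "real^'n" using wt_pos[of k z] wt_le_1[of k z] by auto
    have "1 + norm \<xi> \<le> (\<Prod>i\<in>UNIV. 1 + \<bar>\<xi>$i\<bar>)" by (rule one_plus_norm_le_prod)
    also have "\<dots> \<le> (\<Prod>i\<in>UNIV. (3 * ?l) * (1 + \<bar>(\<xi> - ctr j)$i\<bar>))"
    proof (intro prod_mono conjI)
      fix i
      have "\<xi>$i = (\<xi> - ctr j)$i + 3/2 * ?l" by (simp add: ctr_def)
      then have "1 + \<bar>\<xi>$i\<bar> \<le> 1 + 3/2 * ?l + \<bar>(\<xi> - ctr j)$i\<bar>" using l1 by linarith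
      also have "\<dots> \<le> 3 * ?l + 3 * ?l * \<bar>(\<xi> - ctr j)$i\<bar>"
        using l1 mult_right_mono[of 1 "3 * ?l" "\<bar>(\<xi> - ctr j)$i\<bar>"] by linarith
      finally show "1 + \<bar>\<xi>$i\<bar> \<le> (3 * ?l) * (1 + \<bar>(\<xi> - ctr j)$i\<bar>)" by (simp add: distrib_left)
    qed auto
    also have "\<dots> = (3 * ?l) ^ ?n * (1 / wt 1 (\<xi> - ctr j))"
      unfolding prod.distrib wt_def dec_def by (simp add: prod_dividef)
    finally have "(1 + norm \<xi>) ^ v \<le> ((3 * ?l) ^ ?n * (1 / wt 1 (\<xi> - ctr j))) ^ v"
      by (intro power_mono) auto
    also have "\<dots> = (3 * ?l) ^ \<mu> * (1 / wt v (\<xi> - ctr j))"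
      unfolding wt_def \<mu>_def power_mult_distrib power_one_over[symmetric]
      by (simp add: power_mult[symmetric] prod_power_distrib power_one_over)
    also have "\<dots> \<le> (3 * ?l) ^ \<mu> * (1 / wt \<mu> (\<xi> - ctr j))"
      using l1 wt_mono[OF vm] wt_pos by (intro mult_left_mono divide_left_mono mult_pos_pos) auto
    finally have x: "(1 + norm \<xi>) powr m \<le> (3 * ?l) ^ \<mu> * (1 / wt \<mu> (\<xi> - ctr j))"
      using pm[of "1 + norm \<xi>"] by simp
    have "norm (sig (x, \<xi>)) \<le> C * ((3 * ?l) ^ \<mu> * (1 / wt \<mu> (\<xi> - ctr j)))"
      by (rule order_trans[OF C(2)]) (intro mult_left_mono x C(1))
    also have "\<dots> = (C * 3 ^ \<mu>) * ?l ^ \<mu> * (1 / wt \<mu> (\<xi> - ctr j))" by (simp add: power_mult_distrib)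
    also have "\<dots> \<le> (C * 3 ^ \<mu> + 4 ^ ?n) * ?l ^ \<mu> * (1 / wt \<mu> (\<xi> - ctr j))"
      using w l1 by (intro mult_right_mono) (auto simp: less_imp_le)
    finally show ?thesis .
  qed
  have s2: "norm (of_real ((4 ^ j) powr m) * bf j (x :: real^'n)) \<le> (C * 3 ^ \<mu> + 4 ^ ?n) * (4 ^ j) ^ \<mu> * (1 / wt \<mu> (\<xi> - ctr j))" for j x and \<xi> :: "real^'n"
  proof -
    let ?l = "(4::real) ^ j"
    have l1: "1 \<le> ?l" by simp
    have w: "1 \<le> 1 / wt k z" for k and z :: "real^'n" using wt_pos[of k z] wt_le_1[of k z] by auto
    have "norm (of_real (?l powr m) * bf j x) = ?l powr m * norm (bf j x)" by (simp add: norm_mult)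
    also have "\<dots> \<le> ?l ^ \<mu> * 4 ^ ?n"
    proof (intro mult_mono bf_bound)
      show "?l powr m \<le> ?l ^ \<mu>" using pm[OF l1] power_increasing[OF vm l1] by linarith
    qed auto
    also have "\<dots> = 4 ^ ?n * ?l ^ \<mu> * 1" by simp
    also have "\<dots> \<le> (C * 3 ^ \<mu> + 4 ^ ?n) * ?l ^ \<mu> * (1 / wt \<mu> (\<xi> - ctr j))"
      using w C(1) by (intro mult_mono) auto
    finally show ?thesis .
  qed
  show thesis by (rule that[of "C * 3 ^ \<mu> + 4 ^ ?n" \<mu>]) (use C(1) s1 s2 in \<open>simp_all only: mult_nonneg_nonneg add_nonneg_nonneg zero_le_power zero_le_numeral\<close>)
qed

lemma fourier_tgauss_vec_measurable:
  assumes "0 < a" "finite K"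
  shows "fourier (tgauss_vec a K c \<eta> :: real^'n::finite \<Rightarrow> complex) \<in> borel_measurable borel"
proof -
  have "continuous_on UNIV (\<lambda>\<xi>::real^'n. \<Prod>i\<in>UNIV. tgauss_hat a K c \<eta> (\<xi>$i))"
    unfolding tgauss_hat_def by (intro continuous_intros)
  then show ?thesis
    using borel_measurable_continuous_onI by (simp add: fourier_tgauss_vec[OF assms] fun_eq_iff[symmetric] cong: measurable_cong)
qed

text \<open>Needed to integrate the difference between \<open>psido sig f\<close> and its main term
  against the window.\<close>

lemma psido_measurable:
  assumes "0 < a" "finite K"
  shows "psido sig (tgauss_vec a K c \<eta> :: real^'n::finite \<Rightarrow> complex) \<in> borel_measurable borel"
proof -
  have [measurable]: "fourier (tgauss_vec a K c \<eta> :: real^'n \<Rightarrow> complex) \<in> borel_measurable borel"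
    by (rule fourier_tgauss_vec_measurable[OF assms])
  have [measurable]: "(sig :: (real^'n) \<times> (real^'n) \<Rightarrow> complex) \<in> borel_measurable (borel \<Otimes>\<^sub>M borel)"
    unfolding borel_prod by (intro borel_measurable_continuous_onI sig_continuous)
  have [measurable]: "(\<lambda>y::(real^'n) \<times> (real^'n). cis (fst y \<bullet> snd y)) \<in> borel_measurable (borel \<Otimes>\<^sub>M borel)"
    unfolding borel_prod by (intro borel_measurable_continuous_onI continuous_intros)
  have "(\<lambda>y. cis (fst y \<bullet> snd y) * sig y * fourier (tgauss_vec a K c \<eta>) (snd y)) \<in> borel_measurable (borel \<Otimes>\<^sub>M (lborel :: (real^'n) measure))"
    by measurable
  then have "(\<lambda>x. \<integral>\<xi>. cis (x \<bullet> \<xi>) * sig (x, \<xi>) * fourier (tgauss_vec a K c \<eta>) \<xi> \<partial>(lborel :: (real^'n) measure)) \<in> borel_measurable borel"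
    by (intro lborel.borel_measurable_lebesgue_integral) (simp add: case_prod_unfold)
  then show ?thesis unfolding psido_def[abs_def] by measurable
qed

text \<open>By Fourier inversion the main term is the same oscillatory integral with the symbol
  replaced by its plateau value. The integrands agree on the cube around the centre, and outside it
  the tail bound applies. The constant is fixed before j and the frequencies, whose number may grow
  with j as long as the coefficients sum to at most 4^j in absolute value.\<close>

lemma psido_error:
  fixes M :: real
  assumes a: "0 < a"
  obtains C where "0 \<le> C"
    "\<And>j (K::int set) (c::int \<Rightarrow> complex) \<eta> (x::real^'n::finite). finite K \<Longrightarrow> (\<And>k. k \<in> K \<Longrightarrow> \<bar>\<eta> k - 3/2 * 4 ^ j\<bar> \<le> (4 ^ j) powr \<delta>) \<Longrightarrow>
       (\<Sum>k\<in>K. norm (c k)) \<le> 4 ^ j \<Longrightarrow>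
       norm (psido sig (tgauss_vec a K c \<eta>) x - of_real ((4 ^ j) powr m) * bf j x * tgauss_vec a K c \<eta> x) \<le> C * (4 ^ j) powr (- M)"
proof -
  let ?n = "CARD('n)"
  obtain Cs \<mu> where Cs: "0 \<le> Cs"
    "\<And>j x \<xi>. norm (sig (x, \<xi> :: real^'n)) \<le> Cs * (4 ^ j) ^ \<mu> * (1 / wt \<mu> (\<xi> - ctr j))"
    "\<And>j x (\<xi> :: real^'n). norm (of_real ((4 ^ j) powr m) * bf j (x :: real^'n)) \<le> Cs * (4 ^ j) ^ \<mu> * (1 / wt \<mu> (\<xi> - ctr j))"
    using sig_bound_ctr by blast
  \<comment> \<open>\<open>\<mu>\<close> powers of decay cancel the growth of the symbol, and two
    are left for integrability.\<close>
  define M0 where "M0 = \<mu> + 2"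
  \<comment> \<open>P counts the powers of 4^j lost: \<open>\<mu>\<close> by the symbol and n + n *
    M0 by the Fourier transform. Each of the Q extra powers of decay regains 4^(j*(1-delta)), so Q *
    (1 - delta) >= M + P is what is needed.\<close>
  define P where "P = \<mu> + ?n + ?n * M0"
  define Q where "Q = nat \<lceil>(M + real P) / (1 - \<delta>)\<rceil>"
  have "(M + real P) / (1 - \<delta>) \<le> real Q" unfolding Q_def by linarith
  then have Q: "M + real P \<le> real Q * (1 - \<delta>)" using \<delta> by (simp add: field_simps)
  define I where "I = (\<integral>x. wt 2 (x::real^'n) \<partial>lborel)"
  have I0: "0 \<le> I" unfolding I_def by (rule integral_nonneg_AE) (auto simp: wt_nonneg)
  define pin where "pin = (2 * pi) powr (- real ?n)"
  have pin0: "0 \<le> pin" by (simp add: pin_def)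
  define B where "B = 2 * Cs * (gauss_max a M0 Q * 2 ^ M0) ^ ?n * 8 ^ Q"
  have gm0: "0 \<le> gauss_max a M0 q" for q unfolding gauss_max_def gauss_dec_const_def using a by (simp add: le_max_iff_disj)
  have B0: "0 \<le> B" unfolding B_def using Cs(1) gm0 by auto
  show thesis
  proof (rule that[of "pin * B * I"])
    show "0 \<le> pin * B * I" using pin0 B0 I0 by simp
    fix j and K :: "int set" and c :: "int \<Rightarrow> complex" and \<eta> and x :: "real^'n"
    assume K: "finite K" and \<eta>: "\<And>k. k \<in> K \<Longrightarrow> \<bar>\<eta> k - 3/2 * 4 ^ j\<bar> \<le> (4 ^ j) powr \<delta>" and c: "(\<Sum>k\<in>K. norm (c k)) \<le> 4 ^ j"
    define l where "l = (4::real) ^ j"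
    have l1: "1 \<le> l" by (simp add: l_def)
    let ?F = "fourier (tgauss_vec a K c \<eta> :: real^'n \<Rightarrow> complex)"
    let ?b = "of_real (l powr m) * bf j x"
    have [measurable]: "?F \<in> borel_measurable borel" by (rule fourier_tgauss_vec_measurable[OF a K])
    have [measurable]: "(\<lambda>\<xi>. sig (x, \<xi>)) \<in> borel_measurable borel"
      by (intro borel_measurable_continuous_onI continuous_on_compose2[OF sig_continuous] continuous_intros) auto
    have [measurable]: "(\<lambda>\<xi>. cis (x \<bullet> \<xi>)) \<in> borel_measurable borel"
      by (intro borel_measurable_continuous_onI continuous_intros)
    have wi: "integrable lborel (\<lambda>\<xi>::real^'n. wt 2 (\<xi> - ctr j))" "integral\<^sup>L lborel (\<lambda>\<xi>::real^'n. wt 2 (\<xi> - ctr j)) = I"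
      using lborel_integral_translate(1)[OF wt_integrable[of 2, where 'n='n], of "- ctr j"]
        lborel_integral_translate(2)[of "wt 2 :: real^'n \<Rightarrow> real" "- ctr j"] by (simp_all add: I_def)
    have W: "1 / wt \<mu> z * wt M0 z = wt 2 z" for z :: "real^'n"
      using wt_pos[of \<mu> z] unfolding M0_def wt_add by simp
    define T where "T q = (l * gauss_max a M0 q * (2 * l) ^ M0) ^ ?n * (8 * l powr (\<delta> - 1)) ^ q" for q
    have T0: "0 \<le> T q" for q unfolding T_def using gm0 l1 by auto
    have F: "norm (?F \<xi>) \<le> T q * wt M0 (\<xi> - ctr j)" if "q = 0 \<or> (\<exists>i. 4 ^ j / 4 \<le> \<bar>(\<xi> - ctr j)$i\<bar>)" for q and \<xi> :: "real^'n"
      using fourier_tgauss_vec_tail[OF a K \<eta> c that, where ?M0.0 = M0] by (simp add: T_def l_def)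
    have isg: "integrable lborel (\<lambda>\<xi>. cis (x \<bullet> \<xi>) * sig (x, \<xi>) * ?F \<xi>)"
    proof (rule Bochner_Integration.integrable_bound)
      show "integrable lborel (\<lambda>\<xi>::real^'n. (Cs * l ^ \<mu> * T 0) * wt 2 (\<xi> - ctr j))"
        by (intro integrable_mult_right wi)
      show "AE \<xi> in lborel. norm (cis (x \<bullet> \<xi>) * sig (x, \<xi>) * ?F \<xi>) \<le> norm ((Cs * l ^ \<mu> * T 0) * wt 2 (\<xi> - ctr j))"
      proof (rule AE_I2)
        fix \<xi> :: "real^'n"
        have "norm (cis (x \<bullet> \<xi>) * sig (x, \<xi>) * ?F \<xi>) = norm (sig (x, \<xi>)) * norm (?F \<xi>)" by (simp add: norm_mult)
        also have "\<dots> \<le> (Cs * l ^ \<mu> * (1 / wt \<mu> (\<xi> - ctr j))) * (T 0 * wt M0 (\<xi> - ctr j))"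
          using Cs(1) l1 unfolding l_def by (intro mult_mono Cs(2) F) (auto simp: wt_nonneg)
        also have "\<dots> = (Cs * l ^ \<mu> * T 0) * (1 / wt \<mu> (\<xi> - ctr j) * wt M0 (\<xi> - ctr j))" by simp
        also have "\<dots> = (Cs * l ^ \<mu> * T 0) * wt 2 (\<xi> - ctr j)" unfolding W ..
        finally show "norm (cis (x \<bullet> \<xi>) * sig (x, \<xi>) * ?F \<xi>) \<le> norm ((Cs * l ^ \<mu> * T 0) * wt 2 (\<xi> - ctr j))"
          by (simp add: order_trans[OF _ abs_ge_self])
      qed
    qed measurable
    note inv = fourier_tgauss_vec_inversion[OF a K, of x c \<eta>]
    have ib: "integrable lborel (\<lambda>\<xi>. ?b * (cis (x \<bullet> \<xi>) * ?F \<xi>))" by (intro integrable_mult_right inv)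
    have "psido sig (tgauss_vec a K c \<eta>) x - ?b * tgauss_vec a K c \<eta> x
      = of_real pin * ((\<integral>\<xi>. cis (x \<bullet> \<xi>) * sig (x, \<xi>) * ?F \<xi> \<partial>lborel) - ?b * (\<integral>\<xi>. cis (x \<bullet> \<xi>) * ?F \<xi> \<partial>lborel))"
      by (subst inv(2)[symmetric]) (simp add: psido_def pin_def right_diff_distrib mult_ac)
    also have "\<dots> = of_real pin * (\<integral>\<xi>. cis (x \<bullet> \<xi>) * sig (x, \<xi>) * ?F \<xi> - ?b * (cis (x \<bullet> \<xi>) * ?F \<xi>) \<partial>lborel)"
      using isg ib by (simp add: Bochner_Integration.integral_diff)
    also have "norm \<dots> \<le> pin * (\<integral>\<xi>. (2 * Cs * l ^ \<mu> * T Q) * wt 2 (\<xi> - ctr j :: real^'n) \<partial>lborel)"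
      unfolding norm_mult
    proof (intro mult_mono Bochner_Integration.integral_norm_bound_integral)
      show "integrable lborel (\<lambda>\<xi>. cis (x \<bullet> \<xi>) * sig (x, \<xi>) * ?F \<xi> - ?b * (cis (x \<bullet> \<xi>) * ?F \<xi>))"
        using isg ib by (rule Bochner_Integration.integrable_diff)
      show "integrable lborel (\<lambda>\<xi>::real^'n. (2 * Cs * l ^ \<mu> * T Q) * wt 2 (\<xi> - ctr j))"
        by (intro integrable_mult_right wi)
      fix \<xi> :: "real^'n"
      have eq: "norm (cis (x \<bullet> \<xi>) * sig (x, \<xi>) * ?F \<xi> - ?b * (cis (x \<bullet> \<xi>) * ?F \<xi>)) = norm (sig (x, \<xi>) - ?b) * norm (?F \<xi>)"
      proof -
        have "cis (x \<bullet> \<xi>) * sig (x, \<xi>) * ?F \<xi> - ?b * (cis (x \<bullet> \<xi>) * ?F \<xi>) = cis (x \<bullet> \<xi>) * ((sig (x, \<xi>) - ?b) * ?F \<xi>)"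
          by (simp add: algebra_simps)
        then show ?thesis by (simp only: norm_mult norm_cis mult_1)
      qed
      show "norm (cis (x \<bullet> \<xi>) * sig (x, \<xi>) * ?F \<xi> - ?b * (cis (x \<bullet> \<xi>) * ?F \<xi>)) \<le> (2 * Cs * l ^ \<mu> * T Q) * wt 2 (\<xi> - ctr j)"
      proof (cases "\<exists>i. 4 ^ j / 4 \<le> \<bar>(\<xi> - ctr j)$i\<bar>")
        case True
        have "norm (sig (x, \<xi>) - ?b) \<le> 2 * (Cs * l ^ \<mu> * (1 / wt \<mu> (\<xi> - ctr j)))"
          using norm_triangle_ineq4[of "sig (x, \<xi>)" ?b] Cs(2)[of x \<xi> j] Cs(3)[of j x \<xi>] by (simp only: l_def)
        then have "norm (sig (x, \<xi>) - ?b) * norm (?F \<xi>) \<le> (2 * (Cs * l ^ \<mu> * (1 / wt \<mu> (\<xi> - ctr j)))) * (T Q * wt M0 (\<xi> - ctr j))"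
          using F[of Q \<xi>] True Cs(1) l1 by (intro mult_mono) (auto simp: wt_nonneg)
        also have "\<dots> = (2 * Cs * l ^ \<mu> * T Q) * (1 / wt \<mu> (\<xi> - ctr j) * wt M0 (\<xi> - ctr j))" by simp
        also have "\<dots> = (2 * Cs * l ^ \<mu> * T Q) * wt 2 (\<xi> - ctr j)" unfolding W ..
        finally show ?thesis unfolding eq .
      next
        case False
        have "\<xi>$i / 4 ^ j \<in> {5/4..7/4}" for i
        proof -
          have "\<bar>(\<xi> - ctr j)$i\<bar> < 4 ^ j / 4" using False by (auto simp: not_le)
          then have "\<bar>\<xi>$i - 3/2 * 4 ^ j\<bar> < 4 ^ j / 4" by (simp add: ctr_def)
          then have "5/4 * 4 ^ j \<le> \<xi>$i" "\<xi>$i \<le> 7/4 * 4 ^ j" by linarith+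
          then show ?thesis by (simp add: field_simps)
        qed
        then have "sig (x, \<xi>) = ?b" unfolding l_def by (rule sig_plateau)
        then show ?thesis unfolding eq using Cs(1) l1 T0 by (auto simp: wt_nonneg)
      qed
    qed (use pin0 in auto)
    also have "\<dots> = pin * (2 * Cs * l ^ \<mu> * T Q) * I" by (simp add: wi(2))
    also have "2 * Cs * l ^ \<mu> * T Q = B * (l ^ P * (l powr (\<delta> - 1)) ^ Q)"
      by (simp add: T_def B_def P_def power_mult_distrib power_add power_mult[symmetric] mult_ac)
    also have "l ^ P * (l powr (\<delta> - 1)) ^ Q = l powr (real P + (\<delta> - 1) * real Q)"
      using l1 by (simp add: powr_realpow[symmetric] powr_powr powr_add)
    also have "pin * (B * l powr (real P + (\<delta> - 1) * real Q)) * I \<le> pin * (B * l powr (- M)) * I"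
      using pin0 B0 I0 l1 Q by (intro mult_right_mono mult_left_mono powr_mono) (auto simp: algebra_simps)
    finally show "norm (psido sig (tgauss_vec a K c \<eta>) x - of_real ((4 ^ j) powr m) * bf j x * tgauss_vec a K c \<eta> x) \<le> pin * B * I * (4 ^ j) powr (- M)"
      by (simp add: l_def mult_ac)
  qed
qed

end

section \<open>Unboundedness\<close>

lemma rs_b_times_gauss:
  obtains c :: "int \<Rightarrow> complex" where "\<And>l. norm (c l) = 1 / sqrt (2 ^ N)"
    "\<And>L a \<omega> z. rs_b N L z * tgauss a {0} (\<lambda>_. 1) (\<lambda>l. \<omega> + L * real_of_int l) z = tgauss a {0..<2 ^ N} c (\<lambda>l. \<omega> + L * real_of_int l) z"
proof -
  obtain c :: "nat \<Rightarrow> complex" where c: "\<And>k. norm (c k) = 1 / sqrt (2 ^ N)"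
    "\<And>L z. rs_b N L z = (\<Sum>k<2^N. c k * exp (\<i> * of_real (L * real k) * z))"
    using rs_b_coeffs by blast
  show thesis
  proof (rule that[of "\<lambda>l. c (nat l)"])
    show "norm (c (nat l)) = 1 / sqrt (2 ^ N)" for l by (rule c)
    fix L a \<omega> z
    have im: "{0..<2 ^ N} = int ` {..<2 ^ N}"
      using image_int_atLeastLessThan[of 0 "2 ^ N"] by (simp add: lessThan_atLeast0)
    have "(\<Sum>l\<in>{0..<2 ^ N}. c (nat l) * exp (\<i> * of_real (\<omega> + L * real_of_int l) * z))
      = (\<Sum>k<2^N. c k * exp (\<i> * of_real (L * real k) * z)) * exp (\<i> * of_real \<omega> * z)"
      unfolding im by (subst sum.reindex) (auto simp: sum_distrib_left exp_add algebra_simps)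
    then show "rs_b N L z * tgauss a {0} (\<lambda>_. 1) (\<lambda>l. \<omega> + L * real_of_int l) z = tgauss a {0..<2 ^ N} (\<lambda>l. c (nat l)) (\<lambda>l. \<omega> + L * real_of_int l) z"
      by (simp add: tgauss_def c(2))
  qed
qed

text \<open>The conjugate of b has frequencies -L k, hence the nonpositive indices. In |b|^2 the
  frequency 0 collects D terms equal to 1 / D, and any other difference at most D terms of that
  modulus. So no coefficient exceeds the one at 0, as \<open>stft2_tgauss_vec_lower\<close> requires
  of the packet it isolates.\<close>

lemma rs_b_times_conj:
  obtains K1 K2 :: "int set" and c1 c2 :: "int \<Rightarrow> complex" where
    "finite K1" "card K1 = 2 ^ N" "\<And>l. norm (c1 l) = 1 / sqrt (2 ^ N)" "\<And>l. l \<in> K1 \<Longrightarrow> \<bar>l\<bar> \<le> 2 ^ N"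
    "finite K2" "0 \<in> K2" "c2 0 = 1" "\<And>l. norm (c2 l) \<le> 1"
    "\<And>L a \<omega> z. rs_b N L z * tgauss a K1 c1 (\<lambda>l. \<omega> + L * real_of_int l) z = tgauss a K2 c2 (\<lambda>l. \<omega> + L * real_of_int l) z"
proof -
  obtain c :: "nat \<Rightarrow> complex" where c: "\<And>k. norm (c k) = 1 / sqrt (2 ^ N)"
    "\<And>L z. rs_b N L z = (\<Sum>k<2^N. c k * exp (\<i> * of_real (L * real k) * z))"
    using rs_b_coeffs by blast
  define D where "D = (2::nat) ^ N"
  have cn: "c k * cnj (c k) = of_real (1 / real D)" for k
    unfolding complex_norm_square[symmetric] c(1) by (simp add: D_def power_divide)
  have cc: "norm (c k * cnj (c k')) = 1 / real D" for k k'
    by (simp add: norm_mult c(1) D_def)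
  define K1 where "K1 = (\<lambda>k. - int k) ` {..<D}"
  define c1 where "c1 l = cnj (c (nat (- l)))" for l
  define g where "g = (\<lambda>(k, k'). int k - int k')"
  define P where "P = {..<D} \<times> {..<D}"
  define c2 where "c2 l = (\<Sum>(k, k')\<in>{p. p \<in> P \<and> g p = l}. c k * cnj (c k'))" for l
  have inj: "inj_on (\<lambda>k. - int k) {..<D}" by (auto simp: inj_on_def)
  show thesis
  proof (rule that[of K1 c1 "g ` P" c2])
    show "finite K1" "finite (g ` P)" by (auto simp: K1_def P_def)
    show "card K1 = 2 ^ N" unfolding K1_def by (subst card_image[OF inj]) (simp add: D_def)
    show "norm (c1 l) = 1 / sqrt (2 ^ N)" for l by (simp add: c1_def c)
    show "\<bar>l\<bar> \<le> 2 ^ N" if "l \<in> K1" for l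
    proof -
      obtain k where "k < D" "l = - int k" using \<open>l \<in> K1\<close> unfolding K1_def by blast
      then have "\<bar>l\<bar> \<le> int D" by simp
      then show ?thesis by (simp add: D_def)
    qed
    have "(0, 0) \<in> P" by (simp add: P_def D_def)
    then show "0 \<in> g ` P" by (force simp: g_def)
    have "{p. p \<in> P \<and> g p = 0} = (\<lambda>k. (k, k)) ` {..<D}" by (auto simp: P_def g_def)
    then have "c2 0 = (\<Sum>k<D. c k * cnj (c k))"
      unfolding c2_def by (simp add: sum.reindex inj_on_def)
    also have "\<dots> = 1" unfolding cn by (simp add: D_def)
    finally show "c2 0 = 1" .
    show "norm (c2 l) \<le> 1" for l
    proof -
      let ?S = "{p. p \<in> P \<and> g p = l}"
      have fin: "finite ?S" by (simp add: P_def)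
      \<comment> \<open>A pair with prescribed difference is determined by its first component, so
        there are at most D of them.\<close>
      have "inj_on fst ?S" by (auto simp: inj_on_def g_def)
      then have "card ?S = card (fst ` ?S)" by (simp add: card_image)
      also have "\<dots> \<le> card {..<D}" by (intro card_mono) (auto simp: P_def)
      finally have "real (card ?S) \<le> real D" by simp
      have "norm (c2 l) \<le> (\<Sum>p\<in>?S. 1 / real D)"
        unfolding c2_def by (rule sum_norm_le) (auto simp: cc)
      also have "\<dots> = real (card ?S) / real D" by simp
      also have "\<dots> \<le> 1" using \<open>real (card ?S) \<le> real D\<close> by (simp add: D_def)
      finally show ?thesis .
    qed
    fix L a \<omega> z
    let ?\<eta> = "\<lambda>l. \<omega> + L * real_of_int l"
    let ?E = "\<lambda>l. exp (\<i> * of_real (?\<eta> l) * z)"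
    have s1: "(\<Sum>l\<in>K1. c1 l * ?E l) = (\<Sum>k<D. cnj (c k) * ?E (- int k))"
      unfolding K1_def by (subst sum.reindex[OF inj]) (simp add: c1_def)
    have "rs_b N L z * (\<Sum>l\<in>K1. c1 l * ?E l) = (\<Sum>k<D. \<Sum>k'<D. (c k * exp (\<i> * of_real (L * real k) * z)) * (cnj (c k') * ?E (- int k')))"
      unfolding s1 c(2) D_def[symmetric] by (rule sum_product)
    also have "\<dots> = (\<Sum>k<D. \<Sum>k'<D. c k * cnj (c k') * ?E (int k - int k'))"
    proof (intro sum.cong refl)
      fix k k'
      have "exp (\<i> * of_real (L * real k) * z) * ?E (- int k') = ?E (int k - int k')"
        by (simp add: exp_add[symmetric] algebra_simps)
      then show "(c k * exp (\<i> * of_real (L * real k) * z)) * (cnj (c k') * ?E (- int k')) = c k * cnj (c k') * ?E (int k - int k')"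
        by (simp only: mult_ac)
    qed
    also have "\<dots> = (\<Sum>p\<in>P. (case p of (k, k') \<Rightarrow> c k * cnj (c k')) * ?E (g p))"
      unfolding P_def by (simp add: sum.cartesian_product g_def case_prod_unfold)
    also have "\<dots> = (\<Sum>l\<in>g ` P. \<Sum>p\<in>{p. p \<in> P \<and> g p = l}. (case p of (k, k') \<Rightarrow> c k * cnj (c k')) * ?E (g p))"
      by (rule sum.image_gen) (simp add: P_def)
    also have "\<dots> = (\<Sum>l\<in>g ` P. c2 l * ?E l)"
      unfolding c2_def sum_distrib_right by (intro sum.cong refl) auto
    finally show "rs_b N L z * tgauss a K1 c1 ?\<eta> z = tgauss a (g ` P) c2 ?\<eta> z"
      by (simp add: tgauss_def mult.assoc[symmetric])
  qed
qed

text \<open>The bound is proportional to A^n * card(K)^(n/q): constant for a single packet of weight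
  one, and D^(n/q - n/2) for D packets per coordinate of weight D^(-1/2).\<close>

lemma mod_norm_tgauss_vec_upper:
  fixes \<gamma> :: "real^'n::finite \<Rightarrow> complex"
  assumes p: "1 \<le> p" and q: "1 \<le> q" and K: "finite K" and a: "0 < a" and \<gamma>: "\<gamma> \<in> schwartz"
    and CV: "0 \<le> CV" "\<And>x \<xi>. norm (stft2 (gauss a) (\<lambda>x. cnj (\<gamma> x)) x \<xi>) \<le> CV * wt 2 x * wt 3 \<xi>"
    and L: "1 \<le> L" and A: "0 \<le> A" "\<And>k. k \<in> K \<Longrightarrow> norm (c k) = A"
  shows "mod_norm p q \<gamma> (tgauss_vec a K c (\<lambda>l. \<omega> + L * real_of_int l)) \<le> ennreal (CV * (\<integral>x. wt 2 (x::real^'n) \<partial>lborel) powr (1 / p) *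
     (A powr q * dec_sum_const powr (q - 1) * (real (card K) * (\<integral>t. dec t ^ 3 \<partial>lborel))) powr (real CARD('n) / q))"
proof -
  let ?\<eta> = "\<lambda>l. \<omega> + L * real_of_int l"
  define s where "s t = (\<Sum>k\<in>K. A * dec (t - ?\<eta> k) ^ 3)" for t
  show ?thesis
  proof (rule mod_norm_upper[OF p q CV(1), where s=s])
    show "0 \<le> s t" for t unfolding s_def using A(1) by (intro sum_nonneg) (auto simp: dec_nonneg)
    show "s \<in> borel_measurable borel" unfolding s_def[abs_def] by measurable
    have "s t = (\<Sum>k\<in>K. norm (c k) * dec (t - ?\<eta> k) ^ 3)" for t
      unfolding s_def using A by (intro sum.cong) auto
    then show "norm (stft \<gamma> (tgauss_vec a K c ?\<eta>) x \<xi>) \<le> CV * wt 2 x * (\<Prod>i\<in>UNIV. s (\<xi>$i))" for x \<xi>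
      unfolding stft_eq_stft2 using stft2_tgauss_vec_upper[OF K a schwartz_cnj[OF \<gamma>] CV, of c ?\<eta> x \<xi>] by simp
    show "(\<integral>\<^sup>+ t. ennreal (s t powr q) \<partial>lborel) \<le> ennreal (A powr q * dec_sum_const powr (q - 1) * (real (card K) * (\<integral>t. dec t ^ 3 \<partial>lborel)))"
      unfolding s_def by (rule dec_sum_powr_integral[OF K q L refl A(1)])
    have "0 \<le> (\<integral>t. dec t ^ 3 \<partial>lborel)" by (rule integral_nonneg_AE) (auto simp: dec_nonneg)
    then show "0 \<le> A powr q * dec_sum_const powr (q - 1) * (real (card K) * (\<integral>t. dec t ^ 3 \<partial>lborel))" by simp
  qed
qed

lemma finite_disjoint_balls_measure:
  fixes z :: "'b \<Rightarrow> 'a::euclidean_space"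
  assumes "finite Z" "0 \<le> r" "disjoint_family_on (\<lambda>k. ball (z k) r) Z"
  shows "emeasure lborel (\<Union>k\<in>Z. ball (z k) r) = ennreal (real (card Z) * measure lborel (ball (0::'a) r))"
proof -
  have b: "emeasure lborel (ball (z k) r) = ennreal (measure lborel (ball (0::'a) r))" for k
  proof -
    have "emeasure lborel (ball (z k) r) = emeasure lborel (ball (0::'a) r)"
      using assms(2) by (simp add: emeasure_ball)
    also have "\<dots> = ennreal (measure lborel (ball (0::'a) r))"
      by (rule emeasure_eq_ennreal_measure) (use emeasure_lborel_ball_finite[of "0::'a" r] in auto)
    finally show ?thesis .
  qed
  have "emeasure lborel (\<Union>k\<in>Z. ball (z k) r) = (\<Sum>k\<in>Z. emeasure lborel (ball (z k) r))"
    using assms by (intro sum_emeasure[symmetric]) auto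
  also have "\<dots> = (\<Sum>k\<in>Z. ennreal (measure lborel (ball (0::'a) r)))" unfolding b ..
  also have "\<dots> = ennreal (real (card Z) * measure lborel (ball (0::'a) r))"
    by (simp add: ennreal_mult ennreal_of_nat_eq_real_of_nat)
  finally show ?thesis .
qed

context lacunary_symbol
begin

lemma bf_times_tgauss_vec:
  assumes "\<And>z. rs_b (N j) (L j) z * tgauss a K c \<eta> z = tgauss a K' c' \<eta> z"
  shows "bf j x * tgauss_vec a K c \<eta> x = tgauss_vec a K' c' \<eta> (x :: real^'n::finite)"
  unfolding bf_def tgauss_vec_def prod.distrib[symmetric] assms ..

text \<open>Z selects packets of the product whose coefficients have the largest modulus. On the
  balls around their frequencies the main term is at least twice the claimed value v, and the
  operator error takes away at most v.\<close>

lemma mod_norm_psido_lower: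
  fixes \<gamma> :: "real^'n::finite \<Rightarrow> complex" and x0 :: "real^'n"
  assumes p: "1 \<le> p" and q: "1 \<le> q" and a: "0 < a" and \<gamma>: "\<gamma> \<in> schwartz"
    and CV: "0 < CV" "\<And>x \<xi>. norm (stft2 (gauss a) (\<lambda>x. cnj (\<gamma> x)) x \<xi>) \<le> CV * wt 2 x * wt 3 \<xi>"
    and r: "0 < r" "r \<le> 1" and e: "0 < e"
    and low: "\<forall>x\<in>ball x0 r. \<forall>\<xi>\<in>ball 0 r. e \<le> norm (stft2 (gauss a) (\<lambda>x. cnj (\<gamma> x)) x \<xi>)"
    and Ce: "0 \<le> Ce"
    and err: "\<And>x::real^'n. norm (psido sig (tgauss_vec a K c (\<lambda>l. \<omega> + L j * real_of_int l)) x - of_real ((4 ^ j) powr m) * bf j x * tgauss_vec a K c (\<lambda>l. \<omega> + L j * real_of_int l) x) \<le> Ce * (4 ^ j) powr (m - real CARD('n) - 1)"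
    and K: "finite K" "finite K'"
    and eq: "\<And>z. rs_b (N j) (L j) z * tgauss a K c (\<lambda>l. \<omega> + L j * real_of_int l) z = tgauss a K' c' (\<lambda>l. \<omega> + L j * real_of_int l) z"
    and c': "\<forall>l\<in>K'. norm (c' l) \<le> cm" and cm: "1 / 4 ^ j \<le> cm"
    and Z: "(Z :: ('n \<Rightarrow> int) set) \<subseteq> UNIV \<rightarrow>\<^sub>E K'" "\<forall>\<kappa>\<in>Z. \<forall>i. norm (c' (\<kappa> i)) = cm"
    and large: "2 \<le> L j" "4 * CV * dec_sum_const ^ CARD('n) \<le> e * L j" "4 * Ce * (\<integral>t. norm (\<gamma> t) \<partial>lborel) \<le> e * 4 ^ j"
  shows "ennreal ((4 ^ j) powr m * cm ^ CARD('n) * (e / 4) * measure lborel (ball x0 r) powr (1 / p) * (real (card Z) * measure lborel (ball (0::real^'n) r)) powr (1 / q))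
     \<le> mod_norm p q \<gamma> (psido sig (tgauss_vec a K c (\<lambda>l. \<omega> + L j * real_of_int l)))"
proof -
  let ?n = "CARD('n)"
  let ?\<eta> = "\<lambda>l. \<omega> + L j * real_of_int l"
  let ?f = "tgauss_vec a K c ?\<eta> :: real^'n \<Rightarrow> complex" and ?h = "tgauss_vec a K' c' ?\<eta> :: real^'n \<Rightarrow> complex"
  define H where "H = (\<lambda>x. cnj (\<gamma> x))"
  define l where "l = (4::real) ^ j"
  have l1: "1 \<le> l" by (simp add: l_def)
  have \<gamma>m [measurable]: "\<gamma> \<in> borel_measurable borel" by (rule schwartz_measurable[OF \<gamma>])
  have Hs: "H \<in> schwartz" unfolding H_def by (rule schwartz_cnj[OF \<gamma>])
  have [measurable]: "H \<in> borel_measurable borel" by (rule schwartz_measurable[OF Hs])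
  have cm0: "0 < cm" by (rule less_le_trans[OF _ cm]) simp
  define v where "v = l powr m * cm ^ ?n * (e / 4)"
  have v0: "0 \<le> v" using cm0 e by (simp add: v_def)
  define Er where "Er t = psido sig ?f t - of_real (l powr m) * ?h t" for t
  have bh: "bf j t * ?f t = ?h t" for t :: "real^'n" by (rule bf_times_tgauss_vec[OF eq])
  have Er: "norm (Er t) \<le> Ce * l powr (m - real ?n - 1)" for t
    using err[of t] unfolding Er_def bh[symmetric] l_def by (simp only: mult.assoc)
  have hs: "?h \<in> schwartz" by (rule tgauss_vec_schwartz[OF a])
  have [measurable]: "?h \<in> borel_measurable borel" by (rule schwartz_measurable[OF hs])
  have [measurable]: "Er \<in> borel_measurable borel"
    unfolding Er_def using psido_measurable[OF a K(1)] by measurable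
  have Hi: "integrable lborel H"
  proof -
    obtain B where B: "0 \<le> B" "\<And>x. norm (H x) \<le> B * wt 2 x" using schwartz_wt_bound[OF Hs, of 2] by blast
    show ?thesis
      by (rule Bochner_Integration.integrable_bound[of _ "\<lambda>x. B * wt 2 x"])
         (use B in \<open>auto intro!: integrable_mult_right wt_integrable simp: abs_of_nonneg wt_nonneg\<close>)
  qed
  have low2: "v \<le> norm (stft \<gamma> (psido sig ?f) x \<xi>)" if x: "x \<in> ball x0 r" and \<xi>: "\<xi> \<in> (\<Union>\<kappa>\<in>Z. ball (freq ?\<eta> \<kappa>) r)" for x \<xi>
  proof -
    obtain \<kappa> where \<kappa>: "\<kappa> \<in> Z" "\<xi> \<in> ball (freq ?\<eta> \<kappa>) r" using \<xi> by blast
    have nr: "norm (\<xi> - freq ?\<eta> \<kappa>) < r" using \<kappa>(2) by (simp add: dist_norm norm_minus_commute)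
    have main: "cm ^ ?n * (e / 2) \<le> norm (stft2 ?h H x \<xi>)"
    proof (rule stft2_tgauss_vec_lower[OF K(2) a Hs CV(1), where T=r and ?\<kappa>0.0=\<kappa> and L="L j" and \<omega>=\<omega>])
      show "norm (stft2 (gauss a) H x \<xi>) \<le> CV * wt 2 x * wt 3 \<xi>" for x \<xi> unfolding H_def by (rule CV)
      show "e \<le> norm (stft2 (gauss a) H x (\<xi> - freq ?\<eta> \<kappa>))"
        unfolding H_def using nr by (intro low[rule_format] x) simp
    qed (use large r c' Z \<kappa>(1) nr in auto)
    let ?E = "\<lambda>t. cis (- (\<xi> \<bullet> t))"
    have [measurable]: "?E \<in> borel_measurable borel"
      by (intro borel_measurable_continuous_onI continuous_intros)
    have Hx: "integrable lborel (\<lambda>t. H (t - x))" "(\<integral>t. norm (H (t - x)) \<partial>lborel) = (\<integral>t. norm (\<gamma> t) \<partial>lborel)"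
      using lborel_integral_translate(1)[OF Hi, of "- x"] lborel_integral_translate(2)[of "\<lambda>t. norm (H t)" "- x"]
      by (simp_all add: H_def)
    have eb: "norm (Er t * H (t - x) * ?E t) \<le> (Ce * l powr (m - real ?n - 1)) * norm (H (t - x))" for t
    proof -
      have "norm (Er t * H (t - x) * ?E t) = norm (Er t) * norm (H (t - x))" by (simp add: norm_mult)
      also have "\<dots> \<le> (Ce * l powr (m - real ?n - 1)) * norm (H (t - x))" by (intro mult_right_mono Er) simp
      finally show ?thesis .
    qed
    have bi: "integrable lborel (\<lambda>t. (Ce * l powr (m - real ?n - 1)) * norm (H (t - x)))"
      using Hx(1) by (intro integrable_mult_right integrable_norm)
    have ei: "integrable lborel (\<lambda>t. Er t * H (t - x) * ?E t)"
      by (rule Bochner_Integration.integrable_bound[OF bi]) (measurable, use eb in \<open>auto intro!: AE_I2 order_trans[OF _ abs_ge_self]\<close>)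
    have hi: "integrable lborel (\<lambda>t. of_real (l powr m) * (?h t * H (t - x) * ?E t))"
      by (intro integrable_mult_right stft2_integrable hs Hs)
    have "stft \<gamma> (psido sig ?f) x \<xi> = (\<integral>t. of_real (l powr m) * (?h t * H (t - x) * ?E t) + Er t * H (t - x) * ?E t \<partial>lborel)"
      unfolding stft_def by (intro Bochner_Integration.integral_cong refl) (simp add: Er_def H_def algebra_simps)
    also have "\<dots> = of_real (l powr m) * stft2 ?h H x \<xi> + (\<integral>t. Er t * H (t - x) * ?E t \<partial>lborel)"
      using hi ei by (simp add: Bochner_Integration.integral_add stft2_def)
    finally have S: "stft \<gamma> (psido sig ?f) x \<xi> = of_real (l powr m) * stft2 ?h H x \<xi> + (\<integral>t. Er t * H (t - x) * ?E t \<partial>lborel)" .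
    have "norm (\<integral>t. Er t * H (t - x) * ?E t \<partial>lborel) \<le> (\<integral>t. (Ce * l powr (m - real ?n - 1)) * norm (H (t - x)) \<partial>lborel)"
      by (rule Bochner_Integration.integral_norm_bound_integral[OF ei bi]) (rule eb)
    also have "\<dots> = l powr (m - real ?n - 1) * (Ce * (\<integral>t. norm (\<gamma> t) \<partial>lborel))" by (simp add: Hx(2))
    \<comment> \<open>The spare factor 4^(-j) in the error absorbs \<open>Ce\<close> and the L^1
      norm of the window; what remains is below v because cm^n >= 4^(-j*n).\<close>
    also have "\<dots> \<le> l powr (m - real ?n - 1) * (e / 4 * l)"
      using large(3) by (intro mult_left_mono) (auto simp: l_def)
    also have "\<dots> = l powr m * (1 / l) ^ ?n * (e / 4)"
    proof -
      have "l powr (m - real ?n - 1) = l powr m * (1 / l) ^ ?n / l"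
        using l1 by (simp add: powr_diff powr_realpow power_one_over)
      then show ?thesis using l1 by simp
    qed
    also have "\<dots> \<le> v"
      unfolding v_def using cm e l1 by (intro mult_right_mono mult_left_mono power_mono) (auto simp: l_def)
    finally have E1: "norm (\<integral>t. Er t * H (t - x) * ?E t \<partial>lborel) \<le> v" .
    have "2 * v = l powr m * (cm ^ ?n * (e / 2))" by (simp add: v_def)
    also have "\<dots> \<le> l powr m * norm (stft2 ?h H x \<xi>)" by (rule mult_left_mono[OF main]) simp
    also have "\<dots> = norm (of_real (l powr m) * stft2 ?h H x \<xi>)" by (simp add: norm_mult)
    finally show ?thesis
      unfolding S using E1 norm_diff_ineq[of "of_real (l powr m) * stft2 ?h H x \<xi>" "\<integral>t. Er t * H (t - x) * ?E t \<partial>lborel"] by linarith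
  qed
  have disj: "disjoint_family_on (\<lambda>\<kappa>. ball (freq ?\<eta> \<kappa> :: real^'n) r) Z"
    unfolding disjoint_family_on_def
  proof (intro ballI impI)
    fix \<kappa> \<kappa>' assume k: "\<kappa> \<in> Z" "\<kappa>' \<in> Z" "\<kappa> \<noteq> \<kappa>'"
    then obtain i where i: "\<kappa> i \<noteq> \<kappa>' i" by (auto simp: fun_eq_iff)
    have "1 \<le> \<bar>real_of_int (\<kappa> i - \<kappa>' i)\<bar>" using i by linarith
    then have "L j * 1 \<le> L j * \<bar>real_of_int (\<kappa> i - \<kappa>' i)\<bar>" using large(1) by (intro mult_left_mono) auto
    also have "\<dots> = \<bar>(freq ?\<eta> \<kappa> - freq ?\<eta> \<kappa>' :: real^'n) $ i\<bar>"
      using large(1) by (simp add: freq_def abs_mult algebra_simps flip: abs_mult)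
        (simp add: right_diff_distrib[symmetric] abs_mult)
    also have "\<dots> \<le> norm (freq ?\<eta> \<kappa> - freq ?\<eta> \<kappa>' :: real^'n)" by (rule component_le_norm_cart)
    finally have "2 * r \<le> dist (freq ?\<eta> \<kappa> :: real^'n) (freq ?\<eta> \<kappa>')" using large(1) r by (simp add: dist_norm)
    then show "ball (freq ?\<eta> \<kappa> :: real^'n) r \<inter> ball (freq ?\<eta> \<kappa>') r = {}"
      by (intro disjoint_ballI) simp
  qed
  have fZ: "finite Z" by (rule finite_subset[OF Z(1)]) (intro finite_PiE K, simp)
  have "ennreal (v * measure lborel (ball x0 r) powr (1 / p) * (real (card Z) * measure lborel (ball (0::real^'n) r)) powr (1 / q)) \<le> mod_norm p q \<gamma> (psido sig ?f)"
  proof (rule mod_norm_lower[OF p q v0 low2])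
    show "emeasure lborel (ball x0 r) = ennreal (measure lborel (ball x0 r))"
      by (rule emeasure_eq_ennreal_measure) (use emeasure_lborel_ball_finite[of x0 r] in auto)
    show "emeasure lborel (\<Union>\<kappa>\<in>Z. ball (freq ?\<eta> \<kappa>) r) = ennreal (real (card Z) * measure lborel (ball (0::real^'n) r))"
      by (rule finite_disjoint_balls_measure[OF fZ _ disj]) (use r in auto)
    show "(\<Union>\<kappa>\<in>Z. ball (freq ?\<eta> \<kappa>) r) \<in> sets borel" by (intro borel_open open_UN) auto
  qed auto
  then show ?thesis by (simp add: v_def l_def)
qed

end

lemma filterlim_four_powr:
  assumes "0 < \<kappa>"
  shows "filterlim (\<lambda>j. (4 ^ j :: real) powr \<kappa>) at_top sequentially"
proof -
  have "filterlim (\<lambda>x::real. x powr \<kappa>) at_top at_top" using assms by real_asymp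
  moreover have "filterlim (\<lambda>j. 4 ^ j :: real) at_top sequentially" by real_asymp
  ultimately show ?thesis by (rule filterlim_compose)
qed

context lacunary_symbol
begin

text \<open>Applying the assumed inequality to the test function of scale j bounds the gain by |C| *
  U / V, where U and V do not depend on j. The conditions that make j large enough involve constants
  of the window; they hold eventually because L_j and 4^j tend to infinity.\<close>

lemma psido_sig_gain:
  fixes \<gamma> :: "real^'n::finite \<Rightarrow> complex" and C :: real
  assumes p: "1 \<le> p" and q: "1 \<le> q" and \<gamma>: "\<gamma> \<in> schwartz" "\<gamma> \<noteq> (\<lambda>_. 0)"
    and bdd: "\<And>f. f \<in> schwartz \<Longrightarrow> mod_norm p q \<gamma> (psido sig f) \<le> ennreal C * mod_norm p q \<gamma> f"
    and Llim: "filterlim L at_top sequentially"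
  shows "\<exists>B. \<forall>\<^sub>F j in sequentially. (4 ^ j) powr m * (2 ^ N j) powr (\<bar>1 / q - 1 / 2\<bar> * real CARD('n)) \<le> B"
proof -
  let ?n = "CARD('n)"
  define H where "H = (\<lambda>x. cnj (\<gamma> x))"
  have Hs: "H \<in> schwartz" unfolding H_def by (rule schwartz_cnj[OF \<gamma>(1)])
  have "H \<noteq> (\<lambda>_. 0)" using \<gamma>(2) by (auto simp: H_def fun_eq_iff)
  then obtain a x0 where a: "1 \<le> a" and nz: "stft2 (gauss a) H x0 0 \<noteq> 0" using stft2_gauss_nonzero[OF Hs] by blast
  have a0: "0 < a" using a by simp
  obtain CV where CV: "0 < CV" "\<And>x \<xi>. norm (stft2 (gauss a) H x \<xi>) \<le> CV * wt 2 x * wt 3 \<xi>"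
    using stft2_wt_bound[OF gauss_schwartz[OF a0] Hs, of 2 3] by blast
  define e where "e = norm (stft2 (gauss a) H x0 0) / 2"
  have e: "0 < e" using nz by (simp add: e_def)
  have "isCont (\<lambda>(x, \<xi>). stft2 (gauss a) H x \<xi>) (x0, 0)"
    using stft2_continuous[OF gauss_schwartz[OF a0] Hs] by (simp add: continuous_on_eq_continuous_at)
  then obtain d where d: "0 < d" "\<And>y. dist y (x0, 0) < d \<Longrightarrow> dist (case y of (x, \<xi>) \<Rightarrow> stft2 (gauss a) H x \<xi>) (stft2 (gauss a) H x0 0) < e"
    using e unfolding continuous_at_eps_delta by (metis (no_types, lifting) case_prod_conv)
  \<comment> \<open>Half of d lets a product of two balls fit into the neighbourhood of continuity;
    the cap 1 keeps balls around frequencies at least 2 apart disjoint.\<close>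
  define r where "r = min 1 (d / 2)"
  have r: "0 < r" "r \<le> 1" using d(1) by (auto simp: r_def)
  have low: "e \<le> norm (stft2 (gauss a) H x \<xi>)" if "x \<in> ball x0 r" "\<xi> \<in> ball 0 r" for x \<xi>
  proof -
    have "dist (x, \<xi>) (x0, 0) \<le> dist x x0 + dist \<xi> 0"
      unfolding dist_Pair_Pair by (rule sqrt_sum_squares_le_sum) auto
    also have "\<dots> < d" using that by (auto simp: r_def dist_commute)
    finally have "dist (stft2 (gauss a) H x \<xi>) (stft2 (gauss a) H x0 0) < e" using d(2)[of "(x, \<xi>)"] by simp
    then show ?thesis using norm_triangle_ineq2[of "stft2 (gauss a) H x0 0" "stft2 (gauss a) H x \<xi>"]
      by (simp add: e_def dist_norm norm_minus_commute)
  qed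
  have low': "\<forall>x\<in>ball x0 r. \<forall>\<xi>\<in>ball 0 r. e \<le> norm (stft2 (gauss a) (\<lambda>x. cnj (\<gamma> x)) x \<xi>)"
    using low unfolding H_def by blast
  \<comment> \<open>The order M = n + 1 - m makes the error 4^(j*(m-n-1)). The coefficients of the
    packets are at least 4^(-j) per coordinate, so the main term is at least of size 4^(j*(m-n)) and
    wins by a factor 4^j.\<close>
  obtain Ce where Ce: "0 \<le> Ce"
    "\<And>j (K::int set) c \<eta> (x::real^'n). finite K \<Longrightarrow> (\<And>k. k \<in> K \<Longrightarrow> \<bar>\<eta> k - 3/2 * 4 ^ j\<bar> \<le> (4 ^ j) powr \<delta>) \<Longrightarrow>
       (\<Sum>k\<in>K. norm (c k)) \<le> 4 ^ j \<Longrightarrow>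
       norm (psido sig (tgauss_vec a K c \<eta>) x - of_real ((4 ^ j) powr m) * bf j x * tgauss_vec a K c \<eta> x) \<le> Ce * (4 ^ j) powr (- (real ?n + 1 - m))"
    using psido_error[OF a0] by blast
  define X where "X = measure lborel (ball x0 r) powr (1 / p)"
  define Y where "Y = measure lborel (ball (0::real^'n) r) powr (1 / q)"
  define V where "V = e / 4 * X * Y"
  have "0 < X" "0 < Y" unfolding X_def Y_def using content_ball_pos[OF r(1)] by auto
  then have V: "0 < V" using e by (simp add: V_def)
  define U where "U = CV * (\<integral>x. wt 2 (x::real^'n) \<partial>lborel) powr (1 / p) * (dec_sum_const powr (q - 1) * (\<integral>t. dec t ^ 3 \<partial>lborel)) powr (real ?n / q)"
  have U0: "0 \<le> U" using CV(1) by (simp add: U_def)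
  have J0: "0 \<le> (\<integral>t. dec t ^ 3 \<partial>lborel)" by (rule integral_nonneg_AE) (auto simp: dec_nonneg)
  define s where "s = \<bar>1 / q - 1 / 2\<bar> * real ?n"
  have compare: "v \<le> \<bar>C\<bar> * u" if f: "f \<in> schwartz" and lo: "ennreal v \<le> mod_norm p q \<gamma> (psido sig f)"
    and up: "mod_norm p q \<gamma> f \<le> ennreal u" and u: "0 \<le> u" for f v u
  proof -
    have "ennreal v \<le> ennreal C * mod_norm p q \<gamma> f" using lo bdd[OF f] by (rule order_trans)
    \<comment> \<open>\<open>ennreal C\<close> is 0 for negative C; the absolute value covers both
      signs.\<close>
    also have "\<dots> \<le> ennreal \<bar>C\<bar> * ennreal u" by (intro mult_mono up ennreal_leI) auto
    also have "\<dots> = ennreal (\<bar>C\<bar> * u)" using u by (simp add: ennreal_mult)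
    finally show ?thesis using u by (simp add: ennreal_le_iff)
  qed
  have "\<forall>\<^sub>F j in sequentially. 2 \<le> L j" using Llim by (auto simp: filterlim_at_top)
  moreover have "\<forall>\<^sub>F j in sequentially. 4 * CV * dec_sum_const ^ ?n / e \<le> L j" using Llim by (auto simp: filterlim_at_top)
  moreover have "\<forall>\<^sub>F j in sequentially. 4 * Ce * (\<integral>t. norm (\<gamma> t) \<partial>lborel) / e \<le> (4 ^ j) powr 1"
    using filterlim_four_powr[of 1] by (auto simp: filterlim_at_top)
  ultimately have "\<forall>\<^sub>F j in sequentially. V * ((4 ^ j) powr m * (2 ^ N j) powr s) \<le> \<bar>C\<bar> * U"
  proof eventually_elim
    case (elim j)
    define D where "D = (2::real) ^ N j"
    define l where "l = (4::real) ^ j"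
    have D1: "1 \<le> D" by (simp add: D_def)
    have l1: "1 \<le> l" by (simp add: l_def)
    have LD: "L j * D = l powr \<delta>" using L(2)[of j] by (simp add: D_def l_def)
    \<comment> \<open>D <= 4^j is used twice: it makes the coefficients D^(-1/2) at least 4^(-j),
      and it bounds the sum of D such coefficients, which is sqrt D, by 4^j.\<close>
    have "D \<le> L j * D" using elim(1) D1 mult_right_mono[of 1 "L j" D] by simp
    also have "\<dots> \<le> l powr 1" unfolding LD using l1 \<delta> by (intro powr_mono) auto
    finally have Dl: "D \<le> l" using l1 by simp
    have sD: "1 \<le> sqrt D" "sqrt D \<le> l"
    proof -
      show "1 \<le> sqrt D" using D1 by simp
      have "sqrt D \<le> sqrt (D * D)" using D1 mult_left_mono[of 1 D D] by (intro real_sqrt_le_mono) simp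
      also have "\<dots> = D" using D1 by (simp add: real_sqrt_mult)
      finally show "sqrt D \<le> l" using Dl by simp
    qed
    have lg2: "4 * CV * dec_sum_const ^ ?n \<le> e * L j" using elim(2) e by (simp add: field_simps)
    have lg3: "4 * Ce * (\<integral>t. norm (\<gamma> t) \<partial>lborel) \<le> e * 4 ^ j" using elim(3) e by (simp add: field_simps)
    let ?\<eta> = "\<lambda>k. 3/2 * 4 ^ j + L j * real_of_int k"
    have \<eta>: "\<bar>?\<eta> k - 3/2 * 4 ^ j\<bar> \<le> (4 ^ j) powr \<delta>" if "\<bar>k\<bar> \<le> 2 ^ N j" for k
    proof -
      have "\<bar>real_of_int k\<bar> \<le> D"
        using that unfolding D_def by (metis of_int_abs of_int_le_iff of_int_numeral of_int_power)
      then have "L j * \<bar>real_of_int k\<bar> \<le> L j * D" using elim(1) by (intro mult_left_mono) auto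
      then show ?thesis using elim(1) by (simp add: LD abs_mult l_def)
    qed
    have L1: "1 \<le> L j" using elim(1) by simp
    have err: "norm (psido sig (tgauss_vec a K c ?\<eta>) x - of_real ((4 ^ j) powr m) * bf j x * tgauss_vec a K c ?\<eta> x) \<le> Ce * (4 ^ j) powr (m - real ?n - 1)"
      if "finite K" "\<And>k. k \<in> K \<Longrightarrow> \<bar>k\<bar> \<le> 2 ^ N j" "(\<Sum>k\<in>K. norm (c k)) \<le> 4 ^ j" for K c and x :: "real^'n"
    proof -
      have "- (real ?n + 1 - m) = m - real ?n - 1" by simp
      moreover have "norm (psido sig (tgauss_vec a K c ?\<eta>) x - of_real ((4 ^ j) powr m) * bf j x * tgauss_vec a K c ?\<eta> x) \<le> Ce * (4 ^ j) powr (- (real ?n + 1 - m))"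
        by (rule Ce(2)[OF that(1) \<eta>[OF that(2)] that(3)])
      ultimately show ?thesis by (simp only:)
    qed
    note lower = mod_norm_psido_lower[OF p q a0 \<gamma>(1) CV(1) CV(2)[unfolded H_def] r e low' Ce(1), where j=j]
    have cV0: "0 \<le> CV" using CV(1) by simp
    note upper = mod_norm_tgauss_vec_upper[OF p q _ a0 \<gamma>(1) cV0 CV(2)[unfolded H_def] L1]
    show ?case
    proof (cases "q \<le> 2")
      case True
      obtain c where c: "\<And>l. norm (c l) = 1 / sqrt (2 ^ N j)"
        "\<And>z. rs_b (N j) (L j) z * tgauss a {0} (\<lambda>_. 1) ?\<eta> z = tgauss a {0..<2 ^ N j} c ?\<eta> z"
        using rs_b_times_gauss[of "N j"] by metis
      let ?f = "tgauss_vec a {0} (\<lambda>_. 1) ?\<eta> :: real^'n \<Rightarrow> complex"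
      let ?Z = "UNIV \<rightarrow>\<^sub>E {0..<2 ^ N j} :: ('n \<Rightarrow> int) set"
      have cardZ: "real (card ?Z) = D ^ ?n" by (simp add: card_PiE D_def)
      have lo: "ennreal ((4 ^ j) powr m * (1 / sqrt D) ^ ?n * (e / 4) * measure lborel (ball x0 r) powr (1 / p) * (real (card ?Z) * measure lborel (ball (0::real^'n) r)) powr (1 / q))
         \<le> mod_norm p q \<gamma> (psido sig ?f)"
      proof (rule lower[OF _ _ _ c(2) _ _ _ _ elim(1) lg2 lg3])
        show "norm (psido sig ?f x - of_real ((4 ^ j) powr m) * bf j x * ?f x) \<le> Ce * (4 ^ j) powr (m - real ?n - 1)" for x
          by (rule err) auto
        show "1 / 4 ^ j \<le> 1 / sqrt D" using sD by (intro divide_left_mono) (auto simp: l_def)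
        show "\<forall>l\<in>{0..<2 ^ N j}. norm (c l) \<le> 1 / sqrt D" "\<forall>\<kappa>\<in>?Z. \<forall>i. norm (c (\<kappa> i)) = 1 / sqrt D"
          by (auto simp: c(1) D_def)
      qed simp_all
      have v: "(4 ^ j) powr m * (1 / sqrt D) ^ ?n * (e / 4) * measure lborel (ball x0 r) powr (1 / p) * (real (card ?Z) * measure lborel (ball (0::real^'n) r)) powr (1 / q)
         = V * ((4 ^ j) powr m * (2 ^ N j) powr s)"
      proof -
        have 1: "(1 / sqrt D) ^ ?n = D powr (- real ?n / 2)"
        proof -
          have "1 / sqrt D = D powr (- (1 / 2))"
            using D1 by (simp add: powr_minus powr_half_sqrt inverse_eq_divide)
          then have "(1 / sqrt D) ^ ?n = (D powr (- (1 / 2))) powr real ?n"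
            using D1 by (simp only: powr_realpow[symmetric]) (simp add: powr_realpow)
          also have "\<dots> = D powr (- real ?n / 2)" unfolding powr_powr by simp
          finally show ?thesis .
        qed
        have "(D ^ ?n * measure lborel (ball (0::real^'n) r)) powr (1 / q) = (D ^ ?n) powr (1 / q) * Y"
          unfolding Y_def using D1 by (intro powr_mult)
        also have "(D ^ ?n) powr (1 / q) = D powr (real ?n / q)"
          using D1 by (simp add: powr_realpow[symmetric] powr_powr)
        finally have 2: "(D ^ ?n * measure lborel (ball (0::real^'n) r)) powr (1 / q) = D powr (real ?n / q) * Y" .
        have "D powr (- real ?n / 2) * D powr (real ?n / q) = D powr s"
          unfolding powr_add[symmetric] s_def using True q by (intro arg_cong2[where f="(powr)"]) (auto simp: field_simps abs_if)
        then show ?thesis unfolding cardZ 1 2 V_def X_def[symmetric] D_def[symmetric] by (simp only: mult_ac)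
      qed
      have up: "mod_norm p q \<gamma> ?f \<le> ennreal U"
        using upper[of "{0}" 1 "\<lambda>_. 1" "3/2 * 4 ^ j"] by (simp add: U_def)
      show ?thesis using compare[OF tgauss_vec_schwartz[OF a0] lo up U0] unfolding v .
    next
      case False
      obtain K1 K2 :: "int set" and c1 c2 :: "int \<Rightarrow> complex" where
        K1: "finite K1" "card K1 = 2 ^ N j" "\<And>l. norm (c1 l) = 1 / sqrt (2 ^ N j)" "\<And>l. l \<in> K1 \<Longrightarrow> \<bar>l\<bar> \<le> 2 ^ N j" and
        K2: "finite K2" "0 \<in> K2" "c2 0 = 1" "\<And>l. norm (c2 l) \<le> 1"
        "\<And>L a \<omega> z. rs_b (N j) L z * tgauss a K1 c1 (\<lambda>l. \<omega> + L * real_of_int l) z = tgauss a K2 c2 (\<lambda>l. \<omega> + L * real_of_int l) z"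
        by (rule rs_b_times_conj[of "N j"]) blast
      let ?f = "tgauss_vec a K1 c1 ?\<eta> :: real^'n \<Rightarrow> complex"
      \<comment> \<open>The packet at the centre, with coefficient one, already carries the lower
        bound; here the gain comes from the small norm of the input.\<close>
      let ?Z = "{\<lambda>_. 0} :: ('n \<Rightarrow> int) set"
      have sm: "(\<Sum>k\<in>K1. norm (c1 k)) \<le> 4 ^ j"
      proof -
        have "(\<Sum>k\<in>K1. norm (c1 k)) = D / sqrt D" by (simp add: K1 D_def)
        also have "\<dots> = sqrt D" using D1 by (simp add: real_div_sqrt)
        finally show ?thesis using sD by (simp add: l_def)
      qed
      have lo: "ennreal ((4 ^ j) powr m * 1 ^ ?n * (e / 4) * measure lborel (ball x0 r) powr (1 / p) * (real (card ?Z) * measure lborel (ball (0::real^'n) r)) powr (1 / q))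
         \<le> mod_norm p q \<gamma> (psido sig ?f)"
      proof (rule lower[OF _ K1(1) K2(1) K2(5) _ _ _ _ elim(1) lg2 lg3])
        show "norm (psido sig ?f x - of_real ((4 ^ j) powr m) * bf j x * ?f x) \<le> Ce * (4 ^ j) powr (m - real ?n - 1)" for x
          by (rule err) (use K1 sm in auto)
        show "\<forall>l\<in>K2. norm (c2 l) \<le> 1" "\<forall>\<kappa>\<in>?Z. \<forall>i. norm (c2 (\<kappa> i)) = 1" "1 / 4 ^ j \<le> (1::real)"
          using K2 by auto
      qed (use K2(2) in auto)
      have v: "(4 ^ j) powr m * 1 ^ ?n * (e / 4) * measure lborel (ball x0 r) powr (1 / p) * (real (card ?Z) * measure lborel (ball (0::real^'n) r)) powr (1 / q)
         = V * (4 ^ j) powr m"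
        by (simp add: V_def X_def Y_def)
      have up: "mod_norm p q \<gamma> ?f \<le> ennreal (U * D powr (- s))"
      proof -
        have "((1 / sqrt D) powr q * dec_sum_const powr (q - 1) * (real (card K1) * (\<integral>t. dec t ^ 3 \<partial>lborel))) powr (real ?n / q)
          = ((dec_sum_const powr (q - 1) * (\<integral>t. dec t ^ 3 \<partial>lborel)) * D powr (1 - q / 2)) powr (real ?n / q)"
        proof -
          have "(1 / sqrt D) powr q * D = D powr (1 - q / 2)"
            using D1 by (simp add: powr_half_sqrt[symmetric] powr_divide powr_powr powr_diff)
          moreover have "real (card K1) = D" by (simp add: K1 D_def)
          moreover have "A * B * (D * J) = (B * J) * (A * D)" for A B J by simp
          ultimately show ?thesis by (simp only:)
        qed
        also have "\<dots> = (dec_sum_const powr (q - 1) * (\<integral>t. dec t ^ 3 \<partial>lborel)) powr (real ?n / q) * (D powr (1 - q / 2)) powr (real ?n / q)"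
          using J0 by (intro powr_mult)
        also have "(D powr (1 - q / 2)) powr (real ?n / q) = D powr (- s)"
          unfolding powr_powr s_def using False by (intro arg_cong2[where f="(powr)"]) (auto simp: field_simps abs_if)
        finally have x: "((1 / sqrt D) powr q * dec_sum_const powr (q - 1) * (real (card K1) * (\<integral>t. dec t ^ 3 \<partial>lborel))) powr (real ?n / q)
          = (dec_sum_const powr (q - 1) * (\<integral>t. dec t ^ 3 \<partial>lborel)) powr (real ?n / q) * D powr (- s)" .
        have "mod_norm p q \<gamma> ?f \<le> ennreal (CV * (\<integral>x. wt 2 (x::real^'n) \<partial>lborel) powr (1 / p) * ((1 / sqrt D) powr q * dec_sum_const powr (q - 1) * (real (card K1) * (\<integral>t. dec t ^ 3 \<partial>lborel))) powr (real ?n / q))"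
          by (rule upper) (use K1 D1 in \<open>auto simp: D_def\<close>)
        then show ?thesis unfolding x U_def by (simp only: mult.assoc)
      qed
      have "V * (4 ^ j) powr m \<le> \<bar>C\<bar> * (U * D powr (- s))"
        using compare[OF tgauss_vec_schwartz[OF a0] lo up] U0 unfolding v by simp
      then have "V * (4 ^ j) powr m * D powr s \<le> \<bar>C\<bar> * (U * D powr (- s)) * D powr s" by (rule mult_right_mono) simp
      also have "\<dots> = \<bar>C\<bar> * U" using D1 by (simp add: powr_minus)
      finally show ?thesis by (simp add: D_def mult.assoc)
    qed
  qed
  then have "\<forall>\<^sub>F j in sequentially. (4 ^ j) powr m * (2 ^ N j) powr s \<le> \<bar>C\<bar> * U / V"
    by eventually_elim (use V in \<open>simp add: field_simps\<close>)
  then show ?thesis unfolding s_def by blast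
qed

end

theorem theorem1p1:
  fixes p q m \<delta> :: real
  assumes "1 < p" and "1 < q" and "0 < \<delta>" and "\<delta> < 1"
    and "m > - \<bar>1 / q - 1 / 2\<bar> * \<delta> * real CARD('n)"
  shows "\<exists>\<sigma> \<in> (symbol_class m 1 \<delta> :: ((real^'n::finite) \<times> (real^'n) \<Rightarrow> complex) set).
           \<forall>\<gamma> \<in> schwartz. \<gamma> \<noteq> (\<lambda>_. 0) \<longrightarrow>
             \<not> (\<exists>C::real. \<forall>f \<in> schwartz.
                   mod_norm p q \<gamma> (psido \<sigma> f) \<le> ennreal C * mod_norm p q \<gamma> f)"
proof -
  define s where "s = \<bar>1 / q - 1 / 2\<bar> * real CARD('n)"
  have s0: "0 \<le> s" by (simp add: s_def)
  have ms: "0 < m + \<delta> * s" using assms(5) by (simp add: s_def mult_ac)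
  \<comment> \<open>Giving up the small power 4^(j * kappa) makes the gaps L_j tend to infinity.\<close>
  define \<kappa> where "\<kappa> = min (\<delta> / 2) ((m + \<delta> * s) / (2 * (s + 1)))"
  have \<kappa>: "0 < \<kappa>" using assms(3) ms s0 by (simp add: \<kappa>_def)
  have \<kappa>\<delta>: "\<kappa> \<le> \<delta> / 2" unfolding \<kappa>_def by (rule min.cobounded1)
  \<comment> \<open>The loss in the exponent is thereby at most half of m + delta * s. The summand 1
    keeps the denominator positive at q = 2, where s = 0.\<close>
  have "\<kappa> * (s + 1) \<le> (m + \<delta> * s) / (2 * (s + 1)) * (s + 1)"
    using s0 by (intro mult_right_mono) (auto simp: \<kappa>_def)
  also have "\<dots> = (m + \<delta> * s) / 2" using s0 by (simp add: field_simps)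
  finally have E: "0 < m + (\<delta> - \<kappa>) * s" using ms \<kappa> by (simp add: algebra_simps)
  \<comment> \<open>4^(j*(delta - kappa)) is 2 to the power 2 * j * (delta - kappa). Rounding this
    exponent down gives a power of two at the cost of a factor of at most 2, and the gap takes up
    the rest of 4^(j*delta).\<close>
  define N where "N j = nat \<lfloor>2 * real j * (\<delta> - \<kappa>)\<rfloor>" for j
  define L where "L j = (4 ^ j) powr \<delta> / 2 ^ N j" for j
  have four: "(4 ^ j) powr y = (2::real) powr (2 * real j * y)" for j y
  proof -
    have "(4::real) ^ j = 2 powr (2 * real j)" by (simp add: powr_realpow[symmetric] powr_powr[symmetric])
    then show ?thesis by (simp add: powr_powr)
  qed
  have N: "2 * real j * (\<delta> - \<kappa>) - 1 \<le> real (N j)" "real (N j) \<le> 2 * real j * (\<delta> - \<kappa>)" for j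
  proof -
    have "0 \<le> 2 * real j * (\<delta> - \<kappa>)" using \<kappa>\<delta> assms(3) by simp
    then show "2 * real j * (\<delta> - \<kappa>) - 1 \<le> real (N j)" "real (N j) \<le> 2 * real j * (\<delta> - \<kappa>)"
      unfolding N_def by linarith+
  qed
  have two: "(2::real) ^ N j = 2 powr real (N j)" for j by (simp add: powr_realpow)
  obtain W where W: "deriv_seq W" "\<And>t. t \<in> {5/4..7/4} \<Longrightarrow> W 0 t = 1"
    "\<And>k t. t \<notin> {1..2} \<Longrightarrow> W k t = 0" "\<And>k. \<exists>C. \<forall>t. norm (W k t) \<le> C"
    using smooth_cutoff by blast
  interpret lacunary_symbol m \<delta> N L W
    by standard (use assms W in \<open>auto simp: L_def\<close>)
  have Llim: "filterlim L at_top sequentially"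
  proof (rule filterlim_at_top_mono[OF filterlim_four_powr[OF \<kappa>]])
    have "(4 ^ j) powr \<kappa> \<le> L j" for j
    proof -
      have "(4 ^ j) powr \<kappa> = 2 powr (2 * real j * \<delta> - 2 * real j * (\<delta> - \<kappa>))" unfolding four by (simp add: algebra_simps)
      also have "\<dots> \<le> 2 powr (2 * real j * \<delta> - real (N j))" using N(2)[of j] by simp
      also have "\<dots> = L j" unfolding L_def four two powr_diff ..
      finally show ?thesis .
    qed
    then show "\<forall>\<^sub>F j in sequentially. (4 ^ j) powr \<kappa> \<le> L j" by simp
  qed
  have "\<not> (\<exists>C::real. \<forall>f \<in> schwartz. mod_norm p q \<gamma> (psido sig f) \<le> ennreal C * mod_norm p q \<gamma> f)"
    if \<gamma>: "\<gamma> \<in> schwartz" "\<gamma> \<noteq> (\<lambda>_. 0)" for \<gamma> :: "real^'n \<Rightarrow> complex"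
  proof
    assume "\<exists>C::real. \<forall>f \<in> schwartz. mod_norm p q \<gamma> (psido sig f) \<le> ennreal C * mod_norm p q \<gamma> f"
    then obtain C :: real where C: "\<And>f. f \<in> schwartz \<Longrightarrow> mod_norm p q \<gamma> (psido sig f) \<le> ennreal C * mod_norm p q \<gamma> f" by blast
    have "1 \<le> p" "1 \<le> q" using assms by auto
    from psido_sig_gain[OF this \<gamma> C Llim] obtain B where
      B: "\<forall>\<^sub>F j in sequentially. (4 ^ j) powr m * (2 ^ N j) powr s \<le> B" unfolding s_def by blast
    \<comment> \<open>The factor 2^(-s) pays for the rounding in \<open>N j\<close>.\<close>
    have lower: "2 powr (- s) * (4 ^ j) powr (m + (\<delta> - \<kappa>) * s) \<le> (4 ^ j) powr m * (2 ^ N j) powr s" for j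
    proof -
      have "2 powr (- s) * (4 ^ j) powr (m + (\<delta> - \<kappa>) * s) = 2 powr (2 * real j * m + (2 * real j * (\<delta> - \<kappa>) - 1) * s)"
        unfolding four powr_add[symmetric] by (simp add: algebra_simps)
      also have "\<dots> \<le> 2 powr (2 * real j * m + real (N j) * s)"
        using mult_right_mono[OF N(1) s0, of j] by simp
      also have "\<dots> = (4 ^ j) powr m * (2 ^ N j) powr s" unfolding four two powr_powr powr_add ..
      finally show ?thesis .
    qed
    have "\<forall>\<^sub>F j in sequentially. 2 powr s * B + 1 \<le> (4 ^ j) powr (m + (\<delta> - \<kappa>) * s)"
      using filterlim_four_powr[OF E] by (auto simp: filterlim_at_top)
    with B have "\<forall>\<^sub>F j in sequentially. False"
    proof eventually_elim
      case (elim j)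
      have "(4 ^ j) powr (m + (\<delta> - \<kappa>) * s) = 2 powr s * (2 powr (- s) * (4 ^ j) powr (m + (\<delta> - \<kappa>) * s))"
        by (simp add: powr_minus)
      also have "\<dots> \<le> 2 powr s * B" using lower[of j] elim(1) by (intro mult_left_mono) auto
      finally show False using elim(2) by simp
    qed
    then show False by simp
  qed
  then show ?thesis using sig_symbol_class by blast
qed

end
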